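(* Let $X$ be a real random variable with distribution function $F$, satisfying $\mathbb{E}|\min(X,0)|<\infty$ and condition $\mathcal{C}_2(\gamma,a,\rho,A)$ (defined in the context; in particular $\gamma<0$) with $\rho<0$, and let $x^{\star}$ be the (finite) right endpoint of $F$. Then, as $\tau\uparrow 1$, \begin{align*} x^{\star} - \xi_{\tau} &= \frac{(x^{\star} - q_{\tau})^{\frac{1}{1-\gamma}}}{[(x^{\star}-\mathbb{E}(X))(1-\gamma^{-1})]^{\frac{\gamma}{1-\gamma}}} \Bigg( 1 - \left(\frac{x^{\star}-q_{\tau}}{(x^{\star}-\mathbb{E}(X))(1-\gamma^{-1})}\right)^{\frac{1}{1-\gamma}}(1+o(1)) \\ &\qquad +\frac{\gamma[(x^{\star}-\mathbb{E}(X))(1-\gamma^{-1})]^{-\frac{\rho}{1-\gamma}}}{\rho(\gamma+\rho)(1-\gamma-\rho)} A\left(\frac{(x^{\star} - q_{\tau})^{\frac{1}{1-\gamma}}}{1-\tau}\right)(1+o(1)) \Bigg). \end{align*} In particular, as $\tau\uparrow 1$, \[ x^{\star} - \xi_{\tau} = \frac{(x^{\star} - q_{\tau})^{\frac{1}{1-\gamma}}}{ [(x^{\star}-\mathbb{E}(X))(1-\gamma^{-1})]^{\frac{\gamma}{1-\gamma}}} \left( 1 + O\big((1-\tau)^{-\frac{\gamma}{1-\gamma}}\big) + O\big(|A((1-\tau)^{-\frac{1}{1-\gamma}})|\big) \right). \]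
   Context: Notation. $F(x)=\mathbb{P}(X\le x)$, $\overline F=1-F$, $q_\tau=\inf\{x\in\mathbb{R}: F(x)\ge\tau\}$ is the quantile function, $U(s)=q_{1-s^{-1}}$ ($s>1$) is the tail quantile function, and $x^\star=\sup\{x\in\mathbb{R}:F(x)<1\}$ is the right endpoint. Expectiles. For $\tau\in(0,1)$ and $X$ with finite first moment, the $\tau$th expectile of $X$ is $\xi_\tau=\arg\min_{\theta\in\mathbb{R}}\mathbb{E}[\eta_\tau(X-\theta)-\eta_\tau(X)]$, where $\eta_\tau(x)=|\tau-\mathbf{1}\{x\le 0\}|\,x^2$; it exists and is unique. Condition $\mathcal{C}_2(\gamma,a,\rho,A)$: there exist $\gamma<0$, $\rho\le 0$, a positive function $a(\cdot)$ and a measurable function $A(\cdot)$ having constant sign and converging to $0$ at infinity such that, for all $z>0$, \[ \lim_{s \to \infty} \frac{1}{A(s)} \left( \frac{U(sz)-U(s)}{a(s)}-\frac{z^{\gamma}-1}{\gamma} \right) = \int_1^z v^{\gamma-1} \left( \int_1^v u^{\rho-1}\, \mathrm{d}u \right) \mathrm{d}v. \] Under this condition $x^\star$ is finite, and together with $\mathbb{E}|\min(X,0)|<\infty$ this gives $\mathbb{E}|X|<\infty$. *)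

theory Defs
  imports "HOL-Probability.Probability"
begin

text \<open>
  Throughout, \<open>X\<close> is a real random variable on the probability space \<open>M\<close>, and its distribution
  function is \<open>cdf (distr M borel X)\<close>.
\<close>

text \<open>Meaningful for \<open>0 < \<tau> < 1\<close>, where the set is nonempty and bounded below.\<close>

definition quantile :: "'a measure \<Rightarrow> ('a \<Rightarrow> real) \<Rightarrow> real \<Rightarrow> real" where
  "quantile M X \<tau> = Inf {x. cdf (distr M borel X) x \<ge> \<tau>}"

text \<open>Meaningful for \<open>s > 1\<close>.\<close>

definition tail_quantile :: "'a measure \<Rightarrow> ('a \<Rightarrow> real) \<Rightarrow> real \<Rightarrow> real" where
  "tail_quantile M X s = quantile M X (1 - inverse s)"

text \<open>
  The supremum is taken in \<^typ>\<open>real\<close>, so this is the right endpoint only when that endpoint is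
  finite. The condition \<open>second_order_cond\<close> below, having \<open>\<gamma> < 0\<close>, forces this.
\<close>

definition right_endpoint :: "'a measure \<Rightarrow> ('a \<Rightarrow> real) \<Rightarrow> real" where
  "right_endpoint M X = Sup {x. cdf (distr M borel X) x < 1}"

definition expectile_loss :: "real \<Rightarrow> real \<Rightarrow> real" where
  "expectile_loss \<tau> x = \<bar>\<tau> - of_bool (x \<le> 0)\<bar> * x\<^sup>2"

text \<open>
  Subtracting the loss at \<open>X\<close> makes the integrand integrable as soon as \<open>X\<close> is; the minimiser then
  exists and is unique for \<open>0 < \<tau> < 1\<close>.
\<close>

definition expectile :: "'a measure \<Rightarrow> ('a \<Rightarrow> real) \<Rightarrow> real \<Rightarrow> real" where
  "expectile M X \<tau> =
     arg_min (\<lambda>\<theta>. \<integral>\<omega>. (expectile_loss \<tau> (X \<omega> - \<theta>) - expectile_loss \<tau> (X \<omega>)) \<partial>M) (\<lambda>_. True)"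

text \<open>
  The second-order condition on a tail quantile function \<open>U\<close>. The functions \<open>U\<close>, \<open>a\<close> and \<open>A\<close> matter
  only on \<open>(1, \<infinity>)\<close>. Constant sign means strictly positive or strictly negative, since the
  condition divides by \<open>A\<close>. The integrals are oriented, as \<open>z < 1\<close> is allowed.
\<close>

definition second_order_cond ::
  "(real \<Rightarrow> real) \<Rightarrow> real \<Rightarrow> (real \<Rightarrow> real) \<Rightarrow> real \<Rightarrow> (real \<Rightarrow> real) \<Rightarrow> bool" where
  "second_order_cond U \<gamma> a \<rho> A \<longleftrightarrow>
     \<gamma> < 0 \<and> \<rho> \<le> 0 \<and>
     (\<forall>s>1. a s > 0) \<and>
     A \<in> borel_measurable (restrict_space borel {1<..}) \<and>
     ((\<forall>s>1. A s > 0) \<or> (\<forall>s>1. A s < 0)) \<and>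
     (A \<longlongrightarrow> 0) at_top \<and>
     (\<forall>z>0.
        ((\<lambda>s. 1 / A s * ((U (s * z) - U s) / a s - (z powr \<gamma> - 1) / \<gamma>))
           \<longlongrightarrow> (LBINT v=1..z. v powr (\<gamma> - 1) * (LBINT u=1..v. u powr (\<rho> - 1)))) at_top)"

end

theory Submission
  imports Defs
begin

text \<open>
  Write \<open>x\<close> for the right endpoint, \<open>V = x - U\<close> and \<open>b = \<gamma> / (\<rho> (\<gamma> + \<rho>))\<close>. Taking increments of the
  second-order condition along two scales eliminates \<open>a\<close> and shows that \<open>\<bar>A\<bar>\<close> is regularly varying of
  index \<open>\<rho>\<close>; summing increments over \<open>s, 2 s, 4 s, \<dots>\<close> then gives that \<open>x\<close> is finite and, because \<open>\<rho> < 0\<close>, that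
  \<open>V s = c s\<^sup>\<gamma> (1 + b A s (1 + o(1)))\<close> for some \<open>c > 0\<close>. With \<open>\<eta> = c s\<^sup>\<gamma>\<close>, the quantile transform turns
  \<open>E (X - (x - \<eta>))\<^sub>+\<close> into \<open>(\<eta> / s) J s\<close>, where \<open>J s = \<integral> (1 - V (s / v) / \<eta>)\<^sub>+ dv\<close> has the expansion
  \<open>- \<gamma> / (1 - \<gamma>) - b A s / (1 - \<gamma> - \<rho>) (1 + o(1))\<close> by dominated convergence. The expectile solves the
  first-order condition \<open>(2 \<tau> - 1) E (X - \<xi>)\<^sub>+ = (1 - \<tau>) (\<xi> - E X)\<close>, which for \<open>\<eta> = x - \<xi>\<close> becomes linear
  in \<open>ln \<eta>\<close>, \<open>ln (x - q)\<close> and small correction terms after taking logarithms.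
\<close>

section \<open>Tail summation and uniform convergence\<close>

text \<open>The condition gives limits for each fixed \<open>z\<close> only, whereas three later
  steps need control at moving arguments: filling the gaps between powers of two, dominating the
  excess integral, and evaluating \<open>A\<close> where the multiplier depends on \<tau>.
  Measurability of \<open>A\<close> and \<open>V\<close> supplies this, through uniform convergence
  on compact sets of multipliers. Because \<open>\<rho> < 0\<close>, \<open>V\<close> is compared
  with an exact power, so \<open>\<eta> = c * s powr \<gamma>\<close> defines \<open>s\<close>
  explicitly and \<open>V\<close>, which is only monotone, never has to be inverted. Two scales then
  compete: \<open>T = 1 / (1 - \<tau>)\<close> for the quantile and the much smaller
  \<open>s\<close> for the expectile. As \<open>T / s\<close> tends to infinity, \<open>A T\<close>
  is negligible against \<open>A s\<close>, which is why a single term in \<open>A\<close> survives.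
  Likewise \<open>1 - \<tau>\<close> is negligible against \<open>\<eta>\<close>, so the factor
  \<open>2 * \<tau> - 1\<close> leaves no trace. The constant \<open>K\<close> is
  \<open>m / p\<close>, with \<open>m\<close> the distance from the mean to the endpoint and
  \<open>p = - \<gamma> / (1 - \<gamma>)\<close> the limit of \<open>J\<close>.\<close>

lemma dyadic_tail_bound:
  fixes f R :: "real \<Rightarrow> real"
  assumes f: "(f \<longlongrightarrow> 0) at_top" and l: "0 \<le> l" "l < 1" and d: "0 \<le> d"
    and R: "\<forall>\<^sub>F s in at_top. \<bar>R (2 * s)\<bar> \<le> l * \<bar>R s\<bar>"
    and inc: "\<forall>\<^sub>F s in at_top. \<bar>f (2 * s) - f s\<bar> \<le> d * \<bar>R s\<bar>"
  shows "\<forall>\<^sub>F s in at_top. \<bar>f s\<bar> \<le> d / (1 - l) * \<bar>R s\<bar>"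
proof -
  obtain s0 where s0: "\<And>s. s \<ge> s0 \<Longrightarrow> \<bar>R (2 * s)\<bar> \<le> l * \<bar>R s\<bar> \<and> \<bar>f (2 * s) - f s\<bar> \<le> d * \<bar>R s\<bar>"
    using eventually_conj[OF R inc] unfolding eventually_at_top_linorder by blast
  have "\<bar>f s\<bar> \<le> d / (1 - l) * \<bar>R s\<bar>" if s: "s \<ge> max s0 1" for s
  proof -
    have pw: "2 ^ n * s \<ge> s0" for n :: nat
    proof -
      have "1 * s \<le> 2 ^ n * s" using s by (intro mult_right_mono) auto
      thus ?thesis using s by linarith
    qed
    have Rn: "\<bar>R (2 ^ n * s)\<bar> \<le> l ^ n * \<bar>R s\<bar>" for n
    proof (induction n)
      case (Suc n)
      have "\<bar>R (2 ^ Suc n * s)\<bar> \<le> l * \<bar>R (2 ^ n * s)\<bar>" using s0[OF pw[of n]] by (simp add: mult.assoc)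
      also have "\<dots> \<le> l * (l ^ n * \<bar>R s\<bar>)" using Suc l by (intro mult_left_mono) auto
      finally show ?case by simp
    qed simp
    \<comment> \<open>Telescoping along \<open>s, 2 s, 4 s, ...\<close>; the term
      \<open>f (2 ^ n * s)\<close> disappears in the limit because \<open>f\<close> tends to
      0.\<close>
    have fn: "\<bar>f s\<bar> \<le> \<bar>f (2 ^ n * s)\<bar> + d * \<bar>R s\<bar> * (\<Sum>i<n. l ^ i)" for n
    proof (induction n)
      case (Suc n)
      have "\<bar>f (2 ^ Suc n * s) - f (2 ^ n * s)\<bar> \<le> d * \<bar>R (2 ^ n * s)\<bar>"
        using s0[OF pw[of n]] by (simp add: mult.assoc)
      also have "\<dots> \<le> d * (l ^ n * \<bar>R s\<bar>)" using Rn d by (intro mult_left_mono) auto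
      finally show ?case using Suc by (simp add: algebra_simps)
    qed simp
    have geo: "(\<Sum>i<n. l ^ i) \<le> 1 / (1 - l)" for n
    proof -
      have "(\<Sum>i<n. l ^ i) = (1 - l ^ n) / (1 - l)" using l sum_gp_strict[of l n] by simp
      also have "\<dots> \<le> 1 / (1 - l)" using l by (intro divide_right_mono) auto
      finally show ?thesis .
    qed
    have bd: "\<bar>f s\<bar> \<le> \<bar>f (2 ^ n * s)\<bar> + d / (1 - l) * \<bar>R s\<bar>" for n
    proof -
      have "d * \<bar>R s\<bar> * (\<Sum>i<n. l ^ i) \<le> d * \<bar>R s\<bar> * (1 / (1 - l))"
        using geo d by (intro mult_left_mono) auto
      thus ?thesis using fn[of n] by simp
    qed
    have "filterlim (\<lambda>n. s * 2 ^ n) at_top sequentially"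
    proof (rule filterlim_at_top_mono[OF filterlim_real_sequentially], intro always_eventually allI)
      fix n
      have "real n * 1 \<le> 2 ^ n * s"
        using s of_nat_less_two_power[of n, where 'a = real] by (intro mult_mono) auto
      thus "real n \<le> s * 2 ^ n" by (simp add: mult.commute)
    qed
    hence "(\<lambda>n. f (s * 2 ^ n)) \<longlonglongrightarrow> 0" using f filterlim_compose by blast
    hence "(\<lambda>n. \<bar>f (2 ^ n * s)\<bar> + d / (1 - l) * \<bar>R s\<bar>) \<longlonglongrightarrow> \<bar>0\<bar> + d / (1 - l) * \<bar>R s\<bar>"
      by (intro tendsto_intros) (simp add: mult.commute)
    from LIMSEQ_le_const[OF this] bd show ?thesis by auto
  qed
  thus ?thesis unfolding eventually_at_top_linorder by blast
qed

text \<open>Subtracting \<open>k / (q - 1) * R\<close> from \<open>f\<close> removes the leading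
  part of its increments, since \<open>R (2 * s) - R s\<close> behaves like
  \<open>(q - 1) * R s\<close>. The difference \<open>g\<close> then satisfies the hypothesis of the
  preceding bound with arbitrarily small \<open>d\<close>.\<close>

lemma dyadic_tail_limit:
  fixes f R :: "real \<Rightarrow> real"
  assumes f: "(f \<longlongrightarrow> 0) at_top" and R: "(R \<longlongrightarrow> 0) at_top"
    and ratio: "((\<lambda>s. R (2 * s) / R s) \<longlongrightarrow> q) at_top" and q: "\<bar>q\<bar> < 1"
    and nz: "\<forall>\<^sub>F s in at_top. R s \<noteq> 0"
    and inc: "((\<lambda>s. (f (2 * s) - f s) / R s) \<longlongrightarrow> k) at_top"
  shows "((\<lambda>s. f s / R s) \<longlongrightarrow> k / (q - 1)) at_top"
proof -
  define g where "g s = f s - k / (q - 1) * R s" for s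
  define l where "l = (1 + \<bar>q\<bar>) / 2"
  have l: "0 \<le> l" "l < 1" "\<bar>q\<bar> < l" using q unfolding l_def by auto
  have g0: "(g \<longlongrightarrow> 0) at_top"
    unfolding g_def using tendsto_diff[OF f tendsto_mult[OF tendsto_const R], of "k / (q - 1)"] by simp
  have Rl: "\<forall>\<^sub>F s in at_top. \<bar>R (2 * s)\<bar> \<le> l * \<bar>R s\<bar>"
    using order_tendstoD(2)[OF tendsto_rabs[OF ratio] l(3)] nz
    by eventually_elim (simp add: field_simps)
  have gi: "((\<lambda>s. (g (2 * s) - g s) / R s) \<longlongrightarrow> 0) at_top"
  proof -
    have "((\<lambda>s. (f (2 * s) - f s) / R s - k / (q - 1) * (R (2 * s) / R s - 1)) \<longlongrightarrow>
        k - k / (q - 1) * (q - 1)) at_top"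
      by (intro tendsto_intros inc ratio)
    moreover have "\<forall>\<^sub>F s in at_top. (f (2 * s) - f s) / R s - k / (q - 1) * (R (2 * s) / R s - 1)
        = (g (2 * s) - g s) / R s"
      using nz by eventually_elim (simp add: g_def diff_divide_distrib right_diff_distrib)
    ultimately show ?thesis using q by (simp add: tendsto_cong)
  qed
  have "((\<lambda>s. g s / R s) \<longlongrightarrow> 0) at_top"
  proof (rule tendstoI)
    fix e :: real assume e: "e > 0"
    \<comment> \<open>The tail bound becomes \<open>e / 2\<close>; the other half of
      \<open>e\<close> makes the final inequality strict.\<close>
    define d where "d = e / 2 * (1 - l)"
    have dl: "d / (1 - l) = e / 2" using l(2) unfolding d_def by (subst nonzero_mult_div_cancel_right) auto
    have d: "d > 0" using e l unfolding d_def by simp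
    have "\<forall>\<^sub>F s in at_top. \<bar>g (2 * s) - g s\<bar> \<le> d * \<bar>R s\<bar>"
      using tendstoD[OF gi d] nz by eventually_elim (simp add: field_simps)
    from dyadic_tail_bound[OF g0 l(1,2) less_imp_le[OF d] Rl this] nz
    show "\<forall>\<^sub>F s in at_top. dist (g s / R s) 0 < e"
    proof eventually_elim
      case (elim s)
      have "\<bar>g s\<bar> \<le> e / 2 * \<bar>R s\<bar>" using elim(1) unfolding dl .
      also have "\<dots> < e * \<bar>R s\<bar>" using e elim(2) by simp
      finally show ?case using elim(2) by (simp add: field_simps)
    qed
  qed
  hence "((\<lambda>s. g s / R s + k / (q - 1)) \<longlongrightarrow> 0 + k / (q - 1)) at_top"
    by (intro tendsto_intros)
  moreover have "\<forall>\<^sub>F s in at_top. g s / R s + k / (q - 1) = f s / R s"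
    using nz by eventually_elim (simp add: g_def diff_divide_distrib)
  ultimately show ?thesis by (simp add: tendsto_cong)
qed

text \<open>The quotient rule for expansions of the form \<open>p0 + p1 * A + o(A)\<close>.
  Normalising factors such as \<open>a\<close> are eliminated below by taking quotients of two such
  expansions.\<close>

lemma quotient_first_order_limit:
  fixes p q A :: "'b \<Rightarrow> real"
  assumes p: "((\<lambda>x. (p x - p0) / A x) \<longlongrightarrow> p1) F" and q: "((\<lambda>x. (q x - q0) / A x) \<longlongrightarrow> q1) F"
    and A: "(A \<longlongrightarrow> 0) F" and nz: "\<forall>\<^sub>F x in F. A x \<noteq> 0" and q0: "q0 \<noteq> 0"
  shows "((\<lambda>x. (p x / q x - p0 / q0) / A x) \<longlongrightarrow> (p1 * q0 - p0 * q1) / q0\<^sup>2) F"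
proof -
  have ql: "(q \<longlongrightarrow> q0) F"
  proof -
    have "((\<lambda>x. (q x - q0) / A x * A x + q0) \<longlongrightarrow> q1 * 0 + q0) F"
      by (intro tendsto_intros q A)
    moreover have "\<forall>\<^sub>F x in F. (q x - q0) / A x * A x + q0 = q x"
      using nz by eventually_elim simp
    ultimately show ?thesis by (simp add: tendsto_cong)
  qed
  have "((\<lambda>x. ((p x - p0) / A x * q0 - p0 * ((q x - q0) / A x)) / (q x * q0)) \<longlongrightarrow>
      (p1 * q0 - p0 * q1) / (q0 * q0)) F"
    by (intro tendsto_intros p q ql) (use q0 in auto)
  moreover have "\<forall>\<^sub>F x in F. ((p x - p0) / A x * q0 - p0 * ((q x - q0) / A x)) / (q x * q0)
      = (p x / q x - p0 / q0) / A x"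
    using nz tendsto_imp_eventually_ne[OF ql q0]
    by eventually_elim (use q0 in \<open>simp add: field_simps\<close>)
  ultimately show ?thesis by (simp add: tendsto_cong power2_eq_square)
qed

text \<open>
  A violating sequence \<open>x\<^sub>n\<close>, \<open>u\<^sub>n\<close> is refuted by comparing both \<open>h (x\<^sub>n)\<close> and \<open>h (x\<^sub>n + u\<^sub>n)\<close> with \<open>h (x\<^sub>n + v)\<close>
  and averaging over \<open>v\<close>: the truncated differences tend to \<open>0\<close> in mean by dominated convergence.
\<close>

lemma uniform_shift_convergence:
  fixes h :: "real \<Rightarrow> real"
  assumes [measurable]: "h \<in> borel_measurable borel"
    and lim: "\<And>u. ((\<lambda>x. h (x + u) - h x) \<longlongrightarrow> 0) at_top" and e: "e > 0"
  shows "\<forall>\<^sub>F x in at_top. \<forall>u. \<bar>u\<bar> \<le> N \<longrightarrow> \<bar>h (x + u) - h x\<bar> < e"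
proof (rule ccontr)
  assume "\<not> ?thesis"
  hence "\<forall>n::nat. \<exists>x u. x \<ge> real n \<and> \<bar>u\<bar> \<le> N \<and> \<bar>h (x + u) - h x\<bar> \<ge> e"
    unfolding eventually_at_top_linorder by (auto simp: not_less)
  then obtain x u where x: "\<And>n::nat. x n \<ge> real n" and u: "\<And>n. \<bar>u n\<bar> \<le> N"
    and xu: "\<And>n. \<bar>h (x n + u n) - h (x n)\<bar> \<ge> e" by metis
  have N: "N \<ge> 0" using u[of 0] by linarith
  have xlim: "filterlim x at_top sequentially"
    by (rule filterlim_at_top_mono[OF filterlim_real_sequentially]) (use x in auto)
  have ylim: "filterlim (\<lambda>n. x n + u n) at_top sequentially"
  proof (rule filterlim_at_top_mono)
    show "filterlim (\<lambda>n. - N + real n) at_top sequentially"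
      by (rule filterlim_tendsto_add_at_top[OF tendsto_const filterlim_real_sequentially])
    show "\<forall>\<^sub>F n in sequentially. - N + real n \<le> x n + u n"
    proof (intro always_eventually allI)
      fix n show "- N + real n \<le> x n + u n" using x[of n] u[of n] by linarith
    qed
  qed
  \<comment> \<open>Truncation at 1 gives domination without any integrability of \<open>h\<close>,
    and it preserves the triangle inequality on which the comparison rests.\<close>
  define \<phi> :: "real \<Rightarrow> real" where "\<phi> t = min 1 \<bar>t\<bar>" for t
  have [measurable]: "\<phi> \<in> borel_measurable borel" unfolding \<phi>_def by measurable
  have \<phi>0: "(\<lambda>n. \<phi> (g n)) \<longlonglongrightarrow> 0" if "g \<longlonglongrightarrow> 0" for g :: "nat \<Rightarrow> real"
  proof -
    have "(\<lambda>n. min 1 \<bar>g n\<bar>) \<longlonglongrightarrow> min 1 \<bar>0\<bar>" by (intro tendsto_intros that)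
    thus ?thesis unfolding \<phi>_def by simp
  qed
  \<comment> \<open>As \<open>\<bar>u n\<bar> \<le> N\<close>, both the unit interval
    \<open>{N..N+1}\<close> and its translate by \<open>- u n\<close> lie in \<open>J\<close>. The
    comparison is made for \<open>v\<close> in that unit interval.\<close>
  define J where "J = {0..2 * N + 1}"
  have int: "(\<lambda>n. \<integral>v. indicator J v * \<phi> (h (z n + v) - h (z n)) \<partial>lborel) \<longlonglongrightarrow> 0"
    if z: "filterlim z at_top sequentially" for z :: "nat \<Rightarrow> real"
  proof -
    have "(\<lambda>n. \<integral>v. indicator J v * \<phi> (h (z n + v) - h (z n)) \<partial>lborel) \<longlonglongrightarrow> (\<integral>v. 0 \<partial>(lborel::real measure))"
    proof (rule integral_dominated_convergence)
      show "integrable lborel (indicator J :: real \<Rightarrow> real)"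
        unfolding J_def using N by (intro integrable_real_indicator) auto
      show "AE v in lborel. (\<lambda>n. indicator J v * \<phi> (h (z n + v) - h (z n))) \<longlonglongrightarrow> 0"
      proof (rule AE_I2)
        fix v :: real
        have "(\<lambda>n. h (z n + v) - h (z n)) \<longlonglongrightarrow> 0" using filterlim_compose[OF lim z] by simp
        from tendsto_mult[OF tendsto_const \<phi>0[OF this]]
        show "(\<lambda>n. indicator J v * \<phi> (h (z n + v) - h (z n))) \<longlonglongrightarrow> 0" by simp
      qed
      show "AE v in lborel. norm (indicator J v * \<phi> (h (z n + v) - h (z n))) \<le> indicator J v" for n
        by (rule AE_I2) (auto simp: \<phi>_def indicator_def)
      show "(\<lambda>v. indicator J v * \<phi> (h (z n + v) - h (z n))) \<in> borel_measurable lborel" for n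
        unfolding J_def by measurable
    qed simp
    thus ?thesis by simp
  qed
  have intg: "integrable lborel (\<lambda>v. indicator J v * \<phi> (h (z + v) - h z))" for z
    by (rule Bochner_Integration.integrable_bound[of _ "indicator J :: real \<Rightarrow> real"])
      (use N in \<open>auto simp: J_def \<phi>_def indicator_def intro!: integrable_real_indicator\<close>)
  have key: "\<phi> (h (x n + u n) - h (x n)) \<le> (\<integral>v. indicator J v * \<phi> (h (x n + v) - h (x n)) \<partial>lborel)
     + (\<integral>v. indicator J v * \<phi> (h (x n + u n + v) - h (x n + u n)) \<partial>lborel)" for n
  proof -
    let ?f = "\<lambda>v. indicator J v * \<phi> (h (x n + v) - h (x n))"
    let ?g = "\<lambda>v. indicator J v * \<phi> (h (x n + u n + v) - h (x n + u n))"
    let ?c = "\<phi> (h (x n + u n) - h (x n))"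
    have g': "integrable lborel (\<lambda>v. ?g (- u n + 1 * v))"
      using lborel_integrable_real_affine_iff[of 1 ?g "- u n"] intg by simp
    have "?c = (\<integral>v. indicator {N..N+1} v * ?c \<partial>lborel)" by simp
    also have "\<dots> \<le> (\<integral>v. ?f v + ?g (- u n + 1 * v) \<partial>lborel)"
    proof (rule integral_mono)
      show "integrable lborel (\<lambda>v. ?f v + ?g (- u n + 1 * v))"
        using intg g' by (intro Bochner_Integration.integrable_add) auto
      show "integrable lborel (\<lambda>v. indicator {N..N+1} v * ?c)" by simp
      fix v :: real
      show "indicator {N..N+1} v * ?c \<le> ?f v + ?g (- u n + 1 * v)"
      proof (cases "v \<in> {N..N+1}")
        case True
        hence "v \<in> J" "- u n + v \<in> J" using u[of n] N unfolding J_def by auto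
        moreover have "min 1 \<bar>a - b\<bar> \<le> min 1 \<bar>c - b\<bar> + min 1 \<bar>c - a\<bar>" for a b c :: real by linarith
        ultimately show ?thesis using True unfolding \<phi>_def by (simp add: add.commute)
      next
        case False thus ?thesis by (auto simp: indicator_def \<phi>_def)
      qed
    qed
    also have "\<dots> = (\<integral>v. ?f v \<partial>lborel) + (\<integral>v. ?g (- u n + 1 * v) \<partial>lborel)"
      using intg g' by (intro Bochner_Integration.integral_add) auto
    also have "(\<integral>v. ?g (- u n + 1 * v) \<partial>lborel) = (\<integral>v. ?g v \<partial>lborel)"
      using lborel_integral_real_affine[of 1 ?g "- u n"] by simp
    finally show ?thesis .
  qed
  have "(\<lambda>n. \<phi> (h (x n + u n) - h (x n))) \<longlonglongrightarrow> 0"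
  proof (rule real_tendsto_sandwich[OF _ _ tendsto_const])
    show "\<forall>\<^sub>F n in sequentially. 0 \<le> \<phi> (h (x n + u n) - h (x n))" by (simp add: \<phi>_def)
    show "(\<lambda>n. (\<integral>v. indicator J v * \<phi> (h (x n + v) - h (x n)) \<partial>lborel)
     + (\<integral>v. indicator J v * \<phi> (h (x n + u n + v) - h (x n + u n)) \<partial>lborel)) \<longlonglongrightarrow> 0"
      using tendsto_add[OF int[OF xlim] int[OF ylim]] by simp
  qed (use key in auto)
  from order_tendstoD(2)[OF this, of "min 1 e"] e
  obtain n where "\<phi> (h (x n + u n) - h (x n)) < min 1 e"
    by (auto simp: eventually_sequentially)
  thus False using xu[of n] unfolding \<phi>_def by (auto simp: min_def split: if_splits)
qed

section \<open>Regularly varying functions\<close>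

text \<open>Only the values on \<open>(1, \<infinity>)\<close> matter.\<close>

definition regvar :: "(real \<Rightarrow> real) \<Rightarrow> real \<Rightarrow> bool" where
  "regvar R \<rho> \<longleftrightarrow> R \<in> borel_measurable (restrict_space borel {1<..}) \<and> (\<forall>s>1. R s > 0) \<and>
     (\<forall>z>0. ((\<lambda>s. R (s * z) / R s) \<longlongrightarrow> z powr \<rho>) at_top)"

text \<open>Karamata's uniform convergence theorem. In the coordinate \<open>x = ln s\<close>
  multiplication by \<open>z\<close> becomes a shift, and the increments of
  \<open>h x = ln (R (exp x)) - \<rho> * x\<close> over fixed shifts vanish at infinity.\<close>

lemma regvar_uniform:
  assumes R: "regvar R \<rho>" and e: "e > 0" and b: "0 < b"
  shows "\<forall>\<^sub>F s in at_top. \<forall>z. 1 / b \<le> z \<and> z \<le> b \<longrightarrow> \<bar>ln (R (s * z) / R s) - \<rho> * ln z\<bar> < e"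
proof -
  \<comment> \<open>The value 0 on the left half-line makes \<open>h\<close> Borel on all reals
    although \<open>R\<close> is measurable only on \<open>(1, \<infinity>)\<close>; limits at
    infinity do not see it.\<close>
  define h where "h x = (if x > 0 then ln (R (exp x)) - \<rho> * x else 0)" for x
  have Rm: "R \<in> borel_measurable (restrict_space borel {1<..})" and Rp: "\<And>s. s > 1 \<Longrightarrow> R s > 0"
    and Rl: "\<And>z. z > 0 \<Longrightarrow> ((\<lambda>s. R (s * z) / R s) \<longlongrightarrow> z powr \<rho>) at_top"
    using R unfolding regvar_def by auto
  have hm: "h \<in> borel_measurable borel"
  proof -
    have e: "exp \<in> restrict_space borel {0<..} \<rightarrow>\<^sub>M restrict_space borel {1::real<..}"
      by (rule measurable_restrict_space3) auto
    have "(\<lambda>x. ln (R (exp x)) - \<rho> * x) \<in> borel_measurable (restrict_space borel {0<..})"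
    proof (rule borel_measurable_diff)
      show "(\<lambda>x. ln (R (exp x))) \<in> borel_measurable (restrict_space borel {0<..})"
        using measurable_compose[OF measurable_compose[OF e Rm] borel_measurable_ln[OF measurable_ident]]
        by simp
      show "(\<lambda>x. \<rho> * x) \<in> borel_measurable (restrict_space borel {0<..})"
        by (rule measurable_restrict_space1) simp
    qed
    hence "(\<lambda>x. if x \<in> {0<..} then ln (R (exp x)) - \<rho> * x else 0) \<in> borel_measurable borel"
      by (subst measurable_If_restrict_space_iff) (auto simp: greaterThan_def)
    thus ?thesis unfolding h_def by simp
  qed
  have split: "h (x + u) - h x = ln (R (exp x * exp u) / R (exp x)) - \<rho> * u" if "x > 0" "x + u > 0" for x u
    using that Rp[of "exp x"] Rp[of "exp x * exp u"]
    by (simp add: h_def exp_add[symmetric] ln_div algebra_simps)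
  have "((\<lambda>x. h (x + u) - h x) \<longlongrightarrow> 0) at_top" for u
  proof -
    have "((\<lambda>x. R (exp x * exp u) / R (exp x)) \<longlongrightarrow> exp u powr \<rho>) at_top"
      using filterlim_compose[OF Rl[of "exp u"] exp_at_top] by simp
    hence "((\<lambda>x. ln (R (exp x * exp u) / R (exp x)) - \<rho> * u) \<longlongrightarrow> ln (exp u powr \<rho>) - \<rho> * u) at_top"
      by (intro tendsto_intros) auto
    hence "((\<lambda>x. ln (R (exp x * exp u) / R (exp x)) - \<rho> * u) \<longlongrightarrow> 0) at_top"
      by (simp add: ln_powr)
    moreover have "\<forall>\<^sub>F x in at_top. h (x + u) - h x = ln (R (exp x * exp u) / R (exp x)) - \<rho> * u"
      using eventually_gt_at_top[of 0] eventually_gt_at_top[of "- u"]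
      by eventually_elim (rule split, auto)
    ultimately show ?thesis by (simp add: tendsto_cong)
  qed
  from uniform_shift_convergence[OF hm this e, of "ln b"]
  have "\<forall>\<^sub>F s in at_top. \<forall>u. \<bar>u\<bar> \<le> ln b \<longrightarrow> \<bar>h (ln s + u) - h (ln s)\<bar> < e"
    using ln_at_top unfolding filterlim_iff by blast
  thus ?thesis using eventually_gt_at_top[of 1] eventually_gt_at_top[of b]
  proof eventually_elim
    case (elim s)
    show ?case
    proof (intro allI impI, elim conjE)
      fix z assume z: "1 / b \<le> z" "z \<le> b"
      have z0: "z > 0" using z(1) b by (smt (verit) zero_less_divide_1_iff)
      have "ln (1 / b) \<le> ln z" "ln z \<le> ln b" using z z0 b by (auto intro!: ln_mono)
      hence u: "\<bar>ln z\<bar> \<le> ln b" using b by (simp add: ln_div)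
      have "ln s > ln b" using elim b by simp
      hence "ln s + ln z > 0" "ln s > 0" using u elim by auto
      thus "\<bar>ln (R (s * z) / R s) - \<rho> * ln z\<bar> < e"
        using elim(1)[rule_format, OF u] split[of "ln s" "ln z"] z0 elim(2) by simp
    qed
  qed
qed

text \<open>The multiplier \<open>y\<close> may move as long as it converges to a positive number;
  this is where uniformity, rather than the pointwise limit, is used.\<close>

lemma regvar_tendsto:
  assumes R: "regvar R \<rho>" and f: "filterlim f at_top F" and y: "(y \<longlongrightarrow> l) F" and l: "l > 0"
  shows "((\<lambda>x. R (f x * y x) / R (f x)) \<longlongrightarrow> l powr \<rho>) F"
proof -
  have Rp: "\<And>s. s > 1 \<Longrightarrow> R s > 0" using R unfolding regvar_def by auto
  \<comment> \<open>The window from \<open>1 / b\<close> to \<open>b\<close> has \<open>l\<close> in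
    its interior, so \<open>y\<close> eventually stays inside it.\<close>
  define b where "b = max (2 * l) (2 / l)"
  have b2: "2 * l \<le> b" "2 / l \<le> b" unfolding b_def by auto
  have b: "b > 0" "l < b" using b2(1) l by linarith+
  have "2 \<le> b * l" using b2(2) l by (simp add: divide_le_eq)
  hence b': "1 / b < l" using b(1) by (simp add: divide_less_eq mult.commute)
  have ev: "\<forall>\<^sub>F x in F. 1 / b < y x" "\<forall>\<^sub>F x in F. y x < b"
    using order_tendstoD[OF y] b b' by auto
  have "((\<lambda>x. ln (R (f x * y x) / R (f x)) - \<rho> * ln (y x)) \<longlongrightarrow> 0) F"
  proof (rule tendstoI)
    fix e :: real assume "e > 0"
    from regvar_uniform[OF R this b(1)] f
    have "\<forall>\<^sub>F x in F. \<forall>z. 1 / b \<le> z \<and> z \<le> b \<longrightarrow> \<bar>ln (R (f x * z) / R (f x)) - \<rho> * ln z\<bar> < e"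
      unfolding filterlim_iff by blast
    thus "\<forall>\<^sub>F x in F. dist (ln (R (f x * y x) / R (f x)) - \<rho> * ln (y x)) 0 < e"
      using ev by eventually_elim auto
  qed
  from tendsto_add[OF this tendsto_mult[OF tendsto_const tendsto_ln[OF y]], of \<rho>] l
  have "((\<lambda>x. ln (R (f x * y x) / R (f x))) \<longlongrightarrow> \<rho> * ln l) F" by simp
  from tendsto_exp[OF this] l
  have "((\<lambda>x. exp (ln (R (f x * y x) / R (f x)))) \<longlongrightarrow> l powr \<rho>) F" by (simp add: powr_def)
  \<comment> \<open>\<open>R\<close> is known to be positive only beyond 1; requiring
    \<open>f x > b\<close> keeps the product \<open>f x * y x\<close> above 1.\<close>
  moreover have "\<forall>\<^sub>F x in F. exp (ln (R (f x * y x) / R (f x))) = R (f x * y x) / R (f x)"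
    using ev(1) filterlim_at_top_dense[THEN iffD1, OF f, rule_format, of 1]
      filterlim_at_top_dense[THEN iffD1, OF f, rule_format, of b]
  proof eventually_elim
    case (elim x)
    have "b * (1 / b) < f x * y x" using elim b(1) by (intro mult_strict_mono) auto
    hence "f x * y x > 1" using b(1) by simp
    thus ?case using Rp elim by simp
  qed
  ultimately show ?thesis by (simp add: tendsto_cong)
qed

lemma power_of_two_bracket:
  fixes z :: real
  assumes "z \<ge> 1"
  shows "\<exists>n. 2 ^ n \<le> z \<and> z < 2 ^ Suc n"
proof -
  define n where "n = nat \<lfloor>log 2 z\<rfloor>"
  have "log 2 z \<ge> 0" using assms by simp
  hence "real n \<le> log 2 z" "log 2 z < real (Suc n)" unfolding n_def by linarith+
  hence "2 powr real n \<le> z" "z < 2 powr real (Suc n)"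
    using assms le_log_iff[of 2 z "real n"] log_less_iff[of 2 z "real (Suc n)"]
    by (simp_all del: of_nat_Suc)
  thus ?thesis by (intro exI[of _ n]) (simp add: powr_add powr_realpow)
qed

text \<open>A weak form of Potter's bound, without a rate of decay, which suffices for a dominating
  constant. Since \<open>2 powr \<rho> < 1\<close>, doubling the argument eventually decreases
  \<open>R\<close>; within one octave the ratio is bounded by uniform convergence.\<close>

lemma regvar_neg_bounded:
  assumes R: "regvar R \<rho>" and \<rho>: "\<rho> < 0"
  obtains C where "C > 0" "\<forall>\<^sub>F s in at_top. \<forall>z\<ge>1/2. R (s * z) \<le> C * R s"
proof -
  have Rp: "\<And>s. s > 1 \<Longrightarrow> R s > 0" using R unfolding regvar_def by auto
  \<comment> \<open>For \<open>z\<close> between 1/2 and 2 the logarithm of the ratio is within 1 of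
    \<open>\<rho> * ln z\<close>, which is at most \<open>- \<rho>\<close> because
    \<open>ln 2 \<le> 1\<close>.\<close>
  define C where "C = exp (1 - \<rho>)"
  have "\<forall>\<^sub>F s in at_top. \<forall>z. 1 / 2 \<le> z \<and> z \<le> 2 \<longrightarrow> \<bar>ln (R (s * z) / R s) - \<rho> * ln z\<bar> < 1"
    by (rule regvar_uniform[OF R]) auto
  moreover have "\<forall>\<^sub>F s in at_top. R (s * 2) / R s < 1"
  proof (rule order_tendstoD(2))
    show "((\<lambda>s. R (s * 2) / R s) \<longlongrightarrow> 2 powr \<rho>) at_top" using R unfolding regvar_def by auto
    show "2 powr \<rho> < 1" using powr_less_mono[of \<rho> 0 2] \<rho> by simp
  qed
  ultimately have "\<forall>\<^sub>F s in at_top. (\<forall>z. 1 / 2 \<le> z \<and> z \<le> 2 \<longrightarrow>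
      \<bar>ln (R (s * z) / R s) - \<rho> * ln z\<bar> < 1) \<and> R (s * 2) / R s < 1"
    by (rule eventually_conj)
  then obtain s0 where s0': "\<forall>s\<ge>s0. (\<forall>z. 1 / 2 \<le> z \<and> z \<le> 2 \<longrightarrow>
      \<bar>ln (R (s * z) / R s) - \<rho> * ln z\<bar> < 1) \<and> R (s * 2) / R s < 1"
    unfolding eventually_at_top_linorder ..
  have s0: "\<bar>ln (R (s * z) / R s) - \<rho> * ln z\<bar> < 1" if "s \<ge> s0" "1 / 2 \<le> z" "z \<le> 2" for s z
    using s0' that by simp
  have s0_2: "R (s * 2) / R s < 1" if "s \<ge> s0" for s using s0' that by simp
  have loc: "R (s * z) \<le> C * R s" if "s \<ge> s0" "s > 2" "1 / 2 \<le> z" "z \<le> 2" for s z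
  proof -
    have "s * z \<ge> s * (1 / 2)" using that by (intro mult_left_mono) auto
    hence "s * z > 1" using that by linarith
    hence pos: "R (s * z) > 0" "R s > 0" using Rp that by auto
    have "ln (1 / 2) \<le> ln z" "ln z \<le> ln 2" using that by (auto intro!: ln_mono)
    hence "\<bar>ln z\<bar> \<le> ln 2" by (simp add: ln_div)
    also have "\<dots> \<le> 1" using ln_le_minus_one[of 2] by simp
    finally have "- \<rho> * (- ln z) \<le> - \<rho> * 1" using \<rho> by (intro mult_left_mono) auto
    hence "\<rho> * ln z \<le> - \<rho>" by simp
    moreover have "\<bar>ln (R (s * z) / R s) - \<rho> * ln z\<bar> < 1" using s0[of s z] that by simp
    ultimately have "ln (R (s * z) / R s) \<le> 1 - \<rho>" by linarith
    hence "R (s * z) / R s \<le> C" using pos unfolding C_def by (metis divide_pos_pos exp_le_cancel_iff exp_ln)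
    thus ?thesis using pos by (simp add: pos_divide_le_eq)
  qed
  have dec: "R (s * 2 ^ n) \<le> R s" if s: "s \<ge> s0" "s > 2" for s and n :: nat
  proof (induction n)
    case (Suc n)
    have "s * 1 \<le> s * 2 ^ n" using s by (intro mult_left_mono) auto
    hence "s * 2 ^ n \<ge> s0" "s * 2 ^ n > 1" using s by linarith+
    hence "R (s * 2 ^ n * 2) / R (s * 2 ^ n) < 1" "R (s * 2 ^ n) > 0" by (simp_all only: s0_2 Rp)
    hence "R (s * 2 ^ n * 2) < R (s * 2 ^ n)" by (simp only: divide_less_eq_1_pos)
    thus ?case using Suc by (simp add: mult_ac)
  qed simp
  have all: "R (s * z) \<le> C * R s" if s: "s \<ge> s0" "s > 2" and z: "z \<ge> 1 / 2" for s z
  proof (cases "z < 1")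
    case True thus ?thesis using loc[OF s z] by simp
  next
    case False
    then obtain n where n: "2 ^ n \<le> z" "z < 2 ^ Suc n" using power_of_two_bracket[of z] by auto
    define y where "y = z / 2 ^ n"
    have y: "1 / 2 \<le> y" "y \<le> 2" "s * z = s * 2 ^ n * y"
      using n by (simp_all add: y_def pos_le_divide_eq pos_divide_le_eq)
    have "s * 1 \<le> s * 2 ^ n" using s by (intro mult_left_mono) auto
    hence "s * 2 ^ n \<ge> s0" "s * 2 ^ n > 2" using s by linarith+
    from loc[OF this y(1,2)] have "R (s * z) \<le> C * R (s * 2 ^ n)" by (simp only: y(3))
    also have "\<dots> \<le> C * R s" using dec[OF s] by (intro mult_left_mono) (simp_all add: C_def)
    finally show ?thesis .
  qed
  show ?thesis
  proof (rule that)
    show "C > 0" unfolding C_def by simp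
    show "\<forall>\<^sub>F s in at_top. \<forall>z\<ge>1/2. R (s * z) \<le> C * R s"
      using eventually_ge_at_top[of s0] eventually_gt_at_top[of 2] by eventually_elim (intro allI impI all)
  qed
qed

text \<open>A fixed multiplier \<open>z\<close> with \<open>C * z powr \<rho> < e\<close> already
  makes \<open>C * R (f x * z)\<close> small relative to \<open>R (f x)\<close>. As
  \<open>g x\<close> eventually exceeds \<open>f x * z\<close>, the preceding bound, started at
  \<open>f x * z\<close>, carries the smallness over to \<open>g x\<close>.\<close>

lemma regvar_neg_negligible:
  assumes R: "regvar R \<rho>" and \<rho>: "\<rho> < 0" and f: "filterlim f at_top F"
    and g: "filterlim (\<lambda>x. g x / f x) at_top F"
  shows "((\<lambda>x. R (g x) / R (f x)) \<longlongrightarrow> 0) F"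
proof (rule tendstoI)
  fix e :: real assume e: "e > 0"
  have Rp: "\<And>s. s > 1 \<Longrightarrow> R s > 0" using R unfolding regvar_def by auto
  obtain C where C: "C > 0" "\<forall>\<^sub>F s in at_top. \<forall>z\<ge>1/2. R (s * z) \<le> C * R s"
    using regvar_neg_bounded[OF R \<rho>] .
  have "((\<lambda>z. C * z powr \<rho>) \<longlongrightarrow> C * 0) at_top"
    by (intro tendsto_intros tendsto_neg_powr[OF \<rho> filterlim_ident])
  hence "\<forall>\<^sub>F z in at_top. C * z powr \<rho> < e" using order_tendstoD(2)[of _ "C * 0"] e by simp
  hence "\<forall>\<^sub>F z in at_top. C * z powr \<rho> < e \<and> z > 1"
    using eventually_gt_at_top[of 1] by (rule eventually_conj)
  then obtain z where z: "C * z powr \<rho> < e" "z > 1"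
    unfolding eventually_at_top_linorder by blast
  have fz: "filterlim (\<lambda>x. f x * z) at_top F"
    by (rule filterlim_at_top_mult_tendsto_pos[OF tendsto_const _ f]) (use z in auto)
  have l: "((\<lambda>x. C * (R (f x * z) / R (f x))) \<longlongrightarrow> C * z powr \<rho>) F"
    using z by (intro tendsto_intros regvar_tendsto[OF R f]) auto
  have "\<forall>\<^sub>F x in F. \<forall>y\<ge>1/2. R (f x * z * y) \<le> C * R (f x * z)"
    using C(2) fz unfolding filterlim_iff by blast
  moreover have "\<forall>\<^sub>F x in F. f x > 1" "\<forall>\<^sub>F x in F. g x / f x > z"
    using f g unfolding filterlim_at_top_dense by auto
  ultimately show "\<forall>\<^sub>F x in F. dist (R (g x) / R (f x)) 0 < e"
    using order_tendstoD(2)[OF l z(1)]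
  proof eventually_elim
    case (elim x)
    have fz: "f x * z > 0" using elim z by simp
    have gx: "f x * z < g x" using elim by (simp add: pos_less_divide_eq mult.commute)
    hence "1 < g x / (f x * z)" using fz by (simp add: pos_less_divide_eq)
    hence "1 / 2 \<le> g x / (f x * z)" by linarith
    with elim have "R (f x * z * (g x / (f x * z))) \<le> C * R (f x * z)" by blast
    moreover have "f x * z * (g x / (f x * z)) = g x" using elim z by simp
    ultimately have "R (g x) \<le> C * R (f x * z)" by (simp only:)
    moreover have fp: "R (f x) > 0" using Rp elim by auto
    ultimately have *: "R (g x) / R (f x) \<le> C * (R (f x * z) / R (f x))" by (simp add: divide_right_mono)
    have "f x * 1 < f x * z" using elim z by (intro mult_strict_left_mono) auto
    hence "1 < g x" using elim gx by linarith
    hence "R (g x) > 0" by (rule Rp)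
    moreover have "C * (R (f x * z) / R (f x)) < e" using elim by simp
    ultimately show ?case using * fp by simp
  qed
qed

section \<open>The second-order condition\<close>

lemma interval_integral_powr:
  fixes z :: real
  assumes "z > 0" "\<alpha> \<noteq> 0"
  shows "(LBINT u=1..z. u powr (\<alpha> - 1)) = (z powr \<alpha> - 1) / \<alpha>"
proof -
  have "(LBINT u=ereal 1..ereal z. u powr (\<alpha> - 1)) = z powr \<alpha> / \<alpha> - 1 powr \<alpha> / \<alpha>"
  proof (rule interval_integral_FTC_finite)
    show "continuous_on {min 1 z..max 1 z} (\<lambda>u. u powr (\<alpha> - 1))"
      using assms by (intro continuous_intros) auto
    show "((\<lambda>u. u powr \<alpha> / \<alpha>) has_vector_derivative x powr (\<alpha> - 1)) (at x within {min 1 z..max 1 z})"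
      if "min 1 z \<le> x" "x \<le> max 1 z" for x
    proof -
      have x: "x > 0" using that assms by (auto simp: min_def split: if_splits)
      have "((\<lambda>u. u powr \<alpha> / \<alpha>) has_real_derivative \<alpha> * x powr (\<alpha> - 1) / \<alpha>) (at x)"
        by (intro DERIV_cdivide has_real_derivative_powr x)
      thus ?thesis using assms
        by (simp add: has_real_derivative_iff_has_vector_derivative has_vector_derivative_at_within)
    qed
  qed
  thus ?thesis by (simp add: one_ereal_def diff_divide_distrib)
qed

text \<open>The Box-Cox transform: for \<open>\<alpha> \<noteq> 0\<close> and \<open>z > 0\<close>
  it is the integral of \<open>u powr (\<alpha> - 1)\<close> from 1 to \<open>z\<close>.\<close>

definition powr_quot :: "real \<Rightarrow> real \<Rightarrow> real" where
  "powr_quot \<alpha> z = (z powr \<alpha> - 1) / \<alpha>"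

lemma powr_quot_mult:
  assumes "z > 0" "w > 0"
  shows "powr_quot \<alpha> (z * w) - powr_quot \<alpha> z = z powr \<alpha> * powr_quot \<alpha> w"
  using assms by (simp add: powr_quot_def powr_mult right_diff_distrib diff_divide_distrib)

lemma powr_quot_pos: "z > 1 \<Longrightarrow> \<alpha> \<noteq> 0 \<Longrightarrow> powr_quot \<alpha> z > 0"
  using powr_less_mono[of \<alpha> 0 z] powr_less_mono[of 0 \<alpha> z]
  by (cases "\<alpha> > 0") (auto simp: powr_quot_def intro!: divide_pos_pos divide_neg_neg)

lemma second_order_integral:
  fixes z :: real
  assumes z: "z > 0" and "\<gamma> < 0" "\<rho> < 0"
  shows "(LBINT v=1..z. v powr (\<gamma> - 1) * (LBINT u=1..v. u powr (\<rho> - 1)))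
    = (powr_quot (\<gamma> + \<rho>) z - powr_quot \<gamma> z) / \<rho>"
proof -
  have "(LBINT v=1..z. v powr (\<gamma> - 1) * (LBINT u=1..v. u powr (\<rho> - 1)))
      = (LBINT v=1..z. (v powr (\<gamma> + \<rho> - 1) - v powr (\<gamma> - 1)) / \<rho>)"
  proof (rule interval_integral_cong)
    fix v assume "v \<in> einterval (min 1 (ereal z)) (max 1 (ereal z))"
    hence v: "v > 0" using z by (auto simp: einterval_def min_def max_def one_ereal_def split: if_splits)
    have "v powr (\<gamma> - 1) * v powr \<rho> = v powr (\<gamma> + \<rho> - 1)" by (simp add: powr_add[symmetric] algebra_simps)
    thus "v powr (\<gamma> - 1) * (LBINT u=1..v. u powr (\<rho> - 1)) = (v powr (\<gamma> + \<rho> - 1) - v powr (\<gamma> - 1)) / \<rho>"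
      using v assms by (simp add: interval_integral_powr right_diff_distrib)
  qed
  also have "\<dots> = (LBINT v=ereal 1..ereal z. (v powr (\<gamma> + \<rho> - 1) - v powr (\<gamma> - 1)) / \<rho>)"
    by (simp add: one_ereal_def)
  also have "\<dots> = (z powr (\<gamma> + \<rho>) / (\<gamma> + \<rho>) - z powr \<gamma> / \<gamma>) / \<rho>
      - (1 powr (\<gamma> + \<rho>) / (\<gamma> + \<rho>) - 1 powr \<gamma> / \<gamma>) / \<rho>"
  proof (rule interval_integral_FTC_finite)
    show "continuous_on {min 1 z..max 1 z} (\<lambda>v. (v powr (\<gamma> + \<rho> - 1) - v powr (\<gamma> - 1)) / \<rho>)"
      using assms by (intro continuous_intros) auto
    show "((\<lambda>v. (v powr (\<gamma> + \<rho>) / (\<gamma> + \<rho>) - v powr \<gamma> / \<gamma>) / \<rho>) has_vector_derivative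
        (x powr (\<gamma> + \<rho> - 1) - x powr (\<gamma> - 1)) / \<rho>) (at x within {min 1 z..max 1 z})"
      if "min 1 z \<le> x" "x \<le> max 1 z" for x
    proof -
      have x: "x > 0" using that assms by (auto simp: min_def split: if_splits)
      have "((\<lambda>v. (v powr (\<gamma> + \<rho>) / (\<gamma> + \<rho>) - v powr \<gamma> / \<gamma>) / \<rho>) has_real_derivative
        ((\<gamma> + \<rho>) * x powr (\<gamma> + \<rho> - 1) / (\<gamma> + \<rho>) - \<gamma> * x powr (\<gamma> - 1) / \<gamma>) / \<rho>) (at x)"
        by (intro DERIV_cdivide DERIV_diff has_real_derivative_powr x)
      thus ?thesis using assms
        by (simp add: has_real_derivative_iff_has_vector_derivative has_vector_derivative_at_within)
    qed
  qed
  also have "\<dots> = (powr_quot (\<gamma> + \<rho>) z - powr_quot \<gamma> z) / \<rho>"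
    by (simp add: powr_quot_def diff_divide_distrib)
  finally show ?thesis .
qed

text \<open>Monotonicity is all that the analysis of the tail retains from \<open>U\<close> being a
  quantile function.\<close>

locale second_order_tail =
  fixes U a A :: "real \<Rightarrow> real" and \<gamma> \<rho> :: real
  assumes U_mono: "mono_on {1<..} U" and cond: "second_order_cond U \<gamma> a \<rho> A" and rho: "\<rho> < 0"
begin

lemma gamma: "\<gamma> < 0" and a_pos: "s > 1 \<Longrightarrow> a s > 0"
  and A_meas: "A \<in> borel_measurable (restrict_space borel {1<..})"
  and A_nonzero: "s > 1 \<Longrightarrow> A s \<noteq> 0" and A_lim: "(A \<longlongrightarrow> 0) at_top"
  and A_sign: "(\<forall>s>1. A s > 0) \<or> (\<forall>s>1. A s < 0)"
  using cond unfolding second_order_cond_def by auto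

lemma A_nz: "\<forall>\<^sub>F s in at_top. A s \<noteq> 0"
  using eventually_gt_at_top[of 1] by eventually_elim (rule A_nonzero)

lemma scale_at_top: "z > 0 \<Longrightarrow> filterlim (\<lambda>s. s * z) at_top (at_top :: real filter)"
  by (rule filterlim_at_top_mult_tendsto_pos[OF tendsto_const _ filterlim_ident])

section \<open>Eliminating the auxiliary function \<open>a\<close>\<close>

definition D :: "real \<Rightarrow> real \<Rightarrow> real" where "D s z = (U (s * z) - U s) / a s"

definition H :: "real \<Rightarrow> real" where "H z = (powr_quot (\<gamma> + \<rho>) z - powr_quot \<gamma> z) / \<rho>"

lemma D_second: "z > 0 \<Longrightarrow> ((\<lambda>s. (D s z - powr_quot \<gamma> z) / A s) \<longlongrightarrow> H z) at_top"
proof -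
  assume z: "z > 0"
  have "((\<lambda>s. 1 / A s * ((U (s * z) - U s) / a s - (z powr \<gamma> - 1) / \<gamma>))
      \<longlongrightarrow> (LBINT v=1..z. v powr (\<gamma> - 1) * (LBINT u=1..v. u powr (\<rho> - 1)))) at_top"
    using cond z unfolding second_order_cond_def by blast
  thus ?thesis unfolding second_order_integral[OF z gamma rho]
    by (simp add: D_def H_def powr_quot_def)
qed

lemma D_first: assumes "z > 0" shows "((\<lambda>s. D s z) \<longlongrightarrow> powr_quot \<gamma> z) at_top"
proof -
  have "((\<lambda>s. (D s z - powr_quot \<gamma> z) / A s * A s + powr_quot \<gamma> z) \<longlongrightarrow> H z * 0 + powr_quot \<gamma> z) at_top"
    by (intro tendsto_intros D_second assms A_lim)
  moreover have "\<forall>\<^sub>F s in at_top. (D s z - powr_quot \<gamma> z) / A s * A s + powr_quot \<gamma> z = D s z"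
    using A_nz by eventually_elim simp
  ultimately show ?thesis by (simp add: tendsto_cong)
qed

lemma H_mult:
  assumes "z > 0" "w > 0"
  shows "H (z * w) - H z
    = z powr \<gamma> * (z powr \<rho> * powr_quot (\<gamma> + \<rho>) w - powr_quot \<gamma> w) / \<rho>"
  using powr_quot_mult[OF assms, of "\<gamma> + \<rho>"] powr_quot_mult[OF assms, of \<gamma>]
  unfolding H_def by (simp add: diff_divide_distrib[symmetric] powr_add algebra_simps)

lemma D_increment:
  assumes "z > 0" "w > 0"
  shows "((\<lambda>s. (D s (z * w) - D s z - z powr \<gamma> * powr_quot \<gamma> w) / A s) \<longlongrightarrow>
    z powr \<gamma> * (z powr \<rho> * powr_quot (\<gamma> + \<rho>) w - powr_quot \<gamma> w) / \<rho>) at_top"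
proof -
  have "((\<lambda>s. (D s (z * w) - powr_quot \<gamma> (z * w)) / A s - (D s z - powr_quot \<gamma> z) / A s) \<longlongrightarrow>
     H (z * w) - H z) at_top"
    using assms by (intro tendsto_intros D_second) auto
  moreover have "(D s (z * w) - powr_quot \<gamma> (z * w)) / A s - (D s z - powr_quot \<gamma> z) / A s
      = (D s (z * w) - D s z - z powr \<gamma> * powr_quot \<gamma> w) / A s" for s
    unfolding powr_quot_mult[OF assms, symmetric] by (simp add: diff_divide_distrib)
  ultimately show ?thesis unfolding H_mult[OF assms] by simp
qed

lemma D_cocycle:
  assumes "s > 1" "s * z > 1"
  shows "D s (z * w) - D s z = a (s * z) / a s * D (s * z) w"
  using a_pos[OF assms(1)] a_pos[OF assms(2)] by (simp add: D_def field_simps)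

lemma large_scale: "z > 0 \<Longrightarrow> \<forall>\<^sub>F s in at_top. s > 1 \<and> s * z > (1::real)"
  using filterlim_at_top_dense[THEN iffD1, OF scale_at_top[of z], rule_format, of 1] eventually_gt_at_top[of 1]
  by (simp add: eventually_conj)

text \<open>
  The quotient \<open>D (s z) 4 / D (s z) 2\<close> does not involve \<open>a (s z)\<close>, so it can be expanded both in \<open>A (s z)\<close>
  and, via \<open>D_cocycle\<close>, in \<open>A s\<close>.
\<close>

lemma A_ratio:
  assumes z: "z > 0"
  shows "((\<lambda>s. A (s * z) / A s) \<longlongrightarrow> z powr \<rho>) at_top"
proof -
  define g2 g4 G2 G4 where "g2 = powr_quot \<gamma> 2" and "g4 = powr_quot \<gamma> 4"
    and "G2 = powr_quot (\<gamma> + \<rho>) 2" and "G4 = powr_quot (\<gamma> + \<rho>) 4"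
  define Z P where "Z = z powr \<gamma>" and "P = z powr \<rho>"
  have ZP: "Z > 0" "P > 0" using z unfolding Z_def P_def by auto
  have g2: "g2 > 0" "G2 > 0" unfolding g2_def G2_def using gamma rho by (auto intro!: powr_quot_pos)
  have g4: "g4 = g2 + 2 powr \<gamma> * g2" "G4 = G2 + 2 powr (\<gamma> + \<rho>) * G2"
    using powr_quot_mult[of 2 2 \<gamma>] powr_quot_mult[of 2 2 "\<gamma> + \<rho>"]
    by (simp_all add: g2_def g4_def G2_def G4_def)
  \<comment> \<open>The coefficient of \<open>A t\<close> in the expansion of
    \<open>D t 4 / D t 2\<close>. The conclusion divides by it, so it must not vanish; the choice
    \<open>4 = 2 * 2\<close> makes this visible, as the numerator collapses to
    \<open>G2 * g2 * (2 powr (\<gamma> + \<rho>) - 2 powr \<gamma>)\<close>.\<close>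
  define k where "k = (G4 * g2 - g4 * G2) / (\<rho> * g2\<^sup>2)"
  have "G4 * g2 - g4 * G2 = G2 * g2 * (2 powr (\<gamma> + \<rho>) - 2 powr \<gamma>)"
    unfolding g4 by (simp add: algebra_simps)
  moreover have "2 powr (\<gamma> + \<rho>) < (2::real) powr \<gamma>" using rho by (intro powr_less_mono) auto
  ultimately have "G4 * g2 - g4 * G2 \<noteq> 0" using g2 by (simp only: mult_eq_0_iff) linarith
  hence k: "k \<noteq> 0" unfolding k_def using g2 rho by simp
  define Q where "Q t = D t 4 / D t 2" for t
  have Q1: "((\<lambda>t. (Q t - g4 / g2) / A t) \<longlongrightarrow> k) at_top"
  proof -
    have "((\<lambda>t. (Q t - g4 / g2) / A t) \<longlongrightarrow> (H 4 * g2 - g4 * H 2) / g2\<^sup>2) at_top"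
      unfolding Q_def g4_def g2_def
      by (rule quotient_first_order_limit[OF D_second D_second A_lim A_nz]) (use g2 g2_def in auto)
    moreover have "(H 4 * g2 - g4 * H 2) / g2\<^sup>2 = k"
      unfolding k_def H_def g2_def[symmetric] G2_def[symmetric] g4_def[symmetric] G4_def[symmetric]
      using g2 rho by (simp add: field_simps power2_eq_square)
    ultimately show ?thesis by simp
  qed
  have Q2: "((\<lambda>s. (Q (s * z) - g4 / g2) / A s) \<longlongrightarrow> P * k) at_top"
  proof -
    have L: "((\<lambda>s. ((D s (z * 4) - D s z) / (D s (z * 2) - D s z) - Z * g4 / (Z * g2)) / A s) \<longlongrightarrow>
      (Z * (P * G4 - g4) / \<rho> * (Z * g2) - Z * g4 * (Z * (P * G2 - g2) / \<rho>)) / (Z * g2)\<^sup>2) at_top"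
      unfolding Z_def P_def g2_def g4_def G2_def G4_def
      by (rule quotient_first_order_limit[OF D_increment D_increment A_lim A_nz])
        (use z g2 g2_def in auto)
    have E: "(Z * (P * G4 - g4) / \<rho> * (Z * g2) - Z * g4 * (Z * (P * G2 - g2) / \<rho>)) / (Z * g2)\<^sup>2 = P * k"
      unfolding k_def using g2 rho ZP by (simp add: field_simps power2_eq_square)
    have "\<forall>\<^sub>F s in at_top. ((D s (z * 4) - D s z) / (D s (z * 2) - D s z) - Z * g4 / (Z * g2)) / A s
        = (Q (s * z) - g4 / g2) / A s"
      using large_scale[OF z]
    proof eventually_elim
      case (elim s)
      have "a (s * z) / a s \<noteq> 0" using a_pos[of s] a_pos[of "s * z"] elim by simp
      thus ?case unfolding Q_def using elim ZP by (simp only: D_cocycle mult_divide_mult_cancel_left_if) auto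
    qed
    from Lim_transform_eventually[OF L this] show ?thesis unfolding E .
  qed
  note Q3 = filterlim_compose[OF Q1 scale_at_top[OF z]]
  \<comment> \<open>Dividing the two expansions cancels their common numerator, which is eventually
    nonzero because \<open>k \<noteq> 0\<close>; the ratio of the two values of \<open>A\<close>
    remains.\<close>
  have "((\<lambda>s. ((Q (s * z) - g4 / g2) / A s) / ((Q (s * z) - g4 / g2) / A (s * z))) \<longlongrightarrow> P * k / k) at_top"
    by (intro tendsto_divide Q2 Q3 k)
  moreover have "\<forall>\<^sub>F s in at_top. ((Q (s * z) - g4 / g2) / A s) / ((Q (s * z) - g4 / g2) / A (s * z)) = A (s * z) / A s"
    using tendsto_imp_eventually_ne[OF Q3 k] by eventually_elim simp
  ultimately show ?thesis using k by (simp add: tendsto_cong P_def)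
qed

lemma regvar_A: "regvar (\<lambda>s. \<bar>A s\<bar>) \<rho>"
  unfolding regvar_def
proof (intro conjI allI impI)
  show "(\<lambda>s. \<bar>A s\<bar>) \<in> borel_measurable (restrict_space borel {1<..})" using A_meas by measurable
  fix z :: real assume "z > 0"
  from tendsto_rabs[OF A_ratio[OF this]]
  show "((\<lambda>s. \<bar>A (s * z)\<bar> / \<bar>A s\<bar>) \<longlongrightarrow> z powr \<rho>) at_top" by simp
qed (use A_nonzero in auto)

text \<open>\<open>D_cocycle\<close> solved for the ratio of \<open>a\<close>: it equals
  \<open>(D s (z * 2) - D s z) / D (s * z) 2\<close>. With the ratio of \<open>A\<close> known, the
  denominator too can be expanded in \<open>A s\<close>.\<close>

lemma a_second:
  assumes z: "z > 0"
  shows "((\<lambda>s. (a (s * z) / a s - z powr \<gamma>) / A s) \<longlongrightarrow> z powr \<gamma> * (z powr \<rho> - 1) / \<rho>) at_top"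
proof -
  define g2 G2 where "g2 = powr_quot \<gamma> 2" and "G2 = powr_quot (\<gamma> + \<rho>) 2"
  define Z P where "Z = z powr \<gamma>" and "P = z powr \<rho>"
  have ZP: "Z > 0" "P > 0" using z unfolding Z_def P_def by auto
  have g2: "g2 > 0" "G2 > 0" unfolding g2_def G2_def using gamma rho by (auto intro!: powr_quot_pos)
  have q: "((\<lambda>s. (D (s * z) 2 - g2) / A s) \<longlongrightarrow> H 2 * P) at_top"
  proof -
    have "((\<lambda>s. (D (s * z) 2 - g2) / A (s * z) * (A (s * z) / A s)) \<longlongrightarrow> H 2 * P) at_top"
      unfolding g2_def P_def
      by (intro tendsto_mult filterlim_compose[OF D_second scale_at_top] A_ratio z) auto
    moreover have "\<forall>\<^sub>F s in at_top. (D (s * z) 2 - g2) / A (s * z) * (A (s * z) / A s) = (D (s * z) 2 - g2) / A s"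
      using large_scale[OF z] by eventually_elim (simp add: A_nonzero)
    ultimately show ?thesis by (rule Lim_transform_eventually)
  qed
  have L: "((\<lambda>s. ((D s (z * 2) - D s z) / D (s * z) 2 - Z * g2 / g2) / A s) \<longlongrightarrow>
      (Z * (P * G2 - g2) / \<rho> * g2 - Z * g2 * (H 2 * P)) / g2\<^sup>2) at_top"
    unfolding Z_def P_def g2_def G2_def
    by (rule quotient_first_order_limit[OF D_increment q[unfolded g2_def P_def] A_lim A_nz])
      (use z g2 g2_def in auto)
  have E: "(Z * (P * G2 - g2) / \<rho> * g2 - Z * g2 * (H 2 * P)) / g2\<^sup>2 = Z * (P - 1) / \<rho>"
    unfolding H_def g2_def[symmetric] G2_def[symmetric]
    using g2 rho by (simp add: field_simps power2_eq_square)
  have "\<forall>\<^sub>F s in at_top. D (s * z) 2 \<noteq> 0"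
    using g2 g2_def by (intro tendsto_imp_eventually_ne[OF filterlim_compose[OF D_first scale_at_top]] z) auto
  hence "\<forall>\<^sub>F s in at_top. ((D s (z * 2) - D s z) / D (s * z) 2 - Z * g2 / g2) / A s = (a (s * z) / a s - Z) / A s"
    using large_scale[OF z] by eventually_elim (use g2 in \<open>simp add: D_cocycle\<close>)
  from Lim_transform_eventually[OF L this] show ?thesis unfolding E by (simp add: Z_def P_def)
qed

lemma a_ratio:
  assumes z: "z > 0" shows "((\<lambda>s. a (s * z) / a s) \<longlongrightarrow> z powr \<gamma>) at_top"
proof -
  have "((\<lambda>s. (a (s * z) / a s - z powr \<gamma>) / A s * A s + z powr \<gamma>) \<longlongrightarrow>
      z powr \<gamma> * (z powr \<rho> - 1) / \<rho> * 0 + z powr \<gamma>) at_top"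
    by (intro tendsto_intros a_second z A_lim)
  moreover have "\<forall>\<^sub>F s in at_top. (a (s * z) / a s - z powr \<gamma>) / A s * A s + z powr \<gamma> = a (s * z) / a s"
    using A_nz by eventually_elim simp
  ultimately show ?thesis by (simp add: tendsto_cong)
qed

section \<open>Finiteness of the endpoint and the power expansion of the distance to it\<close>

lemma U_le: "1 < s \<Longrightarrow> s \<le> t \<Longrightarrow> U s \<le> U t"
  using mono_onD[OF U_mono, of s t] by simp

text \<open>The increments \<open>d s = U (s * 2) - U s\<close> are asymptotically proportional to
  \<open>a s\<close>, and \<open>a\<close> shrinks by about \<open>2 powr \<gamma> < 1\<close> under
  doubling. So they are dominated by a geometric series along powers of two, and monotonicity
  controls \<open>U\<close> in between.\<close>

lemma U_converges: "\<exists>x. (U \<longlongrightarrow> x) at_top \<and> (\<forall>s>1. U s < x)"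
proof -
  define d where "d s = U (s * 2) - U s" for s
  have g2: "powr_quot \<gamma> 2 > 0" using gamma by (auto intro!: powr_quot_pos)
  have dD: "d s / a s = D s 2" for s unfolding d_def D_def ..
  have Dl: "((\<lambda>s. d s / a s) \<longlongrightarrow> powr_quot \<gamma> 2) at_top" unfolding dD by (rule D_first) simp
  have dpos: "\<forall>\<^sub>F s in at_top. d s > 0"
    using order_tendstoD(1)[OF Dl g2] eventually_gt_at_top[of 1]
    by eventually_elim (use a_pos in \<open>simp add: zero_less_divide_iff\<close>, fastforce)
  define l where "l = (1 + 2 powr \<gamma>) / 2"
  have "2 powr \<gamma> < (2::real) powr 0" using gamma by (intro powr_less_mono) auto
  hence l: "0 < l" "l < 1" "2 powr \<gamma> < l" unfolding l_def by (auto intro: add_pos_pos)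
  have "((\<lambda>s. d (s * 2) / a (s * 2) * (a (s * 2) / a s) / (d s / a s)) \<longlongrightarrow>
      powr_quot \<gamma> 2 * 2 powr \<gamma> / powr_quot \<gamma> 2) at_top"
    using g2 by (intro tendsto_intros filterlim_compose[OF Dl scale_at_top] a_ratio Dl) auto
  from order_tendstoD(2)[OF this, of l] g2 l
  have "\<forall>\<^sub>F s in at_top. d (s * 2) / a (s * 2) * (a (s * 2) / a s) / (d s / a s) < l" by simp
  hence "\<forall>\<^sub>F s in at_top. d (s * 2) \<le> l * d s \<and> s > 1 \<and> d s > 0"
    using dpos eventually_gt_at_top[of 1]
  proof eventually_elim
    case (elim s)
    have "a s \<noteq> 0" "a (s * 2) \<noteq> 0" using a_pos[of s] a_pos[of "s * 2"] elim by auto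
    hence "d (s * 2) / d s < l" using elim by simp
    thus ?case using elim by (simp add: pos_divide_less_eq)
  qed
  then obtain s0 where s0: "\<forall>s\<ge>s0. d (s * 2) \<le> l * d s \<and> s > 1 \<and> d s > 0"
    unfolding eventually_at_top_linorder ..
  hence s01: "s0 > 1" by simp
  define u where "u n = s0 * 2 ^ n" for n :: nat
  have u: "u n \<ge> s0" "u (Suc n) = u n * 2" for n
    using s01 by (auto simp: u_def)
  \<comment> \<open>The second summand majorises all increments still to come, so the sum does not
    increase with \<open>n\<close>.\<close>
  have bnd: "U (u n) + d (u n) / (1 - l) \<le> U s0 + d s0 / (1 - l)" for n
  proof (induction n)
    case (Suc n)
    have "d (u (Suc n)) / (1 - l) \<le> l * d (u n) / (1 - l)"
      using s0 u[of n] l by (intro divide_right_mono) auto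
    moreover have "U (u (Suc n)) = U (u n) + d (u n)" unfolding d_def u(2) by simp
    moreover have "d (u n) + l * d (u n) / (1 - l) = d (u n) / (1 - l)"
      using l by (simp add: field_simps)
    ultimately show ?case using Suc by linarith
  qed (simp add: u_def)
  have Ub: "U s \<le> U s0 + d s0 / (1 - l)" if s: "s > 1" for s
  proof -
    obtain n where n: "s < 2 ^ n" using real_arch_pow[of 2 s] by auto
    have "1 * 2 ^ n \<le> u n" unfolding u_def using s01 by (intro mult_right_mono) auto
    hence "U s \<le> U (u n)" using n s by (intro U_le) auto
    moreover have "d (u n) / (1 - l) \<ge> 0" using s0 u(1)[of n] l by (intro divide_nonneg_pos) (auto intro: less_imp_le)
    ultimately show ?thesis using bnd[of n] by linarith
  qed
  define x where "x = Sup (U ` {1<..})"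
  have bdd: "bdd_above (U ` {1<..})" using Ub by (auto intro!: bdd_aboveI)
  have le: "U s \<le> x" if "s > 1" for s unfolding x_def using that by (intro cSup_upper bdd) auto
  \<comment> \<open>Strictness comes from a positive increment further out:
    \<open>U s \<le> U t < U (t * 2) \<le> x\<close>.\<close>
  have lt: "U s < x" if "s > 1" for s
  proof -
    define t where "t = max s s0"
    have t: "s \<le> t" "t > 1" "d t > 0" using s0 s01 that unfolding t_def by auto
    have "U s \<le> U t" using t that by (intro U_le) auto
    moreover have "U (t * 2) \<le> x" using t by (intro le) auto
    ultimately show ?thesis using t(3) unfolding d_def by linarith
  qed
  have "(U \<longlongrightarrow> x) at_top"
  proof (rule increasing_tendsto)
    show "\<forall>\<^sub>F s in at_top. U s \<le> x" using eventually_gt_at_top[of 1] by eventually_elim (rule le)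
    fix y assume "y < x"
    then obtain s where s: "s > 1" "y < U s"
      unfolding x_def using less_cSup_iff[OF _ bdd] by auto
    show "\<forall>\<^sub>F t in at_top. y < U t"
      using eventually_ge_at_top[of s] by eventually_elim (use U_le[of s] s in force)
  qed
  thus ?thesis using lt by blast
qed

text \<open>Defined as a limit of \<open>U\<close> alone; that it is the right endpoint of the
  distribution is shown later, in \<open>right_endpoint_eq\<close>.\<close>

definition endpoint :: real where "endpoint = Lim at_top U"

definition V :: "real \<Rightarrow> real" where "V s = endpoint - U s"

lemma U_lim: "(U \<longlongrightarrow> endpoint) at_top" and V_pos: "s > 1 \<Longrightarrow> V s > 0"
proof -
  obtain x where x: "(U \<longlongrightarrow> x) at_top" "\<forall>s>1. U s < x" using U_converges by blast
  hence e: "endpoint = x" unfolding endpoint_def by (intro tendsto_Lim) auto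
  show "(U \<longlongrightarrow> endpoint) at_top" using x e by simp
  show "s > 1 \<Longrightarrow> V s > 0" using x e by (simp add: V_def)
qed

lemma V_lim: "(V \<longlongrightarrow> 0) at_top"
  using tendsto_diff[OF tendsto_const[of endpoint] U_lim] by (simp add: V_def[abs_def])

lemma V_antimono: "1 < s \<Longrightarrow> s \<le> t \<Longrightarrow> V t \<le> V s"
  using U_le by (simp add: V_def)

text \<open>Formally this is \<open>D_second\<close> at \<open>z = \<infinity>\<close>, where
  \<open>powr_quot \<gamma> z\<close> tends to \<open>- 1 / \<gamma>\<close> and \<open>H z\<close>
  to \<open>1 / (\<gamma> * (\<gamma> + \<rho>))\<close>. Since the condition is only pointwise in
  \<open>z\<close>, the limits cannot simply be interchanged; the remainder is summed dyadically
  instead.\<close>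

lemma V_over_a: "((\<lambda>s. (V s / a s - (- 1 / \<gamma>)) / A s) \<longlongrightarrow> 1 / (\<gamma> * (\<gamma> + \<rho>))) at_top"
proof -
  define Z P where "Z = (2::real) powr \<gamma>" and "P = (2::real) powr \<rho>"
  have ZP: "0 < Z" "0 < P" "Z < 1" "P < 1"
    using powr_less_mono[of \<gamma> 0 2] powr_less_mono[of \<rho> 0 2] gamma rho by (simp_all add: Z_def P_def)
  hence ZP1: "0 < Z * P" "Z * P < 1" using mult_strict_mono[of Z 1 P 1] by auto
  have g2: "powr_quot \<gamma> 2 > 0" using gamma by (auto intro!: powr_quot_pos)
  \<comment> \<open>\<open>a s\<close> is an increment of \<open>U\<close>, which vanishes because
    \<open>U\<close> converges, divided by \<open>D s 2\<close>, which has a positive limit.\<close>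
  have a0: "(a \<longlongrightarrow> 0) at_top"
  proof -
    have "((\<lambda>s. (U (s * 2) - U s) / D s 2) \<longlongrightarrow> (endpoint - endpoint) / powr_quot \<gamma> 2) at_top"
      using g2 by (intro tendsto_intros D_first U_lim filterlim_compose[OF U_lim scale_at_top]) auto
    moreover have "\<forall>\<^sub>F s in at_top. (U (s * 2) - U s) / D s 2 = a s"
      using order_tendstoD(1)[OF D_first[of 2] g2, simplified]
      by eventually_elim (auto simp: D_def)
    ultimately show ?thesis by (simp add: tendsto_cong)
  qed
  \<comment> \<open>The error in \<open>V s \<approx> - a s / \<gamma>\<close>. Its natural size is
    \<open>R s = a s * A s\<close>, which contracts by \<open>2 powr (\<gamma> + \<rho>)\<close>
    under doubling.\<close>
  define W where "W s = V s + a s / \<gamma>" for s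
  define R where "R s = a s * A s" for s
  have L: "((\<lambda>s. W s / R s) \<longlongrightarrow> (Z * (P - 1) / \<rho> / \<gamma> - H 2) / (Z * P - 1)) at_top"
  proof (rule dyadic_tail_limit)
    show "(W \<longlongrightarrow> 0) at_top"
      unfolding W_def using tendsto_add[OF V_lim tendsto_divide[OF a0 tendsto_const, of \<gamma>]] gamma by simp
    show "(R \<longlongrightarrow> 0) at_top" unfolding R_def using tendsto_mult[OF a0 A_lim] by simp
    have "((\<lambda>s. (a (s * 2) / a s) * (A (s * 2) / A s)) \<longlongrightarrow> Z * P) at_top"
      unfolding Z_def P_def by (intro tendsto_intros a_ratio A_ratio) auto
    thus "((\<lambda>s. R (2 * s) / R s) \<longlongrightarrow> Z * P) at_top" by (simp add: R_def mult.commute)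
    show "\<bar>Z * P\<bar> < 1" using ZP1 by simp
    show "\<forall>\<^sub>F s in at_top. R s \<noteq> 0" using eventually_gt_at_top[of 1]
    proof eventually_elim
      case (elim s) show ?case using a_pos[OF elim] A_nonzero[OF elim] by (simp add: R_def)
    qed
    have "((\<lambda>s. (a (s * 2) / a s - Z) / A s / \<gamma> - (D s 2 - powr_quot \<gamma> 2) / A s) \<longlongrightarrow>
        Z * (P - 1) / \<rho> / \<gamma> - H 2) at_top"
      unfolding Z_def P_def using gamma by (intro tendsto_intros a_second D_second) auto
    moreover have "\<forall>\<^sub>F s in at_top. (a (s * 2) / a s - Z) / A s / \<gamma> - (D s 2 - powr_quot \<gamma> 2) / A s
        = (W (2 * s) - W s) / R s"
      using eventually_gt_at_top[of 1]
    proof eventually_elim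
      case (elim s)
      have nz: "a s \<noteq> 0" "A s \<noteq> 0" using a_pos[OF elim] A_nonzero[OF elim] by auto
      have "W (2 * s) - W s = a s * ((a (s * 2) / a s - 1) / \<gamma> - D s 2)"
        using nz gamma by (simp add: W_def V_def D_def field_simps)
      hence "(W (2 * s) - W s) / R s = ((a (s * 2) / a s - 1) / \<gamma> - D s 2) / A s"
        using nz by (simp add: R_def)
      also have "(a (s * 2) / a s - 1) / \<gamma> - D s 2 = (a (s * 2) / a s - Z) / \<gamma> - (D s 2 - powr_quot \<gamma> 2)"
        by (simp add: powr_quot_def Z_def diff_divide_distrib)
      finally show ?case by (simp add: diff_divide_distrib mult.commute)
    qed
    ultimately show "((\<lambda>s. (W (2 * s) - W s) / R s) \<longlongrightarrow> Z * (P - 1) / \<rho> / \<gamma> - H 2) at_top"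
      by (rule Lim_transform_eventually)
  qed
  have E: "(Z * (P - 1) / \<rho> / \<gamma> - H 2) / (Z * P - 1) = 1 / (\<gamma> * (\<gamma> + \<rho>))"
  proof -
    have H2: "H 2 = ((Z * P - 1) / (\<gamma> + \<rho>) - (Z - 1) / \<gamma>) / \<rho>"
      by (simp add: H_def powr_quot_def Z_def P_def powr_add)
    define \<sigma> where "\<sigma> = \<gamma> + \<rho>"
    have \<sigma>: "\<sigma> \<noteq> 0" "\<gamma> \<noteq> 0" "\<rho> \<noteq> 0" "\<rho> = \<sigma> - \<gamma>" using gamma rho unfolding \<sigma>_def by auto
    have "Z * (P - 1) / \<rho> / \<gamma> - H 2 = (Z * (P - 1) + (Z - 1)) / \<gamma> / \<rho> - (Z * P - 1) / \<sigma> / \<rho>"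
      unfolding H2 \<sigma>_def[symmetric] by (simp add: diff_divide_distrib add_divide_distrib mult.commute)
    also have "\<dots> = (Z * P - 1) * ((1 / \<gamma> - 1 / \<sigma>) / \<rho>)"
      by (simp add: algebra_simps diff_divide_distrib)
    also have "1 / \<gamma> - 1 / \<sigma> = \<rho> / (\<gamma> * \<sigma>)" using \<sigma> by (simp add: field_simps)
    finally have "Z * (P - 1) / \<rho> / \<gamma> - H 2 = (Z * P - 1) * (1 / (\<gamma> * (\<gamma> + \<rho>)))"
      using \<sigma>(3) unfolding \<sigma>_def by simp
    thus ?thesis using ZP1 by simp
  qed
  have "\<forall>\<^sub>F s in at_top. W s / R s = (V s / a s - (- 1 / \<gamma>)) / A s"
    using eventually_gt_at_top[of 1]
  proof eventually_elim
    case (elim s)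
    have "(V s + a s / \<gamma>) / a s = V s / a s - - 1 / \<gamma>" using a_pos[OF elim] by (simp add: add_divide_distrib)
    thus ?case unfolding W_def R_def by (simp only: divide_divide_eq_left[symmetric])
  qed
  from Lim_transform_eventually[OF L this] show ?thesis unfolding E .
qed

text \<open>Since \<open>V (s * z) / V s = 1 - D s z / (V s / a s)\<close>, a quotient of two known
  expansions, \<open>a\<close> drops out for good.\<close>

lemma V_ratio_second:
  assumes z: "z > 0"
  shows "((\<lambda>s. (V (s * z) / V s - z powr \<gamma>) / A s) \<longlongrightarrow> \<gamma> / (\<gamma> + \<rho>) * z powr \<gamma> * (z powr \<rho> - 1) / \<rho>) at_top"
proof -
  have nz: "\<gamma> + \<rho> \<noteq> 0" "\<gamma> \<noteq> 0" "\<rho> \<noteq> 0" using gamma rho by auto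
  have "((\<lambda>s. (D s z / (V s / a s) - powr_quot \<gamma> z / (- 1 / \<gamma>)) / A s) \<longlongrightarrow>
      (H z * (- 1 / \<gamma>) - powr_quot \<gamma> z * (1 / (\<gamma> * (\<gamma> + \<rho>)))) / (- 1 / \<gamma>)\<^sup>2) at_top"
    by (rule quotient_first_order_limit[OF D_second[OF z] V_over_a A_lim A_nz]) (use nz in auto)
  from tendsto_minus[OF this]
  have L: "((\<lambda>s. - ((D s z / (V s / a s) - powr_quot \<gamma> z / (- 1 / \<gamma>)) / A s)) \<longlongrightarrow>
     - ((H z * (- 1 / \<gamma>) - powr_quot \<gamma> z * (1 / (\<gamma> * (\<gamma> + \<rho>)))) / (- 1 / \<gamma>)\<^sup>2)) at_top" .
  have E: "- ((H z * (- 1 / \<gamma>) - powr_quot \<gamma> z * (1 / (\<gamma> * (\<gamma> + \<rho>)))) / (- 1 / \<gamma>)\<^sup>2)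
      = \<gamma> / (\<gamma> + \<rho>) * z powr \<gamma> * (z powr \<rho> - 1) / \<rho>"
  proof -
    define Z P \<sigma> where "Z = z powr \<gamma>" and "P = z powr \<rho>" and "\<sigma> = \<gamma> + \<rho>"
    have \<sigma>: "\<sigma> \<noteq> 0" "\<gamma> = \<sigma> - \<rho>" using nz unfolding \<sigma>_def by auto
    have "- ((H z * (- 1 / \<gamma>) - powr_quot \<gamma> z * (1 / (\<gamma> * \<sigma>))) / (- 1 / \<gamma>)\<^sup>2)
        = \<gamma> * H z + \<gamma> * powr_quot \<gamma> z / \<sigma>"
      using nz \<sigma>(1) by (simp add: power2_eq_square field_simps)
    also have "\<dots> = \<gamma> * (((Z * P - 1) / \<sigma> - (Z - 1) / \<gamma>) / \<rho>) + (Z - 1) / \<sigma>"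
      using nz by (simp add: H_def powr_quot_def powr_add Z_def P_def \<sigma>_def)
    also have "\<dots> = \<gamma> * (Z * P - 1) / (\<sigma> * \<rho>) - (Z - 1) / \<rho> + (Z - 1) / \<sigma>"
      using nz by (simp add: right_diff_distrib diff_divide_distrib)
    also have "(Z - 1) / \<rho> - (Z - 1) / \<sigma> = \<gamma> * (Z - 1) / (\<sigma> * \<rho>)"
      using nz(3) \<sigma>(1) by (subst \<sigma>(2)) (simp add: field_simps)
    hence "\<gamma> * (Z * P - 1) / (\<sigma> * \<rho>) - (Z - 1) / \<rho> + (Z - 1) / \<sigma>
        = \<gamma> * (Z * P - 1) / (\<sigma> * \<rho>) - \<gamma> * (Z - 1) / (\<sigma> * \<rho>)" by linarith
    also have "\<dots> = \<gamma> / \<sigma> * Z * (P - 1) / \<rho>"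
      by (simp add: diff_divide_distrib[symmetric] algebra_simps)
    finally show ?thesis unfolding Z_def P_def \<sigma>_def .
  qed
  have "\<forall>\<^sub>F s in at_top. - ((D s z / (V s / a s) - powr_quot \<gamma> z / (- 1 / \<gamma>)) / A s)
      = (V (s * z) / V s - z powr \<gamma>) / A s"
    using eventually_gt_at_top[of 1]
  proof eventually_elim
    case (elim s)
    have "a s > 0" "V s > 0" using a_pos[OF elim] V_pos[OF elim] by auto
    hence "D s z / (V s / a s) = 1 - V (s * z) / V s" by (simp add: D_def V_def field_simps)
    moreover have "powr_quot \<gamma> z / (- 1 / \<gamma>) = 1 - z powr \<gamma>" using nz by (simp add: powr_quot_def)
    ultimately have "- (D s z / (V s / a s) - powr_quot \<gamma> z / (- 1 / \<gamma>)) = V (s * z) / V s - z powr \<gamma>"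
      by linarith
    thus ?case by (simp only: minus_divide_left)
  qed
  from Lim_transform_eventually[OF L this] show ?thesis unfolding E .
qed

lemma regvar_V: "regvar V \<gamma>"
  unfolding regvar_def
proof (intro conjI allI impI)
  have "U \<in> borel_measurable (restrict_space borel {1<..})"
    by (rule borel_measurable_mono_on_fnc[OF U_mono])
  thus "V \<in> borel_measurable (restrict_space borel {1<..})" unfolding V_def[abs_def] by measurable
  fix z :: real assume z: "z > 0"
  have "((\<lambda>s. (V (s * z) / V s - z powr \<gamma>) / A s * A s + z powr \<gamma>) \<longlongrightarrow>
      \<gamma> / (\<gamma> + \<rho>) * z powr \<gamma> * (z powr \<rho> - 1) / \<rho> * 0 + z powr \<gamma>) at_top"
    by (intro tendsto_intros V_ratio_second z A_lim)
  moreover have "\<forall>\<^sub>F s in at_top. (V (s * z) / V s - z powr \<gamma>) / A s * A s + z powr \<gamma> = V (s * z) / V s"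
    using A_nz by eventually_elim simp
  ultimately show "((\<lambda>s. V (s * z) / V s) \<longlongrightarrow> z powr \<gamma>) at_top" by (simp add: tendsto_cong)
qed (use V_pos in auto)

text \<open>The logarithm \<open>h\<close> of this quotient has increments of order
  \<open>A s\<close> under doubling. Because \<open>\<rho> < 0\<close> these are summable along
  powers of two, so \<open>h\<close> converges there; uniform convergence for \<open>V\<close>
  covers the points in between.\<close>

lemma V_scaled_limit: "\<exists>c>0. ((\<lambda>s. V s / s powr \<gamma>) \<longlongrightarrow> c) at_top"
proof -
  define h where "h s = ln (V s / s powr \<gamma>)" for s
  have hdiff: "h (s * z) - h s = ln (V (s * z) / V s) - \<gamma> * ln z" if "s > 1" "s * z > 1" "z > 0" for s z
    using V_pos[OF that(1)] V_pos[OF that(2)] that by (simp add: h_def ln_div ln_mult ln_powr algebra_simps)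
  obtain C where C: "C > 0" "\<forall>\<^sub>F s in at_top. \<bar>h (s * 2) - h s\<bar> \<le> C * \<bar>A s\<bar>"
  proof -
    define B where "B s = V (s * 2) / V s / 2 powr \<gamma> - 1" for s
    define k where "k = \<gamma> / (\<gamma> + \<rho>) * 2 powr \<gamma> * (2 powr \<rho> - 1) / \<rho> / 2 powr \<gamma>"
    have "((\<lambda>s. (V (s * 2) / V s - 2 powr \<gamma>) / A s / 2 powr \<gamma>) \<longlongrightarrow> k) at_top"
      unfolding k_def by (intro tendsto_divide V_ratio_second tendsto_const) auto
    moreover have "(V (s * 2) / V s - 2 powr \<gamma>) / A s / 2 powr \<gamma> = B s / A s" for s
      by (simp add: B_def diff_divide_distrib mult.commute)
    ultimately have Bl: "((\<lambda>s. B s / A s) \<longlongrightarrow> k) at_top" by simp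
    have "((\<lambda>s. V (s * 2) / V s / 2 powr \<gamma> - 1) \<longlongrightarrow> 2 powr \<gamma> / 2 powr \<gamma> - 1) at_top"
      using regvar_V by (intro tendsto_intros) (auto simp: regvar_def)
    hence B0: "(B \<longlongrightarrow> 0) at_top" by (simp add: B_def[abs_def])
    have "\<forall>\<^sub>F s in at_top. \<bar>B s / A s\<bar> < \<bar>k\<bar> + 1" using order_tendstoD(2)[OF tendsto_rabs[OF Bl], of "\<bar>k\<bar> + 1"] by simp
    moreover have "\<forall>\<^sub>F s in at_top. \<bar>B s\<bar> < 1 / 2" using order_tendstoD(2)[OF tendsto_rabs[OF B0], of "1 / 2"] by simp
    \<comment> \<open>The factor 2 comes from
      \<open>\<bar>ln (1 + B s)\<bar> \<le> 2 * \<bar>B s\<bar>\<close>, valid as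
      \<open>\<bar>B s\<bar> < 1 / 2\<close>; the rest bounds \<open>\<bar>B s / A s\<bar>\<close>,
      whose limit is \<open>\<bar>k\<bar>\<close>.\<close>
    ultimately have "\<forall>\<^sub>F s in at_top. \<bar>h (s * 2) - h s\<bar> \<le> (2 * (\<bar>k\<bar> + 1)) * \<bar>A s\<bar>"
      using eventually_gt_at_top[of 1]
    proof eventually_elim
      case (elim s)
      have p: "V (s * 2) / V s > 0" using V_pos[of s] V_pos[of "s * 2"] elim by simp
      have "h (s * 2) - h s = ln (V (s * 2) / V s) - \<gamma> * ln 2" using hdiff[of s 2] elim by simp
      also have "\<dots> = ln (V (s * 2) / V s / 2 powr \<gamma>)"
      proof -
        have "ln x - \<gamma> * ln 2 = ln (x / 2 powr \<gamma>)" if "x > 0" for x :: real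
          using that by (simp add: ln_div ln_powr)
        thus ?thesis using p .
      qed
      also have "\<dots> = ln (1 + B s)" by (simp add: B_def)
      finally have "\<bar>h (s * 2) - h s\<bar> = \<bar>ln (1 + B s)\<bar>" by simp
      also have "\<dots> \<le> \<bar>B s\<bar> + 2 * (B s)\<^sup>2"
        using abs_ln_one_plus_x_minus_x_bound[of "B s"] elim by linarith
      also have "2 * (B s)\<^sup>2 = 2 * \<bar>B s\<bar> * \<bar>B s\<bar>" by (simp add: power2_eq_square)
      also have "2 * \<bar>B s\<bar> * \<bar>B s\<bar> \<le> 1 * \<bar>B s\<bar>" using elim by (intro mult_right_mono) auto
      also have "\<bar>B s\<bar> \<le> (\<bar>k\<bar> + 1) * \<bar>A s\<bar>"
        using elim A_nonzero[of s] by (simp add: abs_divide pos_divide_less_eq)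
      finally show ?case by (simp add: algebra_simps)
    qed
    thus ?thesis using that[of "2 * (\<bar>k\<bar> + 1)"] by simp
  qed
  define l where "l = (1 + 2 powr \<rho>) / 2"
  have l: "0 < l" "l < 1" "2 powr \<rho> < l" using powr_less_mono[of \<rho> 0 2] rho unfolding l_def
    by (auto intro: add_pos_pos)
  have "((\<lambda>s. \<bar>A (s * 2) / A s\<bar>) \<longlongrightarrow> \<bar>2 powr \<rho>\<bar>) at_top" by (intro tendsto_rabs A_ratio) simp
  from order_tendstoD(2)[OF this, of l] l
  have "\<forall>\<^sub>F s in at_top. \<bar>A (s * 2) / A s\<bar> < l" by simp
  hence "\<forall>\<^sub>F s in at_top. \<bar>A (s * 2)\<bar> \<le> l * \<bar>A s\<bar> \<and> s > 1"
    using A_nz eventually_gt_at_top[of 1] by eventually_elim (simp add: abs_divide pos_divide_less_eq)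
  from eventually_conj[OF this C(2)]
  obtain s0 where s0: "\<forall>s\<ge>s0. (\<bar>A (s * 2)\<bar> \<le> l * \<bar>A s\<bar> \<and> s > 1) \<and> \<bar>h (s * 2) - h s\<bar> \<le> C * \<bar>A s\<bar>"
    unfolding eventually_at_top_linorder ..
  hence s01: "s0 > 1" by simp
  define u where "u n = s0 * 2 ^ n" for n :: nat
  have u: "u n \<ge> s0" "u (Suc n) = u n * 2" for n using s01 by (auto simp: u_def)
  have An: "\<bar>A (u n)\<bar> \<le> l ^ n * \<bar>A s0\<bar>" for n
  proof (induction n)
    case (Suc n)
    have "\<bar>A (u (Suc n))\<bar> \<le> l * \<bar>A (u n)\<bar>" using s0 u[of n] by simp
    also have "\<dots> \<le> l * (l ^ n * \<bar>A s0\<bar>)" using Suc l by (intro mult_left_mono) auto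
    finally show ?case by simp
  qed (simp add: u_def)
  define y where "y n = h (u n)" for n
  have ydiff: "norm (y (Suc n) - y n) \<le> C * \<bar>A s0\<bar> * l ^ n" for n
  proof -
    have "\<bar>y (Suc n) - y n\<bar> \<le> C * \<bar>A (u n)\<bar>" using s0 u[of n] by (simp add: y_def)
    also have "\<dots> \<le> C * (l ^ n * \<bar>A s0\<bar>)" using An C by (intro mult_left_mono) auto
    finally show ?thesis by (simp add: mult_ac)
  qed
  have "summable (\<lambda>n. y (Suc n) - y n)"
    by (rule summable_comparison_test'[where N = 0, OF _ ydiff]) (use l in \<open>auto intro!: summable_mult summable_geometric\<close>)
  from summable_LIMSEQ[OF this]
  have "(\<lambda>n. y n - y 0) \<longlonglongrightarrow> (\<Sum>n. y (Suc n) - y n)" by (simp only: sum_lessThan_telescope)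
  from tendsto_add[OF this tendsto_const, of "y 0"]
  obtain L where L: "y \<longlonglongrightarrow> L" by auto
  have "(h \<longlongrightarrow> L) at_top"
  proof (rule tendstoI)
    fix e :: real assume e: "e > 0"
    obtain N where N: "\<forall>n\<ge>N. \<bar>y n - L\<bar> < e / 2"
      using LIMSEQ_D[OF L, of "e / 2"] e by auto
    have "\<forall>\<^sub>F s in at_top. \<forall>z. 1 / 2 \<le> z \<and> z \<le> 2 \<longrightarrow> \<bar>ln (V (s * z) / V s) - \<gamma> * ln z\<bar> < e / 2"
      using regvar_uniform[OF regvar_V, of "e / 2" 2] e by simp
    then obtain S where S: "\<forall>s\<ge>S. \<forall>z. 1 / 2 \<le> z \<and> z \<le> 2 \<longrightarrow> \<bar>ln (V (s * z) / V s) - \<gamma> * ln z\<bar> < e / 2"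
      unfolding eventually_at_top_linorder ..
    \<comment> \<open>With \<open>u n \<le> s < 2 * u n\<close>, the two lower bounds on
      \<open>s\<close> force \<open>u n \<ge> S\<close> and \<open>n \<ge> N\<close>, so the local
      and the sequential error each contribute less than \<open>e / 2\<close>.\<close>
    have "\<bar>h s - L\<bar> < e" if s: "s \<ge> max (2 * S) (s0 * 2 ^ N)" for s
    proof -
      have "s0 * 1 \<le> s0 * 2 ^ N" using s01 by (intro mult_left_mono) auto
      also have "\<dots> \<le> s" using s by simp
      finally have "1 \<le> s / s0" using s01 by simp
      then obtain n where n: "2 ^ n \<le> s / s0" "s / s0 < 2 ^ Suc n" using power_of_two_bracket by blast
      have ns: "u n \<le> s" "s < 2 * u n" using n s01 by (simp_all add: u_def pos_le_divide_eq pos_divide_less_eq mult_ac)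
      have u0: "u n > 1" using u(1)[of n] s01 by linarith
      have "s0 * 2 ^ N < s0 * 2 ^ Suc n" using ns s by (simp add: u_def)
      hence "(2::real) ^ N < 2 ^ Suc n" using s01 by simp
      hence "N < Suc n" by (rule power_less_imp_less_exp[rotated]) simp
      hence "N \<le> n" by simp
      hence "\<bar>y n - L\<bar> < e / 2" using N by simp
      moreover have "\<bar>h s - y n\<bar> < e / 2"
      proof -
        define z where "z = s / u n"
        have z: "s = u n * z" "1 / 2 \<le> z" "z \<le> 2" using ns u0 by (simp_all add: z_def pos_le_divide_eq pos_divide_le_eq)
        have "u n \<ge> S" using s ns by simp
        hence "\<bar>ln (V (u n * z) / V (u n)) - \<gamma> * ln z\<bar> < e / 2" using S z by simp
        moreover have "h s - y n = ln (V (u n * z) / V (u n)) - \<gamma> * ln z"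
          using hdiff[of "u n" z] u0 z ns by (simp add: y_def)
        ultimately show ?thesis by simp
      qed
      ultimately show ?thesis by linarith
    qed
    thus "\<forall>\<^sub>F s in at_top. dist (h s) L < e" unfolding eventually_at_top_linorder dist_real_def by blast
  qed
  from tendsto_exp[OF this]
  have L1: "((\<lambda>s. exp (h s)) \<longlongrightarrow> exp L) at_top" .
  have "\<forall>\<^sub>F s in at_top. exp (h s) = V s / s powr \<gamma>"
    using eventually_gt_at_top[of 1] by eventually_elim (simp add: h_def V_pos)
  from Lim_transform_eventually[OF L1 this] show ?thesis by (intro exI[of _ "exp L"]) simp
qed

text \<open>With the constant \<open>c\<close> divided out, the relative error tends to 0 and its
  increments under doubling are known from \<open>V_ratio_second\<close>, so
  \<open>dyadic_tail_limit\<close> applies with \<open>R = A\<close>. The factor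
  \<open>2 powr \<rho> - 1\<close> cancels, leaving a coefficient that does not depend on the
  doubling.\<close>

lemma V_expansion:
  obtains c where "c > 0"
    "((\<lambda>s. (V s / (c * s powr \<gamma>) - 1) / A s) \<longlongrightarrow> \<gamma> / (\<rho> * (\<gamma> + \<rho>))) at_top"
proof -
  obtain c where c: "c > 0" and cl: "((\<lambda>s. V s / s powr \<gamma>) \<longlongrightarrow> c) at_top" using V_scaled_limit by blast
  have nz: "\<gamma> + \<rho> \<noteq> 0" "\<gamma> \<noteq> 0" "\<rho> \<noteq> 0" using gamma rho by auto
  define B where "B s = V s / s powr \<gamma> / c - 1" for s
  define k where "k = \<gamma> / (\<gamma> + \<rho>) * 2 powr \<gamma> * (2 powr \<rho> - 1) / \<rho>"
  have P: "2 powr \<rho> < (1::real)" using powr_less_mono[of \<rho> 0 2] rho by simp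
  have "((\<lambda>s. B s / A s) \<longlongrightarrow> k / 2 powr \<gamma> / (2 powr \<rho> - 1)) at_top"
  proof (rule dyadic_tail_limit[where R = A and f = B and q = "2 powr \<rho>"])
    have "((\<lambda>s. V s / s powr \<gamma> / c - 1) \<longlongrightarrow> c / c - 1) at_top" using c by (intro tendsto_intros cl) auto
    thus "(B \<longlongrightarrow> 0) at_top" using c by (simp add: B_def[abs_def])
    show "((\<lambda>s. A (2 * s) / A s) \<longlongrightarrow> 2 powr \<rho>) at_top" using A_ratio[of 2] by (simp add: mult.commute)
    have "((\<lambda>s. V s / s powr \<gamma> / c * ((V (s * 2) / V s - 2 powr \<gamma>) / A s / 2 powr \<gamma>)) \<longlongrightarrow>
        c / c * (k / 2 powr \<gamma>)) at_top"
      unfolding k_def using c by (intro tendsto_intros cl V_ratio_second) auto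
    moreover have "\<forall>\<^sub>F s in at_top. V s / s powr \<gamma> / c * ((V (s * 2) / V s - 2 powr \<gamma>) / A s / 2 powr \<gamma>)
        = (B (2 * s) - B s) / A s"
      using eventually_gt_at_top[of 1]
    proof eventually_elim
      case (elim s)
      have "V s \<noteq> 0" "s powr \<gamma> \<noteq> 0" using V_pos[OF elim] elim by auto
      hence "V s / s powr \<gamma> / c * ((V (s * 2) / V s - 2 powr \<gamma>) / 2 powr \<gamma>) = B (2 * s) - B s"
        using c elim by (simp add: B_def powr_mult diff_divide_distrib right_diff_distrib mult.commute)
      thus ?case by (metis (no_types, lifting) divide_divide_eq_left mult.commute times_divide_eq_right)
    qed
    ultimately have "((\<lambda>s. (B (2 * s) - B s) / A s) \<longlongrightarrow> c / c * (k / 2 powr \<gamma>)) at_top"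
      by (rule Lim_transform_eventually)
    thus "((\<lambda>s. (B (2 * s) - B s) / A s) \<longlongrightarrow> k / 2 powr \<gamma>) at_top" using c by simp
  qed (use A_lim A_nz P in auto)
  moreover have "k / 2 powr \<gamma> / (2 powr \<rho> - 1) = \<gamma> / (\<rho> * (\<gamma> + \<rho>))"
    using P by (simp add: k_def mult.commute)
  ultimately show ?thesis using that[OF c] by (simp add: B_def mult.commute)
qed

end

section \<open>Expansion of the scaled excess integral\<close>

lemma integral_powr_unit_interval:
  fixes p :: real
  assumes p: "p > 0"
  shows "integrable lborel (\<lambda>v. indicator {0<..<1} v * v powr p)"
    and "(\<integral>v. indicator {0<..<1} v * v powr p \<partial>lborel) = 1 / (p + 1)"
proof -
  have si: "set_integrable lborel {0<..<1} (\<lambda>v. v powr p)"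
    unfolding set_integrable_def
  proof (rule Bochner_Integration.integrable_bound)
    show "integrable lborel (indicator {0<..<1} :: real \<Rightarrow> real)" by (simp add: integrable_real_indicator)
    show "AE v in lborel. norm (indicator {0<..<1} v *\<^sub>R v powr p) \<le> norm (indicator {0<..<1} v :: real)"
      using p by (intro AE_I2) (auto simp: indicator_def intro!: powr_le1)
  qed simp
  thus "integrable lborel (\<lambda>v. indicator {0<..<1} v * v powr p)" by (simp add: set_integrable_def)
  have "((\<lambda>v. v powr p) has_integral (1 powr (p + 1) / (p + 1))) {0..1}"
    using p by (intro has_integral_powr_from_0) auto
  hence "integral {0<..<1} (\<lambda>v. v powr p) = 1 / (p + 1)"
    by (simp add: has_integral_Icc_iff_Ioo integral_unique)
  thus "(\<integral>v. indicator {0<..<1} v * v powr p \<partial>lborel) = 1 / (p + 1)"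
    using set_borel_integral_eq_integral(2)[OF si] by (simp add: set_lebesgue_integral_def)
qed

context second_order_tail
begin

text \<open>The integrand tends to the positive part of \<open>1 - v powr (- \<gamma>)\<close>,
  which lives on \<open>(0, 1)\<close> and integrates to
  \<open>1 - 1 / (1 - \<gamma>) = - \<gamma> / (1 - \<gamma>)\<close>. There the error relative to
  \<open>A s\<close> tends to \<open>- b * v powr (- \<gamma> - \<rho>)\<close>, because
  \<open>A (s / v) / A s\<close> tends to \<open>v powr (- \<rho>)\<close>. The kink at
  \<open>v = 1\<close> is a null set.\<close>

lemma scaled_excess_expansion:
  assumes c: "c > 0"
    and exp: "((\<lambda>s. (V s / (c * s powr \<gamma>) - 1) / A s) \<longlongrightarrow> b) at_top"
  shows "((\<lambda>s. ((\<integral>v. indicator {0<..<s} v * max 0 (1 - V (s / v) / (c * s powr \<gamma>)) \<partial>lborel)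
      - (- \<gamma> / (1 - \<gamma>))) / A s) \<longlongrightarrow> - b / (1 - \<gamma> - \<rho>)) at_top"
proof -
  define B where "B s = V s / (c * s powr \<gamma>) - 1" for s
  define W where "W s v = V (s / v) / (c * s powr \<gamma>)" for s v
  have WB: "W s v = v powr (- \<gamma>) * (1 + B (s / v))" if "s > 0" "v > 0" for s v
    using that c by (simp add: W_def B_def powr_divide powr_minus field_simps)
  have Bl: "((\<lambda>s. B s / A s) \<longlongrightarrow> b) at_top" using exp unfolding B_def .
  have B0: "(B \<longlongrightarrow> 0) at_top"
  proof -
    have "((\<lambda>s. B s / A s * A s) \<longlongrightarrow> b * 0) at_top" by (intro tendsto_intros Bl A_lim)
    moreover have "\<forall>\<^sub>F s in at_top. B s / A s * A s = B s" using A_nz by eventually_elim simp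
    ultimately show ?thesis by (simp add: tendsto_cong)
  qed
  have at_top_div: "filterlim (\<lambda>s. s / v) at_top (at_top :: real filter)" if "v > 0" for v :: real
    using scale_at_top[of "1 / v"] that by simp
  have Wl: "((\<lambda>s. W s v) \<longlongrightarrow> v powr (- \<gamma>)) at_top" if v: "v > 0" for v
  proof -
    have "((\<lambda>s. v powr (- \<gamma>) * (1 + B (s / v))) \<longlongrightarrow> v powr (- \<gamma>) * (1 + 0)) at_top"
      by (intro tendsto_intros filterlim_compose[OF B0 at_top_div[OF v]])
    moreover have "\<forall>\<^sub>F s in at_top. v powr (- \<gamma>) * (1 + B (s / v)) = W s v"
      using eventually_gt_at_top[of 0] by eventually_elim (simp add: WB v)
    ultimately show ?thesis by (simp add: tendsto_cong)
  qed
  define J where "J s = (\<integral>v. indicator {0<..<s} v * max 0 (1 - W s v) \<partial>lborel)" for s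
  \<comment> \<open>The cut at 2 leaves room beyond the kink at 1 and keeps
    \<open>s / v > s / 2\<close>, so the bounds on \<open>A\<close> and \<open>B\<close> at infinity
    hold for all relevant \<open>v\<close> at once.\<close>
  define k where "k s v = indicator {0<..<2} v * ((max 0 (1 - W s v) - max 0 (1 - v powr (- \<gamma>))) / A s)" for s v
  define f where "f v = - b * (indicator {0<..<1} v * v powr (- \<gamma> - \<rho>))" for v :: real
  obtain C1 where C1: "C1 > 0" "\<forall>\<^sub>F s in at_top. \<bar>B s\<bar> \<le> C1 * \<bar>A s\<bar>"
  proof -
    have "\<forall>\<^sub>F s in at_top. \<bar>B s / A s\<bar> < \<bar>b\<bar> + 1" using order_tendstoD(2)[OF tendsto_rabs[OF Bl], of "\<bar>b\<bar> + 1"] by simp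
    hence "\<forall>\<^sub>F s in at_top. \<bar>B s\<bar> \<le> (\<bar>b\<bar> + 1) * \<bar>A s\<bar>" using A_nz
      by eventually_elim (simp add: abs_divide pos_divide_less_eq)
    thus ?thesis using that[of "\<bar>b\<bar> + 1"] by simp
  qed
  obtain C2 where C2: "C2 > 0" "\<forall>\<^sub>F s in at_top. \<forall>z\<ge>1/2. \<bar>A (s * z)\<bar> \<le> C2 * \<bar>A s\<bar>"
    using regvar_neg_bounded[OF regvar_A rho] by blast
  \<comment> \<open>Extension by 0 gives a Borel function. It does not alter \<open>k s\<close>,
    since \<open>s \<ge> 2\<close> and \<open>v < 2\<close> force \<open>s / v > 1\<close>.\<close>
  define V' where "V' t = (if t \<in> {1<..} then V t else 0)" for t
  have V'm [measurable]: "V' \<in> borel_measurable borel"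
    unfolding V'_def using regvar_V
    by (subst measurable_If_restrict_space_iff) (auto simp: regvar_def greaterThan_def)
  have km: "k s \<in> borel_measurable borel" if "s \<ge> 2" for s
  proof -
    have "k s = (\<lambda>v. indicator {0<..<2} v * ((max 0 (1 - V' (s / v) / (c * s powr \<gamma>)) - max 0 (1 - v powr (- \<gamma>))) / A s))"
      using that by (intro ext) (auto simp: k_def W_def V'_def indicator_def pos_less_divide_eq)
    also have "\<dots> \<in> borel_measurable borel" by measurable
    finally show ?thesis .
  qed
  have kb: "\<forall>\<^sub>F s in at_top. \<forall>v. norm (k s v) \<le> indicator {0<..<2} v * (2 powr (- \<gamma>) * C1 * C2)"
  proof -
    obtain s1 where s1: "\<forall>s\<ge>s1. \<bar>B s\<bar> \<le> C1 * \<bar>A s\<bar>" using C1(2) unfolding eventually_at_top_linorder ..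
    show ?thesis
      using C2(2) eventually_ge_at_top[of "2 * s1"] eventually_gt_at_top[of 2]
    proof eventually_elim
      case (elim s)
      show ?case
      proof
        fix v :: real
        show "norm (k s v) \<le> indicator {0<..<2} v * (2 powr (- \<gamma>) * C1 * C2)"
        proof (cases "v \<in> {0<..<2}")
          case True
          hence v: "v > 0" "v < 2" by auto
          have A: "\<bar>A s\<bar> > 0" using A_nonzero[of s] elim by simp
          have "\<bar>max 0 (1 - W s v) - max 0 (1 - v powr (- \<gamma>))\<bar> \<le> \<bar>W s v - v powr (- \<gamma>)\<bar>" by linarith
          also have "W s v - v powr (- \<gamma>) = v powr (- \<gamma>) * B (s / v)"
            using v elim by (simp add: WB algebra_simps)
          also have "\<bar>v powr (- \<gamma>) * B (s / v)\<bar> = v powr (- \<gamma>) * \<bar>B (s / v)\<bar>" by (simp add: abs_mult)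
          also have "\<dots> \<le> 2 powr (- \<gamma>) * (C1 * (C2 * \<bar>A s\<bar>))"
          proof (rule mult_mono)
            show "v powr (- \<gamma>) \<le> 2 powr (- \<gamma>)" using v gamma by (intro powr_mono2) auto
            have "s / 2 \<le> s / v" using v elim by (intro divide_left_mono) auto
            hence "s1 \<le> s / v" using elim by linarith
            hence "\<bar>B (s / v)\<bar> \<le> C1 * \<bar>A (s / v)\<bar>" using s1 by simp
            also have "1 / 2 \<le> 1 / v" using v by (simp add: field_simps)
            hence "\<bar>A (s * (1 / v))\<bar> \<le> C2 * \<bar>A s\<bar>" using elim(1) by blast
            hence "C1 * \<bar>A (s / v)\<bar> \<le> C1 * (C2 * \<bar>A s\<bar>)" using C1(1) by simp
            finally show "\<bar>B (s / v)\<bar> \<le> C1 * (C2 * \<bar>A s\<bar>)" .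
          qed auto
          finally show ?thesis using True A by (simp add: k_def abs_divide pos_divide_le_eq mult.assoc)
        qed (simp add: k_def)
      qed
    qed
  qed
  have kl: "((\<lambda>s. k s v) \<longlongrightarrow> f v) at_top" if v1: "v \<noteq> 1" for v
  proof -
    consider "v \<le> 0 \<or> v \<ge> 2" | "0 < v" "v < 1" | "1 < v" "v < 2" using v1 by linarith
    thus ?thesis
    proof cases
      case 1 thus ?thesis by (auto simp: k_def f_def)
    next
      case 2
      have "v powr (- \<gamma>) < 1 powr (- \<gamma>)" using 2 gamma by (intro powr_less_mono2) auto
      hence v: "v powr (- \<gamma>) < 1" by simp
      have z: "1 / v > 0" using 2 by simp
      have "((\<lambda>s. - (v powr (- \<gamma>) * (B (s / v) / A (s / v)) * (A (s * (1 / v)) / A s))) \<longlongrightarrow>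
          - (v powr (- \<gamma>) * b * (1 / v) powr \<rho>)) at_top"
        using 2(1) by (intro tendsto_intros filterlim_compose[OF Bl at_top_div] A_ratio) auto
      moreover have "\<forall>\<^sub>F s in at_top. - (v powr (- \<gamma>) * (B (s / v) / A (s / v)) * (A (s * (1 / v)) / A s)) = k s v"
        using order_tendstoD(2)[OF Wl[OF 2(1)] v] large_scale[OF z]
      proof eventually_elim
        case (elim s)
        have "A (s / v) \<noteq> 0" using A_nonzero[of "s * (1 / v)"] elim by simp
        moreover have "k s v = (v powr (- \<gamma>) - W s v) / A s" using elim 2 v by (simp add: k_def)
        moreover have "v powr (- \<gamma>) - W s v = - (v powr (- \<gamma>) * B (s / v))"
          using elim 2 by (simp add: WB algebra_simps)
        ultimately show ?case by simp
      qed
      ultimately have "((\<lambda>s. k s v) \<longlongrightarrow> - (v powr (- \<gamma>) * b * (1 / v) powr \<rho>)) at_top"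
        by (rule Lim_transform_eventually)
      moreover have "- (v powr (- \<gamma>) * b * (1 / v) powr \<rho>) = f v"
        using 2 by (simp add: f_def powr_divide powr_diff)
      ultimately show ?thesis by simp
    next
      case 3
      have "1 powr (- \<gamma>) < v powr (- \<gamma>)" using 3 gamma by (intro powr_less_mono2) auto
      hence v: "1 < v powr (- \<gamma>)" by simp
      have "\<forall>\<^sub>F s in at_top. 0 = k s v"
      proof -
        have "\<forall>\<^sub>F s in at_top. 1 < W s v" using 3(1) by (intro order_tendstoD(1)[OF Wl v]) auto
        thus ?thesis by eventually_elim (use v in \<open>simp add: k_def\<close>)
      qed
      from Lim_transform_eventually[OF tendsto_const this] show ?thesis using 3 by (simp add: f_def)
    qed
  qed
  have wi: "integrable lborel (\<lambda>v::real. indicator {0<..<2} v * (2 powr (- \<gamma>) * C1 * C2))"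
    by (intro integrable_mult_left integrable_real_indicator) auto
  \<comment> \<open>Dominated convergence asks for measurability at every \<open>s\<close>;
    \<open>max 2 s\<close> secures it and does not affect the limit.\<close>
  have lim: "((\<lambda>s. \<integral>v. k (max 2 s) v \<partial>lborel) \<longlongrightarrow> (\<integral>v. f v \<partial>lborel)) at_top"
  proof (rule integral_dominated_convergence_at_top)
    show "f \<in> borel_measurable lborel" unfolding f_def by measurable
    show "k (max 2 s) \<in> borel_measurable lborel" for s using km by simp
    show "integrable lborel (\<lambda>v::real. indicator {0<..<2} v * (2 powr (- \<gamma>) * C1 * C2))" by (rule wi)
    show "\<forall>\<^sub>F s in at_top. AE v in lborel. norm (k (max 2 s) v) \<le> indicator {0<..<2} v * (2 powr (- \<gamma>) * C1 * C2)"
      using kb eventually_gt_at_top[of 2] by eventually_elim (auto simp: max_def)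
    have max2: "filterlim (\<lambda>s::real. max 2 s) at_top at_top"
      by (rule filterlim_at_top_mono[OF filterlim_ident]) (auto intro: always_eventually)
    show "AE v in lborel. ((\<lambda>s. k (max 2 s) v) \<longlongrightarrow> f v) at_top"
      using AE_lborel_singleton[of 1] by eventually_elim (rule filterlim_compose[OF kl max2])
  qed
  have "(\<integral>v. f v \<partial>lborel) = - b * (1 / (- \<gamma> - \<rho> + 1))"
    unfolding f_def using integral_powr_unit_interval[of "- \<gamma> - \<rho>"] gamma rho by simp
  also have "\<dots> = - b / (1 - \<gamma> - \<rho>)" by (simp add: algebra_simps)
  finally have fint: "(\<integral>v. f v \<partial>lborel) = - b / (1 - \<gamma> - \<rho>)" .
  \<comment> \<open>Once \<open>W s 2 > 1\<close>, monotonicity of \<open>V\<close> gives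
    \<open>W s v > 1\<close> for all \<open>v\<close> from 2 up to \<open>s\<close>, so nothing is
    lost by the cut at 2.\<close>
  have "2 powr (- \<gamma>) > (1::real)" using powr_less_mono[of 0 "- \<gamma>" 2] gamma by simp
  hence W2: "\<forall>\<^sub>F s in at_top. 1 < W s 2" by (intro order_tendstoD(1)[OF Wl]) auto
  have "\<forall>\<^sub>F s in at_top. (\<integral>v. k (max 2 s) v \<partial>lborel) = (J s - (- \<gamma> / (1 - \<gamma>))) / A s"
    using W2 kb eventually_gt_at_top[of 2]
  proof eventually_elim
    case (elim s)
    define g where "g v = indicator {0<..<2} v * max 0 (1 - W s v)" for v
    define g0 where "g0 v = indicator {0<..<2} v * max 0 (1 - v powr (- \<gamma>))" for v :: real
    have g0: "g0 v = indicator {0<..<1} v - indicator {0<..<1} v * v powr (- \<gamma>)" for v :: real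
    proof -
      consider "v \<le> 0" | "0 < v" "v < 1" | "v = 1" | "v > 1" by linarith
      thus ?thesis
      proof cases
        case 2
        have "v powr (- \<gamma>) < 1 powr (- \<gamma>)" using 2 gamma by (intro powr_less_mono2) auto
        thus ?thesis using 2 by (simp add: g0_def)
      next
        case 4
        have "1 powr (- \<gamma>) < v powr (- \<gamma>)" using 4 gamma by (intro powr_less_mono2) auto
        thus ?thesis using 4 by (simp add: g0_def)
      qed (auto simp: g0_def)
    qed
    have i1: "integrable lborel (indicator {0<..<1} :: real \<Rightarrow> real)" by (simp add: integrable_real_indicator)
    have i2: "integrable lborel (\<lambda>v. indicator {0<..<1} v * v powr (- \<gamma>))"
      using gamma by (intro integral_powr_unit_interval) auto
    have g0i: "integrable lborel g0" unfolding g0[abs_def] using i1 i2 by (rule Bochner_Integration.integrable_diff)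
    have "(\<integral>v. g0 v \<partial>lborel) = 1 - 1 / (- \<gamma> + 1)"
      unfolding g0 using integral_powr_unit_interval(2)[of "- \<gamma>"] gamma i1 i2
      by (subst Bochner_Integration.integral_diff) auto
    also have "\<dots> = - \<gamma> / (1 - \<gamma>)" using gamma by (simp add: field_simps)
    finally have g0int: "(\<integral>v. g0 v \<partial>lborel) = - \<gamma> / (1 - \<gamma>)" .
    have ki: "integrable lborel (k s)"
    proof (rule Bochner_Integration.integrable_bound)
      show "integrable lborel (\<lambda>v::real. indicator {0<..<2} v * (2 powr (- \<gamma>) * C1 * C2))" by (rule wi)
      show "k s \<in> borel_measurable lborel" using km[of s] elim by simp
      show "AE v in lborel. norm (k s v) \<le> norm (indicator {0<..<2} v * (2 powr (- \<gamma>) * C1 * C2))"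
        unfolding real_norm_def using elim(2)
        by (intro AE_I2 order_trans[OF _ abs_ge_self]) (simp only: real_norm_def)
    qed
    have gk: "g v = k s v * A s + g0 v" for v
      using A_nonzero[of s] elim by (simp add: g_def k_def g0_def right_diff_distrib)
    have "(\<integral>v. g v \<partial>lborel) = (\<integral>v. k s v * A s \<partial>lborel) + (\<integral>v. g0 v \<partial>lborel)"
      unfolding gk using ki g0i by (intro Bochner_Integration.integral_add) auto
    also have "(\<integral>v. k s v * A s \<partial>lborel) = (\<integral>v. k s v \<partial>lborel) * A s" by simp
    also have "(\<integral>v. g v \<partial>lborel) = J s"
      unfolding J_def
    proof (rule Bochner_Integration.integral_cong)
      fix v :: real
      have "max 0 (1 - W s v) = 0" if v: "2 \<le> v" "v < s"
      proof -
        have "V (s / 2) \<le> V (s / v)" using v elim by (intro V_antimono) (auto simp: field_simps)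
        hence "W s 2 \<le> W s v" unfolding W_def using c by (intro divide_right_mono) auto
        thus ?thesis using elim by simp
      qed
      thus "g v = indicator {0<..<s} v * max 0 (1 - W s v)"
        using elim by (auto simp: g_def indicator_def not_less)
    qed simp
    finally have "J s = (\<integral>v. k s v \<partial>lborel) * A s + - \<gamma> / (1 - \<gamma>)" unfolding g0int .
    thus ?case using A_nonzero[of s] elim by (simp add: max_def)
  qed
  from Lim_transform_eventually[OF lim this] show ?thesis unfolding fint J_def W_def .
qed

end

section \<open>Expectiles and quantiles\<close>

text \<open>The derivative of \<open>expectile_loss \<tau>\<close> at \<open>y\<close>.\<close>

definition expectile_slope :: "real \<Rightarrow> real \<Rightarrow> real" where
  "expectile_slope \<tau> y = 2 * (\<tau> * max 0 y - (1 - \<tau>) * max 0 (- y))"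

text \<open>For \<open>\<tau> \<ge> 1 / 2\<close> the curvature of the loss lies between
  \<open>2 * (1 - \<tau>)\<close> and \<open>2 * \<tau>\<close>. The lower bound is the strong
  convexity that identifies the minimiser; both bounds together give integrability of loss
  differences.\<close>

lemma expectile_loss_shift:
  assumes t: "1 / 2 \<le> \<tau>" "\<tau> \<le> 1"
  shows "expectile_loss \<tau> (y - h) - expectile_loss \<tau> y \<ge> (1 - \<tau>) * h\<^sup>2 - h * expectile_slope \<tau> y"
    and "expectile_loss \<tau> (y - h) - expectile_loss \<tau> y \<le> \<tau> * h\<^sup>2 - h * expectile_slope \<tau> y"
proof -
  have L: "expectile_loss \<tau> z = (if z \<le> 0 then (1 - \<tau>) * z\<^sup>2 else \<tau> * z\<^sup>2)" for z
    using t by (simp add: expectile_loss_def)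
  consider "y \<le> 0" "y - h \<le> 0" | "y > 0" "y - h > 0" | "y \<le> 0" "y - h > 0" | "y > 0" "y - h \<le> 0" by linarith
  hence "expectile_loss \<tau> (y - h) - expectile_loss \<tau> y \<ge> (1 - \<tau>) * h\<^sup>2 - h * expectile_slope \<tau> y \<and>
      expectile_loss \<tau> (y - h) - expectile_loss \<tau> y \<le> \<tau> * h\<^sup>2 - h * expectile_slope \<tau> y"
  proof cases
    case 1
    have "(2 * \<tau> - 1) * h\<^sup>2 \<ge> 0" using t by simp
    moreover have "expectile_loss \<tau> (y - h) - expectile_loss \<tau> y = (1 - \<tau>) * h\<^sup>2 - h * expectile_slope \<tau> y"
      using 1 by (simp add: L expectile_slope_def power2_eq_square algebra_simps)
    ultimately show ?thesis by (simp add: algebra_simps)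
  next
    case 2
    have "(2 * \<tau> - 1) * h\<^sup>2 \<ge> 0" using t by simp
    moreover have "expectile_loss \<tau> (y - h) - expectile_loss \<tau> y = \<tau> * h\<^sup>2 - h * expectile_slope \<tau> y"
      using 2 by (simp add: L expectile_slope_def power2_eq_square algebra_simps)
    ultimately show ?thesis by (simp add: algebra_simps)
  next
    case 3
    \<comment> \<open>\<open>y\<close> lies between \<open>h\<close> and 0, so the part of the shift
      beyond the kink is no longer than \<open>h\<close> itself.\<close>
    have sq: "(y - h)\<^sup>2 \<le> h\<^sup>2" using 3 by (intro abs_le_square_iff[THEN iffD1]) auto
    have "(2 * \<tau> - 1) * (y - h)\<^sup>2 \<ge> 0" "(2 * \<tau> - 1) * (h\<^sup>2 - (y - h)\<^sup>2) \<ge> 0" using t sq by simp_all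
    moreover have "expectile_loss \<tau> (y - h) - expectile_loss \<tau> y
        = (1 - \<tau>) * h\<^sup>2 - h * expectile_slope \<tau> y + (2 * \<tau> - 1) * (y - h)\<^sup>2"
      using 3 by (simp add: L expectile_slope_def power2_eq_square algebra_simps)
    ultimately show ?thesis by (simp add: algebra_simps)
  next
    case 4
    have sq: "(y - h)\<^sup>2 \<le> h\<^sup>2" using 4 by (intro abs_le_square_iff[THEN iffD1]) auto
    have "(2 * \<tau> - 1) * (y - h)\<^sup>2 \<ge> 0" "(2 * \<tau> - 1) * (h\<^sup>2 - (y - h)\<^sup>2) \<ge> 0" using t sq by simp_all
    moreover have "expectile_loss \<tau> (y - h) - expectile_loss \<tau> y
        = \<tau> * h\<^sup>2 - h * expectile_slope \<tau> y - (2 * \<tau> - 1) * (y - h)\<^sup>2"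
      using 4 by (simp add: L expectile_slope_def power2_eq_square algebra_simps)
    ultimately show ?thesis by (simp add: algebra_simps)
  qed
  thus "expectile_loss \<tau> (y - h) - expectile_loss \<tau> y \<ge> (1 - \<tau>) * h\<^sup>2 - h * expectile_slope \<tau> y"
    and "expectile_loss \<tau> (y - h) - expectile_loss \<tau> y \<le> \<tau> * h\<^sup>2 - h * expectile_slope \<tau> y" by auto
qed

context prob_space
begin

lemma integrable_excess:
  fixes X :: "'a \<Rightarrow> real"
  assumes "integrable M X"
  shows "integrable M (\<lambda>\<omega>. max 0 (X \<omega> - \<theta>))" "integrable M (\<lambda>\<omega>. max 0 (\<theta> - X \<omega>))"
  using assms by (auto intro!: Bochner_Integration.integrable_max Bochner_Integration.integrable_diff)

lemma expectation_shortfall: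
  fixes X :: "'a \<Rightarrow> real"
  assumes X: "integrable M X"
  shows "expectation (\<lambda>\<omega>. max 0 (\<theta> - X \<omega>)) = \<theta> - expectation X + expectation (\<lambda>\<omega>. max 0 (X \<omega> - \<theta>))"
proof -
  have "expectation (\<lambda>\<omega>. max 0 (\<theta> - X \<omega>)) = expectation (\<lambda>\<omega>. (\<theta> - X \<omega>) + max 0 (X \<omega> - \<theta>))"
    by (rule arg_cong[of _ _ expectation]) (auto simp: max_def fun_eq_iff)
  also have "\<dots> = expectation (\<lambda>\<omega>. \<theta> - X \<omega>) + expectation (\<lambda>\<omega>. max 0 (X \<omega> - \<theta>))"
    using X integrable_excess[OF X] by (intro Bochner_Integration.integral_add) auto
  also have "expectation (\<lambda>\<omega>. \<theta> - X \<omega>) = \<theta> - expectation X"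
    using X by (simp add: prob_space)
  finally show ?thesis .
qed

text \<open>The balance condition says that the mean slope at \<theta> is zero. Integrating the
  strong convexity bound then leaves the gap \<open>(1 - \<tau>) * (h - \<theta>)\<^sup>2\<close>,
  which gives uniqueness as well, so that the choice made by \<open>arg_min\<close> can only be
  \<theta>.\<close>

lemma expectileI:
  fixes X :: "'a \<Rightarrow> real"
  assumes X: "integrable M X" and t: "1 / 2 \<le> \<tau>" "\<tau> < 1"
    and foc: "\<tau> * expectation (\<lambda>\<omega>. max 0 (X \<omega> - \<theta>)) = (1 - \<tau>) * expectation (\<lambda>\<omega>. max 0 (\<theta> - X \<omega>))"
  shows "expectile M X \<tau> = \<theta>"
proof -
  have [measurable]: "X \<in> borel_measurable M" using X by auto
  have t': "\<tau> \<le> 1" using t by simp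
  note shift = expectile_loss_shift[OF t(1) t']
  define R where "R h = expectation (\<lambda>\<omega>. expectile_loss \<tau> (X \<omega> - h) - expectile_loss \<tau> (X \<omega>))" for h
  have Lm: "(\<lambda>\<omega>. expectile_loss \<tau> (X \<omega> - h)) \<in> borel_measurable M" for h
    unfolding expectile_loss_def by measurable
  have int: "integrable M (\<lambda>\<omega>. expectile_loss \<tau> (X \<omega> - h) - expectile_loss \<tau> (X \<omega>))" for h
  proof (rule Bochner_Integration.integrable_bound)
    show "integrable M (\<lambda>\<omega>. h\<^sup>2 + \<bar>h\<bar> * (2 * \<bar>X \<omega>\<bar>))" using X by auto
    show "AE \<omega> in M. norm (expectile_loss \<tau> (X \<omega> - h) - expectile_loss \<tau> (X \<omega>)) \<le> norm (h\<^sup>2 + \<bar>h\<bar> * (2 * \<bar>X \<omega>\<bar>))"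
    proof (rule AE_I2)
      fix \<omega>
      have "\<bar>expectile_slope \<tau> (X \<omega>)\<bar> \<le> 2 * \<bar>X \<omega>\<bar>"
        using t mult_left_le_one_le[of "\<bar>X \<omega>\<bar>" \<tau>] mult_left_le_one_le[of "\<bar>X \<omega>\<bar>" "1 - \<tau>"]
        by (auto simp: expectile_slope_def max_def abs_mult)
      hence "\<bar>h * expectile_slope \<tau> (X \<omega>)\<bar> \<le> \<bar>h\<bar> * (2 * \<bar>X \<omega>\<bar>)"
        unfolding abs_mult by (intro mult_left_mono) auto
      moreover have "\<tau> * h\<^sup>2 \<le> h\<^sup>2" "0 \<le> (1 - \<tau>) * h\<^sup>2" using t by (auto intro: mult_left_le_one_le)
      ultimately show "norm (expectile_loss \<tau> (X \<omega> - h) - expectile_loss \<tau> (X \<omega>)) \<le> norm (h\<^sup>2 + \<bar>h\<bar> * (2 * \<bar>X \<omega>\<bar>))"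
        using shift[where y = "X \<omega>" and h = h] unfolding real_norm_def by linarith
    qed
    show "(\<lambda>\<omega>. expectile_loss \<tau> (X \<omega> - h) - expectile_loss \<tau> (X \<omega>)) \<in> borel_measurable M"
      using Lm[of h] Lm[of 0] by simp
  qed
  have slope: "integrable M (\<lambda>\<omega>. expectile_slope \<tau> (X \<omega> - \<theta>))"
    "expectation (\<lambda>\<omega>. expectile_slope \<tau> (X \<omega> - \<theta>)) = 0"
    using integrable_excess[OF X, of \<theta>] foc by (auto simp: expectile_slope_def)
  have lower: "R h - R \<theta> \<ge> (1 - \<tau>) * (h - \<theta>)\<^sup>2" for h
  proof -
    have "R h - R \<theta> = expectation (\<lambda>\<omega>. expectile_loss \<tau> (X \<omega> - h) - expectile_loss \<tau> (X \<omega> - \<theta>))"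
      unfolding R_def using Bochner_Integration.integral_diff[OF int[of h] int[of \<theta>]] by simp
    also have "\<dots> \<ge> expectation (\<lambda>\<omega>. (1 - \<tau>) * (h - \<theta>)\<^sup>2 - (h - \<theta>) * expectile_slope \<tau> (X \<omega> - \<theta>))"
    proof (rule integral_mono)
      show "integrable M (\<lambda>\<omega>. (1 - \<tau>) * (h - \<theta>)\<^sup>2 - (h - \<theta>) * expectile_slope \<tau> (X \<omega> - \<theta>))"
        using slope(1) by auto
      show "integrable M (\<lambda>\<omega>. expectile_loss \<tau> (X \<omega> - h) - expectile_loss \<tau> (X \<omega> - \<theta>))"
        using Bochner_Integration.integrable_diff[OF int[of h] int[of \<theta>]] by simp
      show "(1 - \<tau>) * (h - \<theta>)\<^sup>2 - (h - \<theta>) * expectile_slope \<tau> (X \<omega> - \<theta>)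
          \<le> expectile_loss \<tau> (X \<omega> - h) - expectile_loss \<tau> (X \<omega> - \<theta>)" for \<omega>
        using shift(1)[where y = "X \<omega> - \<theta>" and h = "h - \<theta>"] by simp
    qed
    also have "expectation (\<lambda>\<omega>. (1 - \<tau>) * (h - \<theta>)\<^sup>2 - (h - \<theta>) * expectile_slope \<tau> (X \<omega> - \<theta>)) = (1 - \<tau>) * (h - \<theta>)\<^sup>2"
      using slope by (simp add: prob_space)
    finally show ?thesis .
  qed
  have ge: "R \<theta> \<le> R h" for h using lower[of h] t by (smt (verit) mult_nonneg_nonneg zero_le_power2)
  have "R (arg_min R (\<lambda>_. True)) = R \<theta>" by (rule arg_min_equality) (use ge in auto)
  hence "(1 - \<tau>) * (arg_min R (\<lambda>_. True) - \<theta>)\<^sup>2 \<le> 0" using lower[of "arg_min R (\<lambda>_. True)"] by simp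
  hence "(arg_min R (\<lambda>_. True) - \<theta>)\<^sup>2 \<le> 0" using t by (simp add: mult_le_0_iff)
  hence "arg_min R (\<lambda>_. True) = \<theta>" by simp
  thus ?thesis unfolding expectile_def R_def[abs_def] .
qed

text \<open>A root of the first-order condition exists by the intermediate value theorem:
  \<open>g\<close> is at most 0 at the mean, and at \<open>x\<close> the expected excess vanishes,
  so \<open>g\<close> is positive there. \<open>expectation_shortfall\<close> turns the root into
  the balance required by \<open>expectileI\<close>.\<close>

lemma expectile_characterization:
  fixes X :: "'a \<Rightarrow> real"
  assumes X: "integrable M X" and t: "1 / 2 \<le> \<tau>" "\<tau> < 1"
    and x: "AE \<omega> in M. X \<omega> \<le> x" "expectation X < x"
  shows "expectile M X \<tau> < x"
    and "(2 * \<tau> - 1) * expectation (\<lambda>\<omega>. max 0 (X \<omega> - expectile M X \<tau>)) = (1 - \<tau>) * (expectile M X \<tau> - expectation X)"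
proof -
  define \<phi> where "\<phi> \<theta> = expectation (\<lambda>\<omega>. max 0 (X \<omega> - \<theta>))" for \<theta>
  define g where "g \<theta> = (1 - \<tau>) * (\<theta> - expectation X) - (2 * \<tau> - 1) * \<phi> \<theta>" for \<theta>
  have lip: "\<phi> a \<le> \<phi> b + \<bar>a - b\<bar>" for a b
  proof -
    have "\<phi> a \<le> expectation (\<lambda>\<omega>. max 0 (X \<omega> - b) + \<bar>a - b\<bar>)"
      unfolding \<phi>_def using integrable_excess[OF X] by (intro integral_mono) auto
    also have "\<dots> = \<phi> b + \<bar>a - b\<bar>" unfolding \<phi>_def using integrable_excess[OF X] by (simp add: prob_space)
    finally show ?thesis .
  qed
  have "1-lipschitz_on UNIV \<phi>"
  proof (rule lipschitz_onI)
    show "dist (\<phi> a) (\<phi> b) \<le> 1 * dist a b" for a b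
      using lip[of a b] lip[of b a] by (simp add: dist_real_def abs_le_iff abs_minus_commute)
  qed simp
  hence "continuous_on UNIV \<phi>" by (rule lipschitz_on_continuous_on)
  hence cont: "continuous_on {expectation X..x} g" unfolding g_def
    by (intro continuous_intros) (auto intro: continuous_on_subset)
  have \<phi>0: "\<phi> \<theta> \<ge> 0" for \<theta> unfolding \<phi>_def by (intro Bochner_Integration.integral_nonneg) auto
  have "\<phi> x = expectation (\<lambda>_. 0)" unfolding \<phi>_def
  proof (rule integral_cong_AE)
    show "AE \<omega> in M. max 0 (X \<omega> - x) = 0" using x(1) by eventually_elim auto
  qed (use X in auto)
  hence gx: "g x > 0" unfolding g_def using t x by simp
  have gE: "g (expectation X) \<le> 0" unfolding g_def using \<phi>0 t by simp
  obtain \<theta> where \<theta>: "expectation X \<le> \<theta>" "\<theta> \<le> x" "g \<theta> = 0"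
    using IVT'[OF gE less_imp_le[OF gx] less_imp_le[OF x(2)] cont] by auto
  have "\<tau> * \<phi> \<theta> = (1 - \<tau>) * (\<theta> - expectation X + \<phi> \<theta>)" using \<theta>(3) by (simp add: g_def algebra_simps)
  hence e: "expectile M X \<tau> = \<theta>"
    using expectation_shortfall[OF X, of \<theta>] by (intro expectileI[OF X t]) (simp add: \<phi>_def)
  have "\<theta> \<noteq> x" using gx \<theta>(3) by auto
  thus "expectile M X \<tau> < x" using e \<theta> by simp
  show "(2 * \<tau> - 1) * expectation (\<lambda>\<omega>. max 0 (X \<omega> - expectile M X \<tau>)) = (1 - \<tau>) * (expectile M X \<tau> - expectation X)"
    unfolding e using \<theta>(3) by (simp add: g_def \<phi>_def)
qed

section \<open>Quantile transform and right endpoint\<close>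

lemma cdf_distribution_distr: "X \<in> borel_measurable M \<Longrightarrow> cdf_distribution (distr M borel X)"
  by (simp add: cdf_distribution_def real_distribution_distr)

lemma quantile_le_iff:
  assumes "X \<in> borel_measurable M" "0 < \<tau>" "\<tau> < 1"
  shows "quantile M X \<tau> \<le> y \<longleftrightarrow> \<tau> \<le> cdf (distr M borel X) y"
proof -
  interpret D: cdf_distribution "distr M borel X" by (rule cdf_distribution_distr) fact
  show ?thesis unfolding quantile_def using D.pseudoinverse[OF assms(2,3), of y] by simp
qed

lemma tail_quantile_le_iff:
  assumes "X \<in> borel_measurable M" "1 < s"
  shows "tail_quantile M X s \<le> y \<longleftrightarrow> 1 - inverse s \<le> cdf (distr M borel X) y"
  unfolding tail_quantile_def using assms by (intro quantile_le_iff) (auto simp: inverse_less_1_iff)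

lemma mono_on_tail_quantile:
  assumes X: "X \<in> borel_measurable M"
  shows "mono_on {1<..} (tail_quantile M X)"
proof (rule mono_onI)
  fix s t :: real assume s: "s \<in> {1<..}" "t \<in> {1<..}" "s \<le> t"
  have "1 - inverse t \<le> cdf (distr M borel X) (tail_quantile M X t)"
    using tail_quantile_le_iff[OF X, of t "tail_quantile M X t"] s by simp
  moreover have "inverse t \<le> inverse s" using s by (intro le_imp_inverse_le) auto
  ultimately show "tail_quantile M X s \<le> tail_quantile M X t"
    using tail_quantile_le_iff[OF X, of s "tail_quantile M X t"] s by simp
qed

text \<open>\<open>X\<close> has the law of its quantile function under the uniform distribution on
  \<open>(0, 1)\<close>, and the substitution \<open>\<omega> = 1 - v / s\<close> turns the level
  into the argument \<open>s / v\<close> of the tail quantile. The scale \<open>s\<close> is free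
  here; it is later tied to the threshold so that the rescaled integrand converges.\<close>

lemma expectation_excess_tail_quantile:
  assumes X: "X \<in> borel_measurable M" and s: "s > 0"
  shows "expectation (\<lambda>\<omega>. max 0 (X \<omega> - \<theta>))
    = (\<integral>v. indicator {0<..<s} v * max 0 (tail_quantile M X (s / v) - \<theta>) \<partial>lborel) / s"
proof -
  interpret D: cdf_distribution "distr M borel X" by (rule cdf_distribution_distr) fact
  let ?f = "\<lambda>y. max 0 (y - \<theta>)"
  let ?q = "\<lambda>\<omega>. Inf {x. \<omega> \<le> cdf (distr M borel X) x}"
  let ?g = "\<lambda>\<omega>. indicator {0<..<1} \<omega> * ?f (?q \<omega>)"
  have "expectation (\<lambda>\<omega>. ?f (X \<omega>)) = (\<integral>y. ?f y \<partial>(distr M borel X))"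
    using X by (subst integral_distr) auto
  also have "\<dots> = (\<integral>y. ?f y \<partial>(distr (restrict_space lborel {0<..<1}) borel ?q))"
    by (simp only: D.distr_I_eq_M)
  also have "\<dots> = (\<integral>\<omega>. ?f (?q \<omega>) \<partial>(restrict_space lborel {0<..<1}))"
    using D.measurable_CI by (intro integral_distr) (auto cong: measurable_cong_sets simp: sets_restrict_space)
  also have "\<dots> = (\<integral>\<omega>. ?g \<omega> \<partial>lborel)"
    by (subst integral_restrict_space) auto
  also have "\<dots> = \<bar>- 1 / s\<bar> *\<^sub>R (\<integral>v. ?g (1 + - 1 / s * v) \<partial>lborel)"
    using s by (intro lborel_integral_real_affine) auto
  also have "(\<integral>v. ?g (1 + - 1 / s * v) \<partial>lborel)
      = (\<integral>v. indicator {0<..<s} v * max 0 (tail_quantile M X (s / v) - \<theta>) \<partial>lborel)"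
  proof (rule Bochner_Integration.integral_cong)
    fix v :: real
    have "1 + - 1 / s * v \<in> {0<..<1} \<longleftrightarrow> v \<in> {0<..<s}" using s by (auto simp: field_simps)
    moreover have "tail_quantile M X (s / v) = ?q (1 + - 1 / s * v)"
      by (simp add: tail_quantile_def quantile_def)
    ultimately show "?g (1 + - 1 / s * v) = indicator {0<..<s} v * max 0 (tail_quantile M X (s / v) - \<theta>)"
      by (simp add: indicator_def)
  qed simp
  finally show ?thesis using s by simp
qed

lemma tail_quantile_limit:
  assumes X: "X \<in> borel_measurable M" and lim: "(tail_quantile M X \<longlongrightarrow> x) at_top"
    and less: "\<And>s. s > 1 \<Longrightarrow> tail_quantile M X s < x"
  shows right_endpoint_eq: "right_endpoint M X = x" and AE_le_endpoint: "AE \<omega> in M. X \<omega> \<le> x"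
    and expectation_less_endpoint: "integrable M X \<Longrightarrow> expectation X < x"
proof -
  let ?F = "cdf (distr M borel X)"
  interpret D: cdf_distribution "distr M borel X" by (rule cdf_distribution_distr) fact
  have lt: "y < x" if y: "?F y < 1" for y
  proof -
    \<comment> \<open>This makes \<open>1 - inverse s\<close> at least the midpoint between
      \<open>?F y\<close> and 1, so \<open>y\<close> lies strictly below the tail quantile at
      \<open>s\<close>; the 2 only ensures \<open>s > 1\<close>.\<close>
    define s where "s = max 2 (1 / (1 - (1 + ?F y) / 2))"
    have F: "0 \<le> ?F y" by (simp add: D.cdf_nonneg)
    have s: "s > 1" unfolding s_def by auto
    have "inverse s \<le> inverse (1 / (1 - (1 + ?F y) / 2))"
      unfolding s_def using y by (intro le_imp_inverse_le) auto
    hence "1 - inverse s > ?F y" using y by (simp add: field_simps)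
    hence "y < tail_quantile M X s" using tail_quantile_le_iff[OF X s, of y] by linarith
    thus ?thesis using less[OF s] by simp
  qed
  have gt: "?F z < 1" if "z < x" for z
  proof -
    have "\<forall>\<^sub>F s in at_top. z < tail_quantile M X s \<and> s > 1"
      using order_tendstoD(1)[OF lim that] eventually_gt_at_top[of 1] by (rule eventually_conj)
    then obtain s where s: "z < tail_quantile M X s" "s > 1"
      unfolding eventually_at_top_linorder by blast
    have "?F z < 1 - inverse s" using tail_quantile_le_iff[OF X s(2), of z] s(1) by linarith
    moreover have "inverse s > 0" using s(2) by simp
    ultimately show ?thesis by linarith
  qed
  have "{y. ?F y < 1} = {..<x}"
  proof -
    have "\<not> ?F x < 1" using lt[of x] by auto
    thus ?thesis using lt gt by auto
  qed
  thus "right_endpoint M X = x" unfolding right_endpoint_def by simp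
  have "?F x = 1" using lt[of x] D.cdf_bounded_prob[of x] by force
  hence "prob {\<omega> \<in> space M. X \<omega> \<le> x} = 1"
    using X by (simp add: cdf_def measure_distr vimage_def Int_def conj_commute)
  thus AE: "AE \<omega> in M. X \<omega> \<le> x" using X by (subst (asm) prob_Collect_eq_1) auto
  show "expectation X < x" if i: "integrable M X"
  proof (rule ccontr)
    assume n: "\<not> expectation X < x"
    have "expectation (\<lambda>\<omega>. x - X \<omega>) = x - expectation X" using i by (simp add: prob_space)
    moreover have nn: "AE \<omega> in M. 0 \<le> x - X \<omega>" using AE by eventually_elim simp
    hence "expectation (\<lambda>\<omega>. x - X \<omega>) \<ge> 0" by (rule integral_nonneg_AE)
    ultimately have "expectation (\<lambda>\<omega>. x - X \<omega>) = 0" using n by linarith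
    hence "AE \<omega> in M. x - X \<omega> = 0" using i nn by (subst (asm) integral_nonneg_eq_0_iff_AE) auto
    \<comment> \<open>If \<open>X\<close> were almost surely equal to \<open>x\<close>, no mass
      would lie at or below the tail quantile at 2, where the distribution function is at least
      1/2.\<close>
    hence "AE \<omega> in M. \<not> X \<omega> \<le> tail_quantile M X 2" by eventually_elim (use less[of 2] in auto)
    hence "prob {\<omega> \<in> space M. X \<omega> \<le> tail_quantile M X 2} = 0"
      using X by (subst prob_Collect_eq_0) auto
    hence "?F (tail_quantile M X 2) = 0"
      using X by (simp add: cdf_def measure_distr vimage_def Int_def conj_commute)
    thus False using tail_quantile_le_iff[OF X, of 2 "tail_quantile M X 2"] by simp
  qed
qed

end

section \<open>Inversion of the first-order condition\<close>

text \<open>The value at \<open>0\<close> is the removable one, so that \<open>exp x - 1 = x * exp_quot x\<close> for all \<open>x\<close>.\<close>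

definition exp_quot :: "real \<Rightarrow> real" where
  "exp_quot x = (if x = 0 then 1 else (exp x - 1) / x)"

definition ln_quot :: "real \<Rightarrow> real" where
  "ln_quot x = (if x = 0 then 1 else ln (1 + x) / x)"

lemma exp_quot: "exp x - 1 = x * exp_quot x"
  by (simp add: exp_quot_def)

lemma ln_quot: "ln (1 + x) = x * ln_quot x"
  by (simp add: ln_quot_def)

lemma tendsto_exp_quot:
  assumes "(f \<longlongrightarrow> 0) F" shows "((\<lambda>x. exp_quot (f x)) \<longlongrightarrow> 1) F"
proof -
  have "((\<lambda>h. (exp (0 + h) - exp 0) / h) \<longlongrightarrow> exp 0) (at (0::real))"
    using DERIV_exp[of 0] by (simp only: DERIV_def)
  hence "(exp_quot \<longlongrightarrow> 1) (at 0)"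
    by (rule Lim_transform_eventually[OF tendsto_eq_rhs]) (auto simp: exp_quot_def eventually_at_filter)
  hence "isCont exp_quot 0" by (simp add: isCont_def exp_quot_def[of 0])
  from isCont_tendsto_compose[OF this assms] show ?thesis by (simp add: exp_quot_def[of 0])
qed

lemma tendsto_ln_quot:
  assumes "(f \<longlongrightarrow> 0) F" shows "((\<lambda>x. ln_quot (f x)) \<longlongrightarrow> 1) F"
proof -
  have "((\<lambda>h. (ln (1 + h) - ln 1) / h) \<longlongrightarrow> inverse 1) (at (0::real))"
    using DERIV_ln[of 1] by (simp only: DERIV_def zero_less_one)
  hence "(ln_quot \<longlongrightarrow> 1) (at 0)"
    by (rule Lim_transform_eventually[OF tendsto_eq_rhs]) (auto simp: ln_quot_def eventually_at_filter)
  hence "isCont ln_quot 0" by (simp add: isCont_def ln_quot_def[of 0])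
  from isCont_tendsto_compose[OF this assms] show ?thesis by (simp add: ln_quot_def[of 0])
qed

lemma tendsto_one_minus_at_left: "((\<lambda>\<tau>::real. 1 - \<tau>) \<longlongrightarrow> 0) (at_left 1)"
  using tendsto_diff[OF tendsto_const tendsto_ident_at, of "1::real" 1 "{..<1}"] by simp

lemma filterlim_inverse_one_minus: "filterlim (\<lambda>\<tau>::real. 1 / (1 - \<tau>)) at_top (at_left 1)"
proof -
  have "\<forall>\<^sub>F \<tau> in at_left (1::real). 1 - \<tau> > 0" by (auto simp: eventually_at_filter)
  from filterlim_inverse_at_top[OF tendsto_one_minus_at_left this] show ?thesis by (simp add: inverse_eq_divide)
qed

context second_order_tail
begin

text \<open>Here \<open>\<Phi> y\<close> stands for the expected excess over
  \<open>endpoint - y\<close>, and \<open>\<eta>\<close> for the distance from the expectile to the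
  endpoint. Logarithms keep all relations exact: \<open>R\<close> and \<open>Q\<close> are genuine
  functions instead of error orders, so \<open>r1\<close> and \<open>r2\<close> can be given by
  formulas.\<close>

lemma inverse_excess_expansion:
  fixes \<Phi> \<eta> :: "real \<Rightarrow> real"
  assumes m: "m > 0" and K: "K = m * (1 - inverse \<gamma>)"
    and \<Phi>: "\<And>s y. s > 0 \<Longrightarrow>
      \<Phi> y = (\<integral>v. indicator {0<..<s} v * max 0 (U (s / v) - (endpoint - y)) \<partial>lborel) / s"
    and \<Phi>_mono: "\<And>y z. y \<le> z \<Longrightarrow> \<Phi> y \<le> \<Phi> z"
    and eq: "\<forall>\<^sub>F \<tau> in at_left 1. \<eta> \<tau> > 0 \<and> (2 * \<tau> - 1) * \<Phi> (\<eta> \<tau>) = (1 - \<tau>) * (m - \<eta> \<tau>)"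
  shows "\<exists>r1 r2. (r1 \<longlongrightarrow> 0) (at_left 1) \<and> (r2 \<longlongrightarrow> 0) (at_left 1) \<and>
    (\<forall>\<^sub>F \<tau> in at_left 1. \<eta> \<tau> = V (1 / (1 - \<tau>)) powr (1 / (1 - \<gamma>)) / K powr (\<gamma> / (1 - \<gamma>)) *
      (1 - (V (1 / (1 - \<tau>)) / K) powr (1 / (1 - \<gamma>)) * (1 + r1 \<tau>)
         + \<gamma> * K powr (- \<rho> / (1 - \<gamma>)) / (\<rho> * (\<gamma> + \<rho>) * (1 - \<gamma> - \<rho>))
           * A (V (1 / (1 - \<tau>)) powr (1 / (1 - \<gamma>)) / (1 - \<tau>)) * (1 + r2 \<tau>)))"
proof -
  let ?F = "at_left (1::real)"
  \<comment> \<open>\<open>e\<close> is the exponent of \<open>x - q\<close>, \<open>p\<close> the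
    limit of \<open>J\<close>, and \<open>b\<close> the coefficient of \<open>A\<close> in the
    expansion of \<open>V\<close>. The relation \<open>e + p = 1\<close> drives the arithmetic of
    exponents; \<open>K powr p\<close> is the reciprocal of the denominator in the claim.\<close>
  define e p b where "e = 1 / (1 - \<gamma>)" and "p = - \<gamma> / (1 - \<gamma>)" and "b = \<gamma> / (\<rho> * (\<gamma> + \<rho>))"
  have e0: "e > 0" and p0: "p > 0" and ep1: "e + p = 1" and eg1: "e * (1 - \<gamma>) = 1" and eg2: "e * \<gamma> = e - 1"
    using gamma unfolding e_def p_def by (auto simp: field_simps)
  have b0: "b \<noteq> 0" using gamma rho unfolding b_def by auto
  have Kmp: "K = m / p" unfolding K p_def using gamma by (simp add: field_simps)
  have K0: "K > 0" unfolding Kmp using m e0 p0 by simp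
  have lnK: "ln K = ln m - ln p" unfolding Kmp using m e0 p0 by (simp add: ln_div)
  obtain c where c: "c > 0" and cexp: "((\<lambda>s. (V s / (c * s powr \<gamma>) - 1) / A s) \<longlongrightarrow> b) at_top"
    using V_expansion unfolding b_def by blast
  define J where "J s = (\<integral>v. indicator {0<..<s} v * max 0 (1 - V (s / v) / (c * s powr \<gamma>)) \<partial>lborel)" for s
  have Jexp: "((\<lambda>s. (J s - p) / A s) \<longlongrightarrow> - b / (1 - \<gamma> - \<rho>)) at_top"
    using scaled_excess_expansion[OF c cexp] unfolding J_def p_def .
  have \<Phi>J: "\<Phi> (c * s powr \<gamma>) = c * s powr \<gamma> / s * J s" if s: "s > 0" for s
  proof -
    define d where "d = c * s powr \<gamma>"
    have d: "d > 0" using c s by (simp add: d_def)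
    have "\<Phi> d = (\<integral>v. d * (indicator {0<..<s} v * max 0 (1 - V (s / v) / d)) \<partial>lborel) / s"
      unfolding \<Phi>[OF s]
    proof (intro arg_cong[where f = "\<lambda>x. x / s"] Bochner_Integration.integral_cong refl)
      fix v
      have "U (s / v) - (endpoint - d) = d * (1 - V (s / v) / d)"
        using d by (simp add: V_def field_simps)
      thus "indicator {0<..<s} v * max 0 (U (s / v) - (endpoint - d)) = d * (indicator {0<..<s} v * max 0 (1 - V (s / v) / d))"
        using d by (simp add: max_def zero_le_mult_iff)
    qed
    thus ?thesis by (simp add: J_def d_def)
  qed
  define T where "T \<tau> = 1 / (1 - \<tau>)" for \<tau> :: real
  have T: "filterlim T at_top ?F" unfolding T_def by (rule filterlim_inverse_one_minus)
  have \<tau>ev: "\<forall>\<^sub>F \<tau> in ?F. 1 / 2 < \<tau> \<and> \<tau> < 1"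
    using eventually_at_left_real[of "1/2" "1::real"] by (auto elim: eventually_mono)
  have \<tau>lim: "((\<lambda>\<tau>. - 2 * (1 - \<tau>)) \<longlongrightarrow> 0) ?F"
    using tendsto_mult[OF tendsto_const tendsto_one_minus_at_left, of "- 2"] by simp

  \<comment> \<open>By the first-order condition \<open>\<Phi> (\<eta> \<tau>)\<close> tends to 0,
    whereas \<Phi> is positive at some \<open>c * s powr \<gamma>\<close> below \<epsilon>;
    monotonicity of \<Phi> then puts \<open>\<eta> \<tau>\<close> below that point.\<close>
  have \<eta>lim: "(\<eta> \<longlongrightarrow> 0) ?F"
  proof (rule tendstoI)
    fix \<epsilon> :: real assume \<epsilon>: "\<epsilon> > 0"
    have J: "(J \<longlongrightarrow> p) at_top"
    proof -
      have "((\<lambda>s. (J s - p) / A s * A s + p) \<longlongrightarrow> - b / (1 - \<gamma> - \<rho>) * 0 + p) at_top"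
        by (intro tendsto_intros Jexp A_lim)
      moreover have "\<forall>\<^sub>F s in at_top. (J s - p) / A s * A s + p = J s" using A_nz by eventually_elim simp
      ultimately show ?thesis by (simp add: tendsto_cong)
    qed
    have "((\<lambda>s. c * s powr \<gamma>) \<longlongrightarrow> c * 0) at_top"
      by (intro tendsto_intros tendsto_neg_powr[OF gamma filterlim_ident])
    hence "\<forall>\<^sub>F s in at_top. c * s powr \<gamma> < \<epsilon>" using order_tendstoD(2)[of _ "c * 0"] \<epsilon> by simp
    from eventually_conj[OF this eventually_conj[OF order_tendstoD(1)[OF J p0] eventually_gt_at_top[of 0]]]
    obtain s where s: "c * s powr \<gamma> < \<epsilon>" "J s > 0" "s > 0"
      unfolding eventually_at_top_linorder by blast
    have pos: "\<Phi> (c * s powr \<gamma>) > 0" unfolding \<Phi>J[OF s(3)] using s c by simp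
    have "((\<lambda>\<tau>::real. (1 - \<tau>) * m / (2 * \<tau> - 1)) \<longlongrightarrow> 0 * m / (2 * 1 - 1)) ?F"
      by (intro tendsto_intros tendsto_one_minus_at_left) auto
    hence "((\<lambda>\<tau>::real. (1 - \<tau>) * m / (2 * \<tau> - 1)) \<longlongrightarrow> 0) ?F" by simp
    from order_tendstoD(2)[OF this pos] eq \<tau>ev
    show "\<forall>\<^sub>F \<tau> in ?F. dist (\<eta> \<tau>) 0 < \<epsilon>"
    proof eventually_elim
      case (elim \<tau>)
      have "(1 - \<tau>) * (m - \<eta> \<tau>) \<le> (1 - \<tau>) * m" using elim by (intro mult_left_mono) auto
      hence "\<Phi> (\<eta> \<tau>) * (2 * \<tau> - 1) \<le> (1 - \<tau>) * m" using elim by (simp add: mult.commute)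
      hence "\<Phi> (\<eta> \<tau>) \<le> (1 - \<tau>) * m / (2 * \<tau> - 1)" using elim by (subst pos_le_divide_eq) auto
      hence "\<Phi> (\<eta> \<tau>) < \<Phi> (c * s powr \<gamma>)" using elim by linarith
      hence "\<eta> \<tau> < c * s powr \<gamma>" using \<Phi>_mono[of "c * s powr \<gamma>" "\<eta> \<tau>"] by linarith
      thus ?case using s elim by simp
    qed
  qed
  have \<eta>pos: "\<forall>\<^sub>F \<tau> in ?F. \<eta> \<tau> > 0" using eq by eventually_elim simp

  \<comment> \<open>The solution of \<open>c * s powr \<gamma> = \<eta>\<close>, so that the
    expansion of \<open>J\<close> applies exactly at the expectile.\<close>
  define s where "s \<tau> = (\<eta> \<tau> / c) powr (1 / \<gamma>)" for \<tau>
  have \<eta>s: "c * s \<tau> powr \<gamma> = \<eta> \<tau>" if "\<eta> \<tau> > 0" for \<tau>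
    using that c gamma by (simp add: s_def powr_powr)
  have s: "filterlim s at_top ?F"
  proof -
    have "((\<lambda>\<tau>. (\<eta> \<tau> / c) powr (- 1 / \<gamma>)) \<longlongrightarrow> 0) ?F"
    proof (rule tendsto_zero_powrI)
      show "((\<lambda>\<tau>. \<eta> \<tau> / c) \<longlongrightarrow> 0) ?F" using tendsto_divide[OF \<eta>lim tendsto_const, of c] c by simp
      show "((\<lambda>\<tau>. - 1 / \<gamma>) \<longlongrightarrow> - 1 / \<gamma>) ?F" by (rule tendsto_const)
      show "\<forall>\<^sub>F \<tau> in ?F. 0 \<le> \<eta> \<tau> / c" using \<eta>pos by eventually_elim (use c in simp)
      show "- 1 / \<gamma> > 0" using gamma by (simp add: zero_less_divide_iff)
    qed
    moreover have "\<forall>\<^sub>F \<tau> in ?F. (\<eta> \<tau> / c) powr (- 1 / \<gamma>) > 0" using \<eta>pos by eventually_elim (use c in simp)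
    ultimately have "filterlim (\<lambda>\<tau>. inverse ((\<eta> \<tau> / c) powr (- 1 / \<gamma>))) at_top ?F" by (rule filterlim_inverse_at_top)
    thus ?thesis by (simp add: s_def[abs_def] powr_minus)
  qed
  have sev: "\<forall>\<^sub>F \<tau> in ?F. s \<tau> > 1" and Tev: "\<forall>\<^sub>F \<tau> in ?F. T \<tau> > 1"
    using s T unfolding filterlim_at_top_dense by auto

  \<comment> \<open>\<open>v\<close> is \<open>x - q\<close>; \<open>\<beta>\<close> and
    \<open>j\<close> are the relative errors of \<open>V\<close> at the quantile scale
    \<open>T\<close> and of \<open>J\<close> at the expectile scale \<open>s\<close>, both tending
    to 1.\<close>
  define v \<beta> j where "v \<tau> = V (T \<tau>)" and "\<beta> \<tau> = V (T \<tau>) / (c * T \<tau> powr \<gamma>)" and "j \<tau> = J (s \<tau>) / p" for \<tau>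
  define g where "g = - b / (1 - \<gamma> - \<rho>) / p"
  have jA: "((\<lambda>\<tau>. (j \<tau> - 1) / A (s \<tau>)) \<longlongrightarrow> g) ?F"
  proof -
    have "((\<lambda>\<tau>. (J (s \<tau>) - p) / A (s \<tau>) / p) \<longlongrightarrow> g) ?F"
      unfolding g_def using e0 p0 by (intro tendsto_divide filterlim_compose[OF Jexp s] tendsto_const) auto
    moreover have "(J (s \<tau>) - p) / A (s \<tau>) / p = (j \<tau> - 1) / A (s \<tau>)" for \<tau>
      using e0 p0 by (simp add: j_def diff_divide_distrib mult.commute)
    ultimately show ?thesis by simp
  qed
  have \<beta>A: "((\<lambda>\<tau>. (\<beta> \<tau> - 1) / A (T \<tau>)) \<longlongrightarrow> b) ?F"
    unfolding \<beta>_def by (rule filterlim_compose[OF cexp T])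
  have As: "((\<lambda>\<tau>. A (s \<tau>)) \<longlongrightarrow> 0) ?F" and AT: "((\<lambda>\<tau>. A (T \<tau>)) \<longlongrightarrow> 0) ?F"
    using filterlim_compose[OF A_lim s] filterlim_compose[OF A_lim T] by auto
  have j1: "((\<lambda>\<tau>. j \<tau> - 1) \<longlongrightarrow> 0) ?F"
  proof -
    have "((\<lambda>\<tau>. (j \<tau> - 1) / A (s \<tau>) * A (s \<tau>)) \<longlongrightarrow> g * 0) ?F" by (intro tendsto_mult jA As)
    moreover have "\<forall>\<^sub>F \<tau> in ?F. (j \<tau> - 1) / A (s \<tau>) * A (s \<tau>) = j \<tau> - 1"
      using sev by eventually_elim (simp add: A_nonzero)
    ultimately show ?thesis by (simp add: tendsto_cong)
  qed
  have \<beta>1: "((\<lambda>\<tau>. \<beta> \<tau> - 1) \<longlongrightarrow> 0) ?F"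
  proof -
    have "((\<lambda>\<tau>. (\<beta> \<tau> - 1) / A (T \<tau>) * A (T \<tau>)) \<longlongrightarrow> b * 0) ?F" by (intro tendsto_mult \<beta>A AT)
    moreover have "\<forall>\<^sub>F \<tau> in ?F. (\<beta> \<tau> - 1) / A (T \<tau>) * A (T \<tau>) = \<beta> \<tau> - 1"
      using Tev by eventually_elim (simp add: A_nonzero)
    ultimately show ?thesis by (simp add: tendsto_cong)
  qed
  define x where "x \<tau> = - \<eta> \<tau> / m" for \<tau>
  have x0: "(x \<longlongrightarrow> 0) ?F"
    unfolding x_def using tendsto_divide[OF tendsto_minus[OF \<eta>lim] tendsto_const, of m] m by simp
  define R where "R \<tau> = ln (1 + x \<tau>) - ln (j \<tau>) - ln (1 + - 2 * (1 - \<tau>))" for \<tau>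
  have ln0: "((\<lambda>\<tau>. ln (1 + f \<tau>)) \<longlongrightarrow> 0) ?F" if "(f \<longlongrightarrow> 0) ?F" for f :: "real \<Rightarrow> real"
    unfolding ln_quot using tendsto_mult[OF that tendsto_ln_quot[OF that]] by simp
  have lnj: "((\<lambda>\<tau>. ln (j \<tau>)) \<longlongrightarrow> 0) ?F" and ln\<beta>: "((\<lambda>\<tau>. ln (\<beta> \<tau>)) \<longlongrightarrow> 0) ?F"
    using ln0[OF j1] ln0[OF \<beta>1] by simp_all
  have R0: "(R \<longlongrightarrow> 0) ?F"
    unfolding R_def using tendsto_diff[OF tendsto_diff[OF ln0[OF x0] lnj] ln0[OF \<tau>lim]] by simp
  \<comment> \<open>The first-order condition gives
    \<open>(1 - \<gamma>) * ln s = ln c + ln T - ln K - R\<close>. Replacing \<open>T\<close> by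
    \<open>v\<close> and \<open>s\<close> by \<open>\<eta>\<close> turns it into
    \<open>ln \<eta> = e * ln v + p * ln K + Q\<close>.\<close>
  define Q where "Q \<tau> = p * R \<tau> - e * ln (\<beta> \<tau>)" for \<tau>
  have Q0: "(Q \<longlongrightarrow> 0) ?F"
    unfolding Q_def using tendsto_diff[OF tendsto_mult[OF tendsto_const R0] tendsto_mult[OF tendsto_const ln\<beta>], of p e] by simp
  \<comment> \<open>The multiplier linking the argument of \<open>A\<close> in the claim to the
    expectile scale: \<open>v powr e * T = s * y\<close>.\<close>
  define y where "y \<tau> = exp (e * ln K + e * ln (\<beta> \<tau>) + e * R \<tau>)" for \<tau>
  have yl: "(y \<longlongrightarrow> K powr e) ?F"
  proof -
    have "((\<lambda>\<tau>. e * ln K + e * ln (\<beta> \<tau>) + e * R \<tau>) \<longlongrightarrow> e * ln K + e * 0 + e * 0) ?F"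
      by (intro tendsto_intros ln\<beta> R0)
    from tendsto_exp[OF this] show ?thesis unfolding y_def using K0 by (simp add: powr_def)
  qed
  have gt1: "\<forall>\<^sub>F \<tau> in ?F. - 1 < f \<tau>" if "(f \<longlongrightarrow> 0) ?F" for f :: "real \<Rightarrow> real"
    by (rule order_tendstoD(1)[OF that]) simp
  have lns: "\<forall>\<^sub>F \<tau> in ?F. v \<tau> > 0 \<and> \<eta> \<tau> = v \<tau> powr e * K powr p * exp (Q \<tau>) \<and> v \<tau> powr e * T \<tau> = s \<tau> * y \<tau>"
    using eq \<tau>ev sev Tev gt1[OF x0] gt1[OF j1] gt1[OF \<beta>1]
  proof eventually_elim
    case (elim \<tau>)
    have \<eta>: "\<eta> \<tau> > 0" and j: "j \<tau> > 0" and \<beta>: "\<beta> \<tau> > 0" and v: "v \<tau> > 0" and st: "s \<tau> > 1" "T \<tau> > 1"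
      using elim V_pos[of "T \<tau>"] by (auto simp: v_def)
    have "\<Phi> (\<eta> \<tau>) = \<eta> \<tau> / s \<tau> * (p * j \<tau>)"
      using \<Phi>J[of "s \<tau>"] \<eta>s[OF \<eta>] elim e0 p0 by (simp add: j_def)
    hence "(1 + - 2 * (1 - \<tau>)) * (\<eta> \<tau> / s \<tau> * (p * j \<tau>)) = (m * (1 + x \<tau>)) / T \<tau>"
      using elim m by (simp add: T_def x_def algebra_simps)
    hence "ln ((1 + - 2 * (1 - \<tau>)) * (\<eta> \<tau> / s \<tau> * (p * j \<tau>))) = ln ((m * (1 + x \<tau>)) / T \<tau>)" by (rule arg_cong)
    moreover have "ln ((1 + - 2 * (1 - \<tau>)) * (\<eta> \<tau> / s \<tau> * (p * j \<tau>)))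
        = ln (1 + - 2 * (1 - \<tau>)) + (ln (\<eta> \<tau>) - ln (s \<tau>) + (ln p + ln (j \<tau>)))"
      using elim \<eta> j st e0 p0 by (simp add: ln_mult ln_div)
    moreover have "ln ((m * (1 + x \<tau>)) / T \<tau>) = ln m + ln (1 + x \<tau>) - ln (T \<tau>)"
      using elim m st by (simp add: ln_mult ln_div)
    moreover have l\<eta>: "ln (\<eta> \<tau>) = ln c + \<gamma> * ln (s \<tau>)"
      unfolding \<eta>s[OF \<eta>, symmetric] using c st by (simp add: ln_mult ln_powr)
    ultimately have main: "(1 - \<gamma>) * ln (s \<tau>) = ln c + ln (T \<tau>) - ln K - R \<tau>"
      unfolding R_def lnK by (simp add: algebra_simps)
    have "v \<tau> = \<beta> \<tau> * (c * T \<tau> powr \<gamma>)" using c st by (simp add: v_def \<beta>_def)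
    hence lv: "ln (v \<tau>) = ln (\<beta> \<tau>) + ln c + \<gamma> * ln (T \<tau>)" using c st \<beta> by (simp add: ln_mult ln_powr)
    have ls: "ln (s \<tau>) = e * (ln c + ln (T \<tau>) - ln K - R \<tau>)"
    proof -
      have "e * ((1 - \<gamma>) * ln (s \<tau>)) = ln (s \<tau>)" using eg1 by (simp add: mult.assoc[symmetric])
      thus ?thesis unfolding main by simp
    qed
    have eg: "\<gamma> * (e * z) = e * z - z" for z
      using eg2 by (metis left_diff_distrib mult.assoc mult.commute mult_1)
    have pe: "p = 1 - e" using ep1 by simp
    have "ln (\<eta> \<tau>) = e * ln (v \<tau>) + p * ln K + Q \<tau>"
      unfolding l\<eta> ls eg lv Q_def pe distrib_left mult.left_commute[of e \<gamma>]
      by (simp add: algebra_simps)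
    hence "\<eta> \<tau> = exp (e * ln (v \<tau>) + p * ln K + Q \<tau>)" using \<eta> by (metis exp_ln)
    hence 1: "\<eta> \<tau> = v \<tau> powr e * K powr p * exp (Q \<tau>)" using v K0 by (simp add: powr_def exp_add)
    have "e * ln (v \<tau>) + ln (T \<tau>) = ln (s \<tau>) + (e * ln K + e * ln (\<beta> \<tau>) + e * R \<tau>)"
      unfolding ls lv distrib_left mult.left_commute[of e \<gamma>] eg by (simp add: algebra_simps)
    hence "exp (e * ln (v \<tau>) + ln (T \<tau>)) = exp (ln (s \<tau>) + (e * ln K + e * ln (\<beta> \<tau>) + e * R \<tau>))" by simp
    hence "v \<tau> powr e * T \<tau> = s \<tau> * y \<tau>" using v st by (simp add: powr_def exp_add y_def)
    thus ?case using v 1 by simp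
  qed

  have vlim: "(v \<longlongrightarrow> 0) ?F" unfolding v_def by (rule filterlim_compose[OF V_lim T])
  \<comment> \<open>\<open>T / s\<close> equals \<open>y / v powr e\<close>, with a positive limit
    above and a vanishing denominator.\<close>
  have Ts: "filterlim (\<lambda>\<tau>. T \<tau> / s \<tau>) at_top ?F"
  proof -
    have "((\<lambda>\<tau>. v \<tau> powr e) \<longlongrightarrow> 0) ?F"
      by (rule tendsto_zero_powrI[OF vlim tendsto_const]) (use lns e0 p0 in \<open>auto elim: eventually_mono\<close>)
    moreover have "\<forall>\<^sub>F \<tau> in ?F. v \<tau> powr e > 0" using lns by eventually_elim simp
    ultimately have "filterlim (\<lambda>\<tau>. inverse (v \<tau> powr e)) at_top ?F" by (rule filterlim_inverse_at_top)
    from filterlim_tendsto_pos_mult_at_top[OF yl _ this]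
    have "filterlim (\<lambda>\<tau>. y \<tau> * inverse (v \<tau> powr e)) at_top ?F" using K0 by simp
    moreover have "\<forall>\<^sub>F \<tau> in ?F. y \<tau> * inverse (v \<tau> powr e) = T \<tau> / s \<tau>"
      using lns sev
    proof eventually_elim
      case (elim \<tau>)
      have "v \<tau> powr e * T \<tau> = s \<tau> * y \<tau>" "v \<tau> powr e > 0" using elim by auto
      thus ?case using elim(2) by (simp add: field_simps)
    qed
    ultimately show ?thesis by (simp add: filterlim_cong)
  qed
  have AsT: "((\<lambda>\<tau>. A (T \<tau>) / A (s \<tau>)) \<longlongrightarrow> 0) ?F"
    using regvar_neg_negligible[OF regvar_A rho s Ts]
    by (simp only: abs_divide[symmetric]) (rule tendsto_rabs_zero_cancel)
  \<comment> \<open>\<open>T * \<eta>\<close> is \<open>s\<close> times a factor with positive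
    limit, hence unbounded; so \<open>ln (2 * \<tau> - 1)\<close> is of smaller order than
    \<open>\<eta>\<close>.\<close>
  have \<eta>T: "((\<lambda>\<tau>. (1 - \<tau>) / \<eta> \<tau>) \<longlongrightarrow> 0) ?F"
  proof -
    have "((\<lambda>\<tau>. y \<tau> * (K powr p * exp (Q \<tau>))) \<longlongrightarrow> K powr e * (K powr p * exp 0)) ?F"
      by (intro tendsto_intros yl Q0)
    from filterlim_tendsto_pos_mult_at_top[OF this _ s]
    have "filterlim (\<lambda>\<tau>. y \<tau> * (K powr p * exp (Q \<tau>)) * s \<tau>) at_top ?F" using K0 by simp
    from filterlim_compose[OF tendsto_inverse_0_at_top[OF filterlim_ident] this]
    have L: "((\<lambda>\<tau>. inverse (y \<tau> * (K powr p * exp (Q \<tau>)) * s \<tau>)) \<longlongrightarrow> 0) ?F" .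
    have "\<forall>\<^sub>F \<tau> in ?F. inverse (y \<tau> * (K powr p * exp (Q \<tau>)) * s \<tau>) = (1 - \<tau>) / \<eta> \<tau>"
      using lns
    proof eventually_elim
      case (elim \<tau>)
      have "y \<tau> * (K powr p * exp (Q \<tau>)) * s \<tau> = (s \<tau> * y \<tau>) * (K powr p * exp (Q \<tau>))" by simp
      also have "\<dots> = (v \<tau> powr e * T \<tau>) * (K powr p * exp (Q \<tau>))" by (simp only: elim)
      also have "\<dots> = T \<tau> * \<eta> \<tau>" by (simp only: elim mult_ac)
      finally have "inverse (y \<tau> * (K powr p * exp (Q \<tau>)) * s \<tau>) = inverse (T \<tau> * \<eta> \<tau>)" by (rule arg_cong)
      thus ?case by (simp only: T_def inverse_mult_distrib inverse_divide) (simp add: divide_inverse)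
    qed
    from Lim_transform_eventually[OF L this] show ?thesis .
  qed

  \<comment> \<open>Coefficients in the exact splitting \<open>Q = \<eta> * q1 + A s * q2\<close>.
    In \<open>q1\<close> only \<open>ln (1 - \<eta> / m)\<close> survives, giving
    \<open>- p / m = - 1 / K\<close>; in \<open>q2\<close> only \<open>ln j\<close> survives, as
    \<open>A T / A s\<close> vanishes.\<close>
  define q1 where "q1 \<tau> = p * (- 1 / m * ln_quot (x \<tau>) - (- 2 * ((1 - \<tau>) / \<eta> \<tau>) * ln_quot (- 2 * (1 - \<tau>))))" for \<tau>
  define q2 where "q2 \<tau> = - p * ((j \<tau> - 1) / A (s \<tau>) * ln_quot (j \<tau> - 1))
     - e * ((\<beta> \<tau> - 1) / A (T \<tau>) * (A (T \<tau>) / A (s \<tau>)) * ln_quot (\<beta> \<tau> - 1))" for \<tau>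
  have q1: "(q1 \<longlongrightarrow> - 1 / K) ?F"
  proof -
    have "(q1 \<longlongrightarrow> p * (- 1 / m * 1 - (- 2 * 0 * 1))) ?F"
      unfolding q1_def by (intro tendsto_intros tendsto_ln_quot x0 \<eta>T \<tau>lim)
    thus ?thesis by (simp add: Kmp)
  qed
  have q2: "(q2 \<longlongrightarrow> b / (1 - \<gamma> - \<rho>)) ?F"
  proof -
    have "(q2 \<longlongrightarrow> - p * (g * 1) - e * (b * 0 * 1)) ?F"
      unfolding q2_def by (intro tendsto_intros tendsto_ln_quot jA \<beta>A AsT j1 \<beta>1)
    moreover have "- p * (g * 1) - e * (b * 0 * 1) = b / (1 - \<gamma> - \<rho>)" using p0 by (simp add: g_def)
    ultimately show ?thesis by simp
  qed
  have Qq: "\<forall>\<^sub>F \<tau> in ?F. Q \<tau> = \<eta> \<tau> * q1 \<tau> + A (s \<tau>) * q2 \<tau>"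
    using \<eta>pos sev Tev
  proof eventually_elim
    case (elim \<tau>)
    have nz: "A (s \<tau>) \<noteq> 0" "A (T \<tau>) \<noteq> 0" "\<eta> \<tau> \<noteq> 0" using elim by (auto simp: A_nonzero)
    have "ln (j \<tau>) = A (s \<tau>) * ((j \<tau> - 1) / A (s \<tau>) * ln_quot (j \<tau> - 1))"
      using nz ln_quot[of "j \<tau> - 1"] by simp
    moreover have "ln (\<beta> \<tau>) = A (s \<tau>) * ((\<beta> \<tau> - 1) / A (T \<tau>) * (A (T \<tau>) / A (s \<tau>)) * ln_quot (\<beta> \<tau> - 1))"
      using nz ln_quot[of "\<beta> \<tau> - 1"] by simp
    moreover have "ln (1 + x \<tau>) = \<eta> \<tau> * (- 1 / m * ln_quot (x \<tau>))"
      unfolding ln_quot by (simp add: x_def)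
    moreover have "ln (1 + - 2 * (1 - \<tau>)) = \<eta> \<tau> * (- 2 * ((1 - \<tau>) / \<eta> \<tau>) * ln_quot (- 2 * (1 - \<tau>)))"
      unfolding ln_quot using nz by simp
    moreover have "p * (E * a1 - C * a2 - E * a3) - e * (C * a4) = E * (p * (a1 - a3)) + C * (- p * a2 - e * a4)"
      for E C a1 a2 a3 a4 by (simp add: algebra_simps)
    ultimately show ?case unfolding Q_def R_def q1_def q2_def by (simp only:)
  qed

  define w where "w \<tau> = v \<tau> powr e * T \<tau>" for \<tau>
  \<comment> \<open>\<open>w = s * y\<close> with \<open>y\<close> tending to
    \<open>K powr e\<close>, so regular variation applies; the constant sign of \<open>A\<close>
    removes the absolute values. This is the origin of the power of \<open>K\<close> in front of
    \<open>A\<close>.\<close>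
  have Aw: "((\<lambda>\<tau>. A (w \<tau>) / A (s \<tau>)) \<longlongrightarrow> K powr (e * \<rho>)) ?F"
  proof -
    have "((\<lambda>\<tau>. \<bar>A (s \<tau> * y \<tau>)\<bar> / \<bar>A (s \<tau>)\<bar>) \<longlongrightarrow> (K powr e) powr \<rho>) ?F"
      by (rule regvar_tendsto[OF regvar_A s yl]) (use K0 in simp)
    moreover have "\<forall>\<^sub>F \<tau> in ?F. \<bar>A (s \<tau> * y \<tau>)\<bar> / \<bar>A (s \<tau>)\<bar> = A (w \<tau>) / A (s \<tau>)"
    proof -
      have "filterlim (\<lambda>\<tau>. y \<tau> * s \<tau>) at_top ?F"
        by (rule filterlim_tendsto_pos_mult_at_top[OF yl _ s]) (use K0 in simp)
      hence "\<forall>\<^sub>F \<tau> in ?F. y \<tau> * s \<tau> > 1" unfolding filterlim_at_top_dense by blast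
      thus ?thesis using lns sev
      proof eventually_elim
        case (elim \<tau>)
        have "w \<tau> = s \<tau> * y \<tau>" "w \<tau> > 1" using elim by (simp_all add: w_def mult.commute)
        thus ?case using A_sign elim(3) by (auto simp: abs_of_pos abs_of_neg)
      qed
    qed
    ultimately show ?thesis by (simp add: tendsto_cong powr_powr)
  qed
  define k where "k = b / (1 - \<gamma> - \<rho>) * K powr (- \<rho> * e)"
  have k: "k \<noteq> 0" using b0 K0 gamma rho unfolding k_def by auto
  \<comment> \<open>Both remainders are obtained by solving
    \<open>exp Q - 1 = Q * exp_quot Q\<close> term by term, using
    \<open>\<eta> = (v / K) powr e * K * exp Q\<close> for the first.\<close>
  define r1 where "r1 \<tau> = - K * exp (Q \<tau>) * q1 \<tau> * exp_quot (Q \<tau>) - 1" for \<tau>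
  define r2 where "r2 \<tau> = q2 \<tau> * exp_quot (Q \<tau>) / (A (w \<tau>) / A (s \<tau>)) / k - 1" for \<tau>
  have r1: "(r1 \<longlongrightarrow> 0) ?F"
  proof -
    have "(r1 \<longlongrightarrow> - K * exp 0 * (- 1 / K) * 1 - 1) ?F"
      unfolding r1_def by (intro tendsto_intros tendsto_exp_quot Q0 q1)
    thus ?thesis using K0 by simp
  qed
  have r2: "(r2 \<longlongrightarrow> 0) ?F"
  proof -
    have L: "(r2 \<longlongrightarrow> b / (1 - \<gamma> - \<rho>) * 1 / K powr (e * \<rho>) / k - 1) ?F"
      unfolding r2_def using K0 k by (intro tendsto_intros tendsto_exp_quot Q0 q2 Aw) auto
    have E: "b / (1 - \<gamma> - \<rho>) * 1 / K powr (e * \<rho>) = k"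
      by (simp add: k_def powr_minus_divide mult.commute)
    show ?thesis using L unfolding E using k by simp
  qed
  have "\<forall>\<^sub>F \<tau> in ?F. A (w \<tau>) / A (s \<tau>) \<noteq> 0" using K0 by (intro tendsto_imp_eventually_ne[OF Aw]) auto
  hence "\<forall>\<^sub>F \<tau> in ?F. \<eta> \<tau> = v \<tau> powr e / K powr (- p) *
      (1 - (v \<tau> / K) powr e * (1 + r1 \<tau>) + k * A (w \<tau>) * (1 + r2 \<tau>))"
    using lns Qq sev
  proof eventually_elim
    case (elim \<tau>)
    have v: "v \<tau> > 0" using elim by simp
    have lead: "\<eta> \<tau> = v \<tau> powr e * K powr p * exp (Q \<tau>)" using elim by simp
    have "exp (Q \<tau>) - 1 = Q \<tau> * exp_quot (Q \<tau>)" by (rule exp_quot)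
    also have "\<dots> = \<eta> \<tau> * q1 \<tau> * exp_quot (Q \<tau>) + A (s \<tau>) * q2 \<tau> * exp_quot (Q \<tau>)"
      using elim(3) by (simp add: distrib_right)
    also have "\<eta> \<tau> * q1 \<tau> * exp_quot (Q \<tau>) = - ((v \<tau> / K) powr e * (1 + r1 \<tau>))"
    proof -
      have "K powr p = K * K powr (- e)"
      proof -
        have "p = 1 + - e" using ep1 by simp
        thus ?thesis using K0 by (simp only: powr_add powr_one)
      qed
      hence "\<eta> \<tau> = (v \<tau> / K) powr e * K * exp (Q \<tau>)"
        using v K0 unfolding lead by (simp add: powr_divide powr_minus field_simps)
      thus ?thesis by (simp add: r1_def)
    qed
    also have "A (s \<tau>) * q2 \<tau> * exp_quot (Q \<tau>) = k * A (w \<tau>) * (1 + r2 \<tau>)"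
      using elim(1) k by (simp add: r2_def field_simps)
    finally have "exp (Q \<tau>) = 1 - (v \<tau> / K) powr e * (1 + r1 \<tau>) + k * A (w \<tau>) * (1 + r2 \<tau>)" by simp
    moreover have "v \<tau> powr e / K powr (- p) = v \<tau> powr e * K powr p"
      using K0 by (simp add: powr_minus divide_inverse)
    ultimately show ?case unfolding lead by simp
  qed
  moreover have "- p = \<gamma> / (1 - \<gamma>)" "w \<tau> = V (1 / (1 - \<tau>)) powr e / (1 - \<tau>)" "v \<tau> = V (1 / (1 - \<tau>))"
    "k = \<gamma> * K powr (- \<rho> / (1 - \<gamma>)) / (\<rho> * (\<gamma> + \<rho>) * (1 - \<gamma> - \<rho>))" for \<tau>
    by (simp_all add: p_def w_def v_def T_def k_def b_def e_def)
  ultimately show ?thesis using r1 r2 unfolding e_def[symmetric] by (intro exI[of _ r1] exI[of _ r2]) simp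
qed

section \<open>Orders of magnitude of the two corrections\<close>

lemma scaled_V_at_left:
  obtains c L where "c > 0" "(L \<longlongrightarrow> c) (at_left 1)"
    "\<forall>\<^sub>F \<tau> in at_left 1. L \<tau> > 0 \<and> V (1 / (1 - \<tau>)) = L \<tau> * (1 - \<tau>) powr (- \<gamma>)"
proof -
  obtain c where c: "c > 0" "((\<lambda>s. V s / s powr \<gamma>) \<longlongrightarrow> c) at_top" using V_scaled_limit by blast
  define L where "L \<tau> = V (1 / (1 - \<tau>)) / (1 / (1 - \<tau>)) powr \<gamma>" for \<tau>
  have L: "(L \<longlongrightarrow> c) (at_left 1)"
    unfolding L_def by (rule filterlim_compose[OF c(2) filterlim_inverse_one_minus])
  have "\<forall>\<^sub>F \<tau> in at_left (1::real). \<tau> < 1" by (auto simp: eventually_at_filter)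
  with order_tendstoD(1)[OF L c(1)]
  have "\<forall>\<^sub>F \<tau> in at_left 1. L \<tau> > 0 \<and> V (1 / (1 - \<tau>)) = L \<tau> * (1 - \<tau>) powr (- \<gamma>)"
  proof eventually_elim
    case (elim \<tau>)
    have "(1 / (1 - \<tau>)) powr \<gamma> = (1 - \<tau>) powr (- \<gamma>)" "(1 - \<tau>) powr (- \<gamma>) \<noteq> 0"
      using elim by (simp_all add: powr_divide powr_minus_divide)
    thus ?case using elim(1) by (simp add: L_def)
  qed
  thus ?thesis using that c L by blast
qed

lemma V_powr_bigo:
  assumes K: "K > 0"
  shows "(\<lambda>\<tau>. (V (1 / (1 - \<tau>)) / K) powr (1 / (1 - \<gamma>))) \<in> O[at_left 1](\<lambda>\<tau>. (1 - \<tau>) powr (- \<gamma> / (1 - \<gamma>)))"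
proof -
  obtain c L where c: "c > 0" and L: "(L \<longlongrightarrow> c) (at_left 1)"
    and ev: "\<forall>\<^sub>F \<tau> in at_left 1. L \<tau> > 0 \<and> V (1 / (1 - \<tau>)) = L \<tau> * (1 - \<tau>) powr (- \<gamma>)"
    by (rule scaled_V_at_left)
  have lt: "\<forall>\<^sub>F \<tau> in at_left (1::real). \<tau> < 1" by (auto simp: eventually_at_filter)
  show ?thesis
  proof (rule bigoI_tendsto)
    have l: "((\<lambda>\<tau>. (L \<tau> / K) powr (1 / (1 - \<gamma>))) \<longlongrightarrow> (c / K) powr (1 / (1 - \<gamma>))) (at_left 1)"
      using c K by (intro tendsto_intros L) auto
    have "\<forall>\<^sub>F \<tau> in at_left 1. (L \<tau> / K) powr (1 / (1 - \<gamma>))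
        = (V (1 / (1 - \<tau>)) / K) powr (1 / (1 - \<gamma>)) / (1 - \<tau>) powr (- \<gamma> / (1 - \<gamma>))"
      using ev lt
    proof eventually_elim
      case (elim \<tau>)
      have "V (1 / (1 - \<tau>)) / K = L \<tau> / K * (1 - \<tau>) powr (- \<gamma>)" using elim by simp
      hence "(V (1 / (1 - \<tau>)) / K) powr (1 / (1 - \<gamma>))
          = (L \<tau> / K) powr (1 / (1 - \<gamma>)) * (1 - \<tau>) powr (- \<gamma> / (1 - \<gamma>))"
        using elim K by (simp only: powr_mult powr_powr) simp
      thus ?case using elim by simp
    qed
    from Lim_transform_eventually[OF l this]
    show "((\<lambda>\<tau>. (V (1 / (1 - \<tau>)) / K) powr (1 / (1 - \<gamma>)) / (1 - \<tau>) powr (- \<gamma> / (1 - \<gamma>)))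
        \<longlongrightarrow> (c / K) powr (1 / (1 - \<gamma>))) (at_left 1)" .
    show "\<forall>\<^sub>F \<tau> in at_left 1. (1 - \<tau>) powr (- \<gamma> / (1 - \<gamma>)) \<noteq> 0"
      using lt by eventually_elim simp
  qed
qed

text \<open>Up to the convergent factor \<open>L powr e\<close>, the two arguments of
  \<open>A\<close> coincide, and such a factor changes a regularly varying function only by a
  bounded ratio.\<close>

lemma A_bigo:
  "(\<lambda>\<tau>. A (V (1 / (1 - \<tau>)) powr (1 / (1 - \<gamma>)) / (1 - \<tau>))) \<in> O[at_left 1](\<lambda>\<tau>. \<bar>A ((1 - \<tau>) powr (- 1 / (1 - \<gamma>)))\<bar>)"
proof -
  define e where "e = 1 / (1 - \<gamma>)"
  \<comment> \<open>\<open>- \<gamma> * e - 1\<close> is the exponent of \<open>1 - \<tau>\<close>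
    in \<open>V powr e / (1 - \<tau>)\<close>.\<close>
  have e0: "e > 0" and eg: "- \<gamma> * e - 1 = - e" using gamma unfolding e_def by (auto simp: field_simps)
  obtain c L where c: "c > 0" and L: "(L \<longlongrightarrow> c) (at_left 1)"
    and ev: "\<forall>\<^sub>F \<tau> in at_left 1. L \<tau> > 0 \<and> V (1 / (1 - \<tau>)) = L \<tau> * (1 - \<tau>) powr (- \<gamma>)"
    by (rule scaled_V_at_left)
  have lt: "\<forall>\<^sub>F \<tau> in at_left (1::real). \<tau> < 1" by (auto simp: eventually_at_filter)
  define t where "t \<tau> = (1 - \<tau>) powr (- e)" for \<tau> :: real
  have t: "filterlim t at_top (at_left 1)"
  proof -
    have "((\<lambda>\<tau>::real. (1 - \<tau>) powr e) \<longlongrightarrow> 0) (at_left 1)"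
      by (rule tendsto_zero_powrI[OF tendsto_one_minus_at_left tendsto_const])
        (use lt e0 in \<open>auto elim: eventually_mono\<close>)
    moreover have "\<forall>\<^sub>F \<tau> in at_left (1::real). (1 - \<tau>) powr e > 0" using lt by eventually_elim simp
    ultimately show ?thesis unfolding t_def powr_minus by (rule filterlim_inverse_at_top)
  qed
  have Ll: "((\<lambda>\<tau>. L \<tau> powr e) \<longlongrightarrow> c powr e) (at_left 1)" using c by (intro tendsto_intros L) auto
  have "(\<lambda>\<tau>. \<bar>A (V (1 / (1 - \<tau>)) powr e / (1 - \<tau>))\<bar>) \<in> O[at_left 1](\<lambda>\<tau>. \<bar>A (t \<tau>)\<bar>)"
  proof (rule bigoI_tendsto)
    have l: "((\<lambda>\<tau>. \<bar>A (t \<tau> * L \<tau> powr e)\<bar> / \<bar>A (t \<tau>)\<bar>) \<longlongrightarrow> (c powr e) powr \<rho>) (at_left 1)"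
      by (rule regvar_tendsto[OF regvar_A t Ll]) (use c in simp)
    have "\<forall>\<^sub>F \<tau> in at_left 1. \<bar>A (t \<tau> * L \<tau> powr e)\<bar> / \<bar>A (t \<tau>)\<bar>
        = \<bar>A (V (1 / (1 - \<tau>)) powr e / (1 - \<tau>))\<bar> / \<bar>A (t \<tau>)\<bar>"
      using ev lt
    proof eventually_elim
      case (elim \<tau>)
      have "V (1 / (1 - \<tau>)) powr e / (1 - \<tau>) = L \<tau> powr e * ((1 - \<tau>) powr (- \<gamma> * e) / (1 - \<tau>) powr 1)"
        using elim by (simp add: powr_mult powr_powr)
      also have "\<dots> = L \<tau> powr e * t \<tau>" by (simp only: powr_diff[symmetric] eg t_def)
      finally show ?case by (simp add: mult.commute)
    qed
    from Lim_transform_eventually[OF l this]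
    show "((\<lambda>\<tau>. \<bar>A (V (1 / (1 - \<tau>)) powr e / (1 - \<tau>))\<bar> / \<bar>A (t \<tau>)\<bar>) \<longlongrightarrow> (c powr e) powr \<rho>) (at_left 1)" .
    show "\<forall>\<^sub>F \<tau> in at_left 1. \<bar>A (t \<tau>)\<bar> \<noteq> 0"
      using filterlim_at_top_dense[THEN iffD1, OF t, rule_format, of 1] by eventually_elim (simp add: A_nonzero)
  qed
  thus ?thesis unfolding t_def e_def by simp
qed

end

theorem proposition1:
  fixes M :: "'a measure" and X :: "'a \<Rightarrow> real"
    and \<gamma> \<rho> :: real and a A :: "real \<Rightarrow> real"
  defines "q \<equiv> quantile M X"
    and "\<xi> \<equiv> expectile M X"
    and "xs \<equiv> right_endpoint M X"
    and "K \<equiv> (right_endpoint M X - integral\<^sup>L M X) * (1 - inverse \<gamma>)"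
  assumes "prob_space M"
    and "X \<in> borel_measurable M"
    and "integrable M (\<lambda>\<omega>. \<bar>min (X \<omega>) 0\<bar>)"
    and "second_order_cond (tail_quantile M X) \<gamma> a \<rho> A"
    and "\<rho> < 0"
  shows
    "(\<exists>r1 r2 :: real \<Rightarrow> real.
        (r1 \<longlongrightarrow> 0) (at_left 1) \<and> (r2 \<longlongrightarrow> 0) (at_left 1) \<and>
        (\<forall>\<^sub>F \<tau> in at_left 1.
           xs - \<xi> \<tau> =
             (xs - q \<tau>) powr (1 / (1 - \<gamma>)) / K powr (\<gamma> / (1 - \<gamma>)) *
             (1 - ((xs - q \<tau>) / K) powr (1 / (1 - \<gamma>)) * (1 + r1 \<tau>)
                + \<gamma> * K powr (- \<rho> / (1 - \<gamma>)) / (\<rho> * (\<gamma> + \<rho>) * (1 - \<gamma> - \<rho>))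
                  * A ((xs - q \<tau>) powr (1 / (1 - \<gamma>)) / (1 - \<tau>)) * (1 + r2 \<tau>))))
     \<and>
     (\<exists>e1 e2 :: real \<Rightarrow> real.
        e1 \<in> O[at_left 1](\<lambda>\<tau>. (1 - \<tau>) powr (- \<gamma> / (1 - \<gamma>))) \<and>
        e2 \<in> O[at_left 1](\<lambda>\<tau>. \<bar>A ((1 - \<tau>) powr (- 1 / (1 - \<gamma>)))\<bar>) \<and>
        (\<forall>\<^sub>F \<tau> in at_left 1.
           xs - \<xi> \<tau> =
             (xs - q \<tau>) powr (1 / (1 - \<gamma>)) / K powr (\<gamma> / (1 - \<gamma>)) *
             (1 + e1 \<tau> + e2 \<tau>)))"
proof -
  interpret prob_space M by fact
  note X = assms(6)
  interpret second_order_tail "tail_quantile M X" a A \<gamma> \<rho>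
    by standard (use mono_on_tail_quantile[OF X] assms in auto)
  define m where "m = endpoint - expectation X"
  have less: "tail_quantile M X s < endpoint" if "s > 1" for s
    using V_pos[OF that] by (simp add: V_def)
  have xs: "xs = endpoint" unfolding xs_def by (rule right_endpoint_eq[OF X U_lim less])
  have X_le: "AE \<omega> in M. X \<omega> \<le> endpoint" by (rule AE_le_endpoint[OF X U_lim less])
  \<comment> \<open>\<open>X\<close> is almost surely bounded above by the endpoint, so
    integrability of the negative part suffices.\<close>
  have int: "integrable M X"
  proof (rule Bochner_Integration.integrable_bound)
    show "integrable M (\<lambda>\<omega>. \<bar>min (X \<omega>) 0\<bar> + \<bar>endpoint\<bar>)" using assms(7) by simp
    show "AE \<omega> in M. norm (X \<omega>) \<le> norm (\<bar>min (X \<omega>) 0\<bar> + \<bar>endpoint\<bar>)"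
      using X_le by eventually_elim auto
  qed (rule X)
  have EX: "expectation X < endpoint" by (rule expectation_less_endpoint[OF X U_lim less int])
  hence m: "m > 0" by (simp add: m_def)
  have K: "K = m * (1 - inverse \<gamma>)" by (simp add: K_def m_def xs[unfolded xs_def])
  have "inverse \<gamma> < 0" using gamma by simp
  hence K0: "K > 0" unfolding K using m by (intro mult_pos_pos) linarith+
  define \<Phi> where "\<Phi> y = expectation (\<lambda>\<omega>. max 0 (X \<omega> - (endpoint - y)))" for y
  have \<Phi>: "\<Phi> y = (\<integral>v. indicator {0<..<s} v * max 0 (tail_quantile M X (s / v) - (endpoint - y)) \<partial>lborel) / s"
    if "s > 0" for s y
    unfolding \<Phi>_def by (rule expectation_excess_tail_quantile[OF X that])
  have \<Phi>_mono: "\<Phi> y \<le> \<Phi> z" if "y \<le> z" for y z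
    unfolding \<Phi>_def using that by (intro integral_mono integrable_excess int) auto
  have \<tau>ev: "\<forall>\<^sub>F \<tau> in at_left 1. 1 / 2 < \<tau> \<and> \<tau> < (1::real)"
    using eventually_at_left_real[of "1/2" "1::real"] by (auto elim: eventually_mono)
  have eq: "\<forall>\<^sub>F \<tau> in at_left 1. xs - \<xi> \<tau> > 0 \<and>
      (2 * \<tau> - 1) * \<Phi> (xs - \<xi> \<tau>) = (1 - \<tau>) * (m - (xs - \<xi> \<tau>))"
    using \<tau>ev
  proof eventually_elim
    case (elim \<tau>)
    note E = expectile_characterization[OF int _ _ X_le EX, of \<tau>]
    show ?case using E elim by (simp add: \<Phi>_def xs \<xi>_def m_def)
  qed
  have q: "V (1 / (1 - \<tau>)) = xs - q \<tau>" for \<tau>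
    by (simp add: V_def xs q_def tail_quantile_def)
  define u where "u \<tau> = ((xs - q \<tau>) / K) powr (1 / (1 - \<gamma>))" for \<tau>
  define k where "k = \<gamma> * K powr (- \<rho> / (1 - \<gamma>)) / (\<rho> * (\<gamma> + \<rho>) * (1 - \<gamma> - \<rho>))"
  define Aw where "Aw \<tau> = A ((xs - q \<tau>) powr (1 / (1 - \<gamma>)) / (1 - \<tau>))" for \<tau>
  obtain r1 r2 where r: "(r1 \<longlongrightarrow> 0) (at_left 1)" "(r2 \<longlongrightarrow> 0) (at_left 1)"
    and expansion: "\<forall>\<^sub>F \<tau> in at_left 1. xs - \<xi> \<tau> =
      (xs - q \<tau>) powr (1 / (1 - \<gamma>)) / K powr (\<gamma> / (1 - \<gamma>)) * (1 - u \<tau> * (1 + r1 \<tau>) + k * Aw \<tau> * (1 + r2 \<tau>))"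
    using inverse_excess_expansion[OF m K \<Phi> \<Phi>_mono eq] unfolding q u_def k_def Aw_def by blast
  \<comment> \<open>The factors \<open>1 + o(1)\<close> are bounded, so the two corrections of the
    full expansion serve directly as \<open>e1\<close> and \<open>e2\<close>.\<close>
  have one: "(\<lambda>\<tau>. 1 + r \<tau>) \<in> O[at_left 1](\<lambda>_. 1)" if "(r \<longlongrightarrow> 0) (at_left 1)" for r :: "real \<Rightarrow> real"
    by (rule bigoI_tendsto[where c = "1 + 0"]) (use that in \<open>auto intro!: tendsto_eq_intros\<close>)
  have e1: "(\<lambda>\<tau>. - (u \<tau> * (1 + r1 \<tau>))) \<in> O[at_left 1](\<lambda>\<tau>. (1 - \<tau>) powr (- \<gamma> / (1 - \<gamma>)))"
    using landau_o.big.mult[OF V_powr_bigo[OF K0, unfolded q, folded u_def] one[OF r(1)]] by simp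
  have e2: "(\<lambda>\<tau>. k * (Aw \<tau> * (1 + r2 \<tau>))) \<in> O[at_left 1](\<lambda>\<tau>. \<bar>A ((1 - \<tau>) powr (- 1 / (1 - \<gamma>)))\<bar>)"
    using landau_o.big.mult[OF A_bigo[unfolded q, folded Aw_def] one[OF r(2)]]
    by (cases "k = 0") simp_all
  have "\<forall>\<^sub>F \<tau> in at_left 1. xs - \<xi> \<tau> =
      (xs - q \<tau>) powr (1 / (1 - \<gamma>)) / K powr (\<gamma> / (1 - \<gamma>)) *
      (1 + - (u \<tau> * (1 + r1 \<tau>)) + k * (Aw \<tau> * (1 + r2 \<tau>)))"
    using expansion by eventually_elim (simp add: mult.assoc)
  with e1 e2 show ?thesis
    using r expansion unfolding u_def k_def Aw_def by blast
qed

end
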